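(* Let $C$ be a coalgebra over a field $k$, and consider the contravariant functors $G,H:\mathcal{M}^C\to\mathrm{mod}\text{-}C^*$ given by $G(M)=\mathrm{Hom}_{C^*}({}_{C^*}M,{}_{C^*}C)$ and $H(M)=\mathrm{Hom}_{C^*}({}_{C^*}M,{}_{C^*}C^* )$. If $C$ is a symmetric coalgebra, then $G$ and $H$ are naturally equivalent (i.e. naturally isomorphic). Conversely, if $C$ is a semiperfect coalgebra and $G\simeq H$, then $C$ is a symmetric coalgebra.
   Context: For a coalgebra $C$ over $k$ with $\Delta(x)=\sum x_1\otimes x_2$, the dual $C^*$ is an algebra with the convolution product $(c^*d^* )(x)=\sum c^*(x_1)d^*(x_2)$. $C$ is a $(C^*,C^* )$-bimodule with $c^*\cdot x=\sum c^*(x_2)x_1$ and $x\cdot c^*=\sum c^*(x_1)x_2$; $C^*$ is a bimodule over itself by multiplication. $C$ is symmetric if there exists an injective morphism $C\to C^*$ of $(C^*,C^* )$-bimodules. $C$ is semiperfect if the injective envelope of every simple left $C$-comodule and of every simple right $C$-comodule is finite dimensional. $\mathcal{M}^C$ is the category of right $C$-comodules; a right $C$-comodule $M$ with coaction $m\mapsto\sum m_0\otimes m_1$ is a left $C^*$-module by $c^*\cdot m=\sum c^*(m_1)m_0$. $\mathrm{mod}\text{-}C^*$ is the category of right $C^*$-modules. The Hom spaces consist of left $C^*$-linear maps. The right $C^*$-module structure on $G(M)$ is $(f\leftarrow c^* )(m)=f(m)\cdot c^*$, and on $H(M)$ it is $(f\leftarrow c^* )(m)=f(m)c^*$ (product in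 $C^*$). On morphisms both functors act by precomposition. *)

theory Defs
  imports "HOL-Algebra.Module" "HOL-Algebra.AbelCoset" "HOL-Library.FuncSet"
begin

section \<open>Linear maps, spans, quotients\<close>

text \<open>
  The record \<open>('r, 'm) module\<close> also stores modules over non-commutative rings: the field
  \<^const>\<open>smult\<close> then holds either a left action, \<open>smult M r m = r m\<close>, or a right action,
  \<open>smult M r m = m r\<close>. The definition below reads correctly in both cases. The fields
  \<open>mult\<close> and \<open>one\<close> of a module record carry no meaning. Maps are extensional, so that
  equal maps are equal as HOL functions.
\<close>

definition Hom_mod ::
  "('r, 'x) ring_scheme \<Rightarrow> ('r, 'm, 'y) module_scheme \<Rightarrow> ('r, 'n, 'z) module_scheme \<Rightarrow> ('m \<Rightarrow> 'n) set"
  where "Hom_mod R M N =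
    {f \<in> carrier M \<rightarrow>\<^sub>E carrier N.
      (\<forall>x\<in>carrier M. \<forall>y\<in>carrier M. f (x \<oplus>\<^bsub>M\<^esub> y) = f x \<oplus>\<^bsub>N\<^esub> f y) \<and>
      (\<forall>r\<in>carrier R. \<forall>x\<in>carrier M. f (r \<odot>\<^bsub>M\<^esub> x) = r \<odot>\<^bsub>N\<^esub> f x)}"

definition left_regular :: "('r, 'x) ring_scheme \<Rightarrow> ('r, 'r) module"
  where "left_regular R = \<lparr>carrier = carrier R, mult = mult R, one = one R,
    zero = zero R, add = add R, smult = (\<lambda>r x. r \<otimes>\<^bsub>R\<^esub> x)\<rparr>"

definition right_regular :: "('r, 'x) ring_scheme \<Rightarrow> ('r, 'r) module"
  where "right_regular R = \<lparr>carrier = carrier R, mult = mult R, one = one R,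
    zero = zero R, add = add R, smult = (\<lambda>r x. x \<otimes>\<^bsub>R\<^esub> r)\<rparr>"

definition module_span ::
  "('k, 'x) ring_scheme \<Rightarrow> ('k, 'm, 'y) module_scheme \<Rightarrow> 'm set \<Rightarrow> 'm set"
  where "module_span k M S = \<Inter>{N. submodule N k M \<and> S \<subseteq> N}"

definition fin_dim :: "('k, 'x) ring_scheme \<Rightarrow> ('k, 'm, 'y) module_scheme \<Rightarrow> bool"
  where "fin_dim k M \<longleftrightarrow> (\<exists>B. finite B \<and> B \<subseteq> carrier M \<and> module_span k M B = carrier M)"

definition quotient_module :: "('k, 'm, 'y) module_scheme \<Rightarrow> 'm set \<Rightarrow> ('k, 'm set) module"
  where "quotient_module M N = \<lparr>carrier = a_rcosets\<^bsub>M\<^esub> N, mult = undefined, one = undefined,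
    zero = N, add = (\<lambda>X Y. X <+>\<^bsub>M\<^esub> Y), smult = (\<lambda>r X. \<Union>x\<in>X. N +>\<^bsub>M\<^esub> (r \<odot>\<^bsub>M\<^esub> x))\<rparr>"

section \<open>Tensor products of vector spaces\<close>

definition free_module :: "('k, 'x) ring_scheme \<Rightarrow> 's set \<Rightarrow> ('k, 's \<Rightarrow> 'k) module"
  where "free_module k S = \<lparr>
    carrier = {a. (\<forall>s. a s \<in> carrier k) \<and> finite {s. a s \<noteq> \<zero>\<^bsub>k\<^esub>} \<and> (\<forall>s. s \<notin> S \<longrightarrow> a s = \<zero>\<^bsub>k\<^esub>)},
    mult = undefined, one = undefined,
    zero = (\<lambda>_. \<zero>\<^bsub>k\<^esub>), add = (\<lambda>a b s. a s \<oplus>\<^bsub>k\<^esub> b s), smult = (\<lambda>r a s. r \<otimes>\<^bsub>k\<^esub> a s)\<rparr>"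

definition free_gen :: "('k, 'x) ring_scheme \<Rightarrow> 's \<Rightarrow> ('s \<Rightarrow> 'k)"
  where "free_gen k s = (\<lambda>t. if t = s then \<one>\<^bsub>k\<^esub> else \<zero>\<^bsub>k\<^esub>)"

definition tensor_relations ::
  "('k, 'x) ring_scheme \<Rightarrow> ('k, 'v, 'y) module_scheme \<Rightarrow> ('k, 'w, 'z) module_scheme \<Rightarrow>
    ('v \<times> 'w \<Rightarrow> 'k) set"
  where "tensor_relations k V W =
    (let F = free_module k (carrier V \<times> carrier W); d = free_gen k in
      {d (v \<oplus>\<^bsub>V\<^esub> v', w) \<ominus>\<^bsub>F\<^esub> (d (v, w) \<oplus>\<^bsub>F\<^esub> d (v', w)) | v v' w.
        v \<in> carrier V \<and> v' \<in> carrier V \<and> w \<in> carrier W} \<union>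
      {d (v, w \<oplus>\<^bsub>W\<^esub> w') \<ominus>\<^bsub>F\<^esub> (d (v, w) \<oplus>\<^bsub>F\<^esub> d (v, w')) | v w w'.
        v \<in> carrier V \<and> w \<in> carrier W \<and> w' \<in> carrier W} \<union>
      {d (r \<odot>\<^bsub>V\<^esub> v, w) \<ominus>\<^bsub>F\<^esub> (r \<odot>\<^bsub>F\<^esub> d (v, w)) | r v w.
        r \<in> carrier k \<and> v \<in> carrier V \<and> w \<in> carrier W} \<union>
      {d (v, r \<odot>\<^bsub>W\<^esub> w) \<ominus>\<^bsub>F\<^esub> (r \<odot>\<^bsub>F\<^esub> d (v, w)) | r v w.
        r \<in> carrier k \<and> v \<in> carrier V \<and> w \<in> carrier W})"

type_synonym ('k, 'v, 'w) tensor = "('v \<times> 'w \<Rightarrow> 'k) set"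

definition tensor_null ::
  "('k, 'x) ring_scheme \<Rightarrow> ('k, 'v, 'y) module_scheme \<Rightarrow> ('k, 'w, 'z) module_scheme \<Rightarrow>
    ('v \<times> 'w \<Rightarrow> 'k) set"
  where "tensor_null k V W =
    module_span k (free_module k (carrier V \<times> carrier W)) (tensor_relations k V W)"

definition tensor ::
  "('k, 'x) ring_scheme \<Rightarrow> ('k, 'v, 'y) module_scheme \<Rightarrow> ('k, 'w, 'z) module_scheme \<Rightarrow>
    ('k, ('k, 'v, 'w) tensor) module"
  where "tensor k V W =
    quotient_module (free_module k (carrier V \<times> carrier W)) (tensor_null k V W)"

definition pure_tensor ::
  "('k, 'x) ring_scheme \<Rightarrow> ('k, 'v, 'y) module_scheme \<Rightarrow> ('k, 'w, 'z) module_scheme \<Rightarrow>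
    'v \<Rightarrow> 'w \<Rightarrow> ('k, 'v, 'w) tensor"
  where "pure_tensor k V W v w =
    tensor_null k V W +>\<^bsub>free_module k (carrier V \<times> carrier W)\<^esub> free_gen k (v, w)"

text \<open>
  \<open>tensor_lift k X \<beta>\<close> is the linear map \<open>v \<otimes> w \<mapsto> \<beta> v w\<close> into \<open>X\<close>, evaluated on a
  representative of the coset. It is used for bilinear \<open>\<beta>\<close> only, where the choice
  of the representative is immaterial. In Sweedler notation \<open>tensor_lift k X \<beta> (\<Delta> x)\<close> is
  \<open>\<Sum> \<beta> x\<^sub>1 x\<^sub>2\<close>.
\<close>

definition tensor_lift ::
  "('k, 'x) ring_scheme \<Rightarrow> ('k, 'n, 'y) module_scheme \<Rightarrow> ('v \<Rightarrow> 'w \<Rightarrow> 'n) \<Rightarrow>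
    ('k, 'v, 'w) tensor \<Rightarrow> 'n"
  where "tensor_lift k X \<beta> t =
    (let a = (SOME a. a \<in> t) in
      \<Oplus>\<^bsub>X\<^esub>p\<in>{p. a p \<noteq> \<zero>\<^bsub>k\<^esub>}. a p \<odot>\<^bsub>X\<^esub> \<beta> (fst p) (snd p))"

text \<open>\<open>tensor_map k V' W' f g\<close> is \<open>f \<otimes> g\<close> with values in \<open>V' \<otimes> W'\<close>.\<close>

definition tensor_map ::
  "('k, 'x) ring_scheme \<Rightarrow> ('k, 'v2, 'y) module_scheme \<Rightarrow> ('k, 'w2, 'z) module_scheme \<Rightarrow>
    ('v \<Rightarrow> 'v2) \<Rightarrow> ('w \<Rightarrow> 'w2) \<Rightarrow> ('k, 'v, 'w) tensor \<Rightarrow> ('k, 'v2, 'w2) tensor"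
  where "tensor_map k V' W' f g =
    tensor_lift k (tensor k V' W') (\<lambda>v w. pure_tensor k V' W' (f v) (g w))"

text \<open>The canonical map \<open>(U \<otimes> V) \<otimes> W \<rightarrow> U \<otimes> (V \<otimes> W)\<close>.\<close>

definition tensor_assoc ::
  "('k, 'x) ring_scheme \<Rightarrow> ('k, 'u, 'a) module_scheme \<Rightarrow> ('k, 'v, 'y) module_scheme \<Rightarrow>
    ('k, 'w, 'z) module_scheme \<Rightarrow>
    ('k, ('k, 'u, 'v) tensor, 'w) tensor \<Rightarrow> ('k, 'u, ('k, 'v, 'w) tensor) tensor"
  where "tensor_assoc k U V W =
    (let T = tensor k U (tensor k V W) in
      tensor_lift k T (\<lambda>t w.
        tensor_lift k T (\<lambda>u v. pure_tensor k U (tensor k V W) u (pure_tensor k V W v w)) t))"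

section \<open>Coalgebras and comodules\<close>

record ('k, 'c) coalgebra = "('k, 'c) module" +
  comult :: "'c \<Rightarrow> ('k, 'c, 'c) tensor"
  counit :: "'c \<Rightarrow> 'k"

locale coalgebra = field k + module k C
  for k :: "('k, 'x) ring_scheme" and C :: "('k, 'c, 'y) coalgebra_scheme" +
  assumes comult_linear: "comult C \<in> Hom_mod k C (tensor k C C)"
    and counit_linear: "counit C \<in> Hom_mod k C (left_regular k)"
    and coassoc: "x \<in> carrier C \<Longrightarrow>
      tensor_assoc k C C C (tensor_map k (tensor k C C) C (comult C) id (comult C x)) =
      tensor_map k C (tensor k C C) id (comult C) (comult C x)"
    and counit_left: "x \<in> carrier C \<Longrightarrow>
      tensor_lift k C (\<lambda>x1 x2. counit C x1 \<odot>\<^bsub>C\<^esub> x2) (comult C x) = x"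
    and counit_right: "x \<in> carrier C \<Longrightarrow>
      tensor_lift k C (\<lambda>x1 x2. counit C x2 \<odot>\<^bsub>C\<^esub> x1) (comult C x) = x"

text \<open>The coaction takes values in \<open>M \<otimes> C\<close> for right and in \<open>C \<otimes> M\<close> for left comodules.\<close>

record ('k, 'm, 't) comodule = "('k, 'm) module" +
  coact :: "'m \<Rightarrow> 't"

type_synonym ('k, 'c, 'm) rcomodule = "('k, 'm, ('k, 'm, 'c) tensor) comodule"
type_synonym ('k, 'c, 'm) lcomodule = "('k, 'm, ('k, 'c, 'm) tensor) comodule"

definition right_comodule ::
  "('k, 'x) ring_scheme \<Rightarrow> ('k, 'c, 'y) coalgebra_scheme \<Rightarrow> ('k, 'c, 'm) rcomodule \<Rightarrow> bool"
  where "right_comodule k C M \<longleftrightarrow>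
    module k M \<and> coact M \<in> Hom_mod k M (tensor k M C) \<and>
    (\<forall>m\<in>carrier M.
      tensor_assoc k M C C (tensor_map k (tensor k M C) C (coact M) id (coact M m)) =
      tensor_map k M (tensor k C C) id (comult C) (coact M m)) \<and>
    (\<forall>m\<in>carrier M. tensor_lift k M (\<lambda>m0 m1. counit C m1 \<odot>\<^bsub>M\<^esub> m0) (coact M m) = m)"

definition left_comodule ::
  "('k, 'x) ring_scheme \<Rightarrow> ('k, 'c, 'y) coalgebra_scheme \<Rightarrow> ('k, 'c, 'm) lcomodule \<Rightarrow> bool"
  where "left_comodule k C M \<longleftrightarrow>
    module k M \<and> coact M \<in> Hom_mod k M (tensor k C M) \<and>
    (\<forall>m\<in>carrier M.
      tensor_assoc k C C M (tensor_map k (tensor k C C) M (comult C) id (coact M m)) =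
      tensor_map k C (tensor k C M) id (coact M) (coact M m)) \<and>
    (\<forall>m\<in>carrier M. tensor_lift k M (\<lambda>m1 m0. counit C m1 \<odot>\<^bsub>M\<^esub> m0) (coact M m) = m)"

definition Hom_rcomod ::
  "('k, 'x) ring_scheme \<Rightarrow> ('k, 'c, 'y) coalgebra_scheme \<Rightarrow>
    ('k, 'c, 'm) rcomodule \<Rightarrow> ('k, 'c, 'n) rcomodule \<Rightarrow> ('m \<Rightarrow> 'n) set"
  where "Hom_rcomod k C M N =
    {f \<in> Hom_mod k M N. \<forall>m\<in>carrier M. coact N (f m) = tensor_map k N C f id (coact M m)}"

definition Hom_lcomod ::
  "('k, 'x) ring_scheme \<Rightarrow> ('k, 'c, 'y) coalgebra_scheme \<Rightarrow>
    ('k, 'c, 'm) lcomodule \<Rightarrow> ('k, 'c, 'n) lcomodule \<Rightarrow> ('m \<Rightarrow> 'n) set"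
  where "Hom_lcomod k C M N =
    {f \<in> Hom_mod k M N. \<forall>m\<in>carrier M. coact N (f m) = tensor_map k C N id f (coact M m)}"

section \<open>Semiperfect coalgebras\<close>

text \<open>
  The next definitions serve left and right comodules alike. The parameters are the class
  \<open>P\<close> of objects and the sets \<open>mor\<close> of morphisms. Objects are those whose carrier is a
  subset of the type \<open>'m\<close>, which therefore plays the role of the universe of the category.
\<close>

definition subcomodule ::
  "(('k, 'm, 't) comodule \<Rightarrow> bool) \<Rightarrow>
    (('k, 'm, 't) comodule \<Rightarrow> ('k, 'm, 't) comodule \<Rightarrow> ('m \<Rightarrow> 'm) set) \<Rightarrow>
    ('k, 'm, 't) comodule \<Rightarrow> ('k, 'm, 't) comodule \<Rightarrow> bool"
  where "subcomodule P mor N M \<longleftrightarrow>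
    P N \<and> carrier N \<subseteq> carrier M \<and> restrict id (carrier N) \<in> mor N M"

definition simple_comodule ::
  "(('k, 'm, 't) comodule \<Rightarrow> bool) \<Rightarrow>
    (('k, 'm, 't) comodule \<Rightarrow> ('k, 'm, 't) comodule \<Rightarrow> ('m \<Rightarrow> 'm) set) \<Rightarrow>
    ('k, 'm, 't) comodule \<Rightarrow> bool"
  where "simple_comodule P mor S \<longleftrightarrow>
    P S \<and> carrier S \<noteq> {\<zero>\<^bsub>S\<^esub>} \<and>
    (\<forall>N. subcomodule P mor N S \<longrightarrow> carrier N = {\<zero>\<^bsub>S\<^esub>} \<or> carrier N = carrier S)"

definition injective_comodule ::
  "(('k, 'm, 't) comodule \<Rightarrow> bool) \<Rightarrow>
    (('k, 'm, 't) comodule \<Rightarrow> ('k, 'm, 't) comodule \<Rightarrow> ('m \<Rightarrow> 'm) set) \<Rightarrow>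
    ('k, 'm, 't) comodule \<Rightarrow> bool"
  where "injective_comodule P mor E \<longleftrightarrow>
    P E \<and>
    (\<forall>M N i f. P M \<and> P N \<and> i \<in> mor M N \<and> inj_on i (carrier M) \<and> f \<in> mor M E \<longrightarrow>
      (\<exists>g\<in>mor N E. \<forall>m\<in>carrier M. g (i m) = f m))"

definition injective_envelope ::
  "(('k, 'm, 't) comodule \<Rightarrow> bool) \<Rightarrow>
    (('k, 'm, 't) comodule \<Rightarrow> ('k, 'm, 't) comodule \<Rightarrow> ('m \<Rightarrow> 'm) set) \<Rightarrow>
    ('k, 'm, 't) comodule \<Rightarrow> ('m \<Rightarrow> 'm) \<Rightarrow> ('k, 'm, 't) comodule \<Rightarrow> bool"
  where "injective_envelope P mor S i E \<longleftrightarrow>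
    P S \<and> injective_comodule P mor E \<and> i \<in> mor S E \<and> inj_on i (carrier S) \<and>
    (\<forall>N. subcomodule P mor N E \<and> carrier N \<noteq> {\<zero>\<^bsub>E\<^esub>} \<longrightarrow>
      carrier N \<inter> i ` carrier S \<noteq> {\<zero>\<^bsub>E\<^esub>})"

definition semiperfect ::
  "'m itself \<Rightarrow> ('k, 'x) ring_scheme \<Rightarrow> ('k, 'c, 'y) coalgebra_scheme \<Rightarrow> bool"
  where "semiperfect (_ :: 'm itself) k C \<longleftrightarrow>
    (\<forall>S :: ('k, 'c, 'm) rcomodule.
      simple_comodule (right_comodule k C) (Hom_rcomod k C) S \<longrightarrow>
      (\<exists>i E. injective_envelope (right_comodule k C) (Hom_rcomod k C) S i E \<and> fin_dim k E)) \<and>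
    (\<forall>S :: ('k, 'c, 'm) lcomodule.
      simple_comodule (left_comodule k C) (Hom_lcomod k C) S \<longrightarrow>
      (\<exists>i E. injective_envelope (left_comodule k C) (Hom_lcomod k C) S i E \<and> fin_dim k E))"

section \<open>The dual algebra and symmetric coalgebras\<close>

definition dual_algebra ::
  "('k, 'x) ring_scheme \<Rightarrow> ('k, 'c, 'y) coalgebra_scheme \<Rightarrow> ('c \<Rightarrow> 'k) ring"
  where "dual_algebra k C = \<lparr>
    carrier = Hom_mod k C (left_regular k),
    mult = (\<lambda>f g. \<lambda>x\<in>carrier C.
      tensor_lift k (left_regular k) (\<lambda>x1 x2. f x1 \<otimes>\<^bsub>k\<^esub> g x2) (comult C x)),
    one = counit C,
    zero = (\<lambda>x\<in>carrier C. \<zero>\<^bsub>k\<^esub>),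
    add = (\<lambda>f g. \<lambda>x\<in>carrier C. f x \<oplus>\<^bsub>k\<^esub> g x)\<rparr>"

definition coalgebra_left ::
  "('k, 'x) ring_scheme \<Rightarrow> ('k, 'c, 'y) coalgebra_scheme \<Rightarrow> ('c \<Rightarrow> 'k, 'c) module"
  where "coalgebra_left k C = \<lparr>carrier = carrier C, mult = undefined, one = undefined,
    zero = zero C, add = add C,
    smult = (\<lambda>f x. tensor_lift k C (\<lambda>x1 x2. f x2 \<odot>\<^bsub>C\<^esub> x1) (comult C x))\<rparr>"

definition coalgebra_right ::
  "('k, 'x) ring_scheme \<Rightarrow> ('k, 'c, 'y) coalgebra_scheme \<Rightarrow> ('c \<Rightarrow> 'k, 'c) module"
  where "coalgebra_right k C = \<lparr>carrier = carrier C, mult = undefined, one = undefined,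
    zero = zero C, add = add C,
    smult = (\<lambda>f x. tensor_lift k C (\<lambda>x1 x2. f x1 \<odot>\<^bsub>C\<^esub> x2) (comult C x))\<rparr>"

definition symmetric_coalgebra ::
  "('k, 'x) ring_scheme \<Rightarrow> ('k, 'c, 'y) coalgebra_scheme \<Rightarrow> bool"
  where "symmetric_coalgebra k C \<longleftrightarrow>
    (let A = dual_algebra k C in
      \<exists>\<alpha>. \<alpha> \<in> Hom_mod A (coalgebra_left k C) (left_regular A) \<and>
          \<alpha> \<in> Hom_mod A (coalgebra_right k C) (right_regular A) \<and>
          inj_on \<alpha> (carrier C))"

section \<open>The two functors\<close>

definition comodule_left ::
  "('k, 'x) ring_scheme \<Rightarrow> ('k, 'c, 'm) rcomodule \<Rightarrow> ('c \<Rightarrow> 'k, 'm) module"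
  where "comodule_left k M = \<lparr>carrier = carrier M, mult = undefined, one = undefined,
    zero = zero M, add = add M,
    smult = (\<lambda>f m. tensor_lift k M (\<lambda>m0 m1. f m1 \<odot>\<^bsub>M\<^esub> m0) (coact M m))\<rparr>"

text \<open>
  For an \<open>(R, R)\<close>-bimodule given by its left part \<open>L\<close> and its right part \<open>L'\<close> (on the same
  additive group), the right module of left linear maps \<open>M \<rightarrow> L\<close> with \<open>(f r) m = (f m) r\<close>.
\<close>

definition Hom_right_module ::
  "('r, 'x) ring_scheme \<Rightarrow> ('r, 'm) module \<Rightarrow> ('r, 'n) module \<Rightarrow> ('r, 'n) module \<Rightarrow>
    ('r, 'm \<Rightarrow> 'n) module"
  where "Hom_right_module R M L L' = \<lparr>carrier = Hom_mod R M L, mult = undefined, one = undefined,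
    zero = (\<lambda>m\<in>carrier M. \<zero>\<^bsub>L\<^esub>), add = (\<lambda>f g. \<lambda>m\<in>carrier M. f m \<oplus>\<^bsub>L\<^esub> g m),
    smult = (\<lambda>r f. \<lambda>m\<in>carrier M. r \<odot>\<^bsub>L'\<^esub> f m)\<rparr>"

definition functor_G ::
  "('k, 'x) ring_scheme \<Rightarrow> ('k, 'c, 'y) coalgebra_scheme \<Rightarrow> ('k, 'c, 'm) rcomodule \<Rightarrow>
    ('c \<Rightarrow> 'k, 'm \<Rightarrow> 'c) module"
  where "functor_G k C M =
    Hom_right_module (dual_algebra k C) (comodule_left k M) (coalgebra_left k C) (coalgebra_right k C)"

definition functor_H ::
  "('k, 'x) ring_scheme \<Rightarrow> ('k, 'c, 'y) coalgebra_scheme \<Rightarrow> ('k, 'c, 'm) rcomodule \<Rightarrow>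
    ('c \<Rightarrow> 'k, 'm \<Rightarrow> 'c \<Rightarrow> 'k) module"
  where "functor_H k C M =
    Hom_right_module (dual_algebra k C) (comodule_left k M)
      (left_regular (dual_algebra k C)) (right_regular (dual_algebra k C))"

text \<open>
  Natural isomorphism of \<open>G\<close> and \<open>H\<close> on the right comodules with carrier in the type \<open>'m\<close>;
  \<open>compose (carrier M) f h\<close> is the image of \<open>f\<close> under \<open>G(h)\<close> respectively \<open>H(h)\<close>.
\<close>

definition G_H_naturally_isomorphic ::
  "'m itself \<Rightarrow> ('k, 'x) ring_scheme \<Rightarrow> ('k, 'c, 'y) coalgebra_scheme \<Rightarrow> bool"
  where "G_H_naturally_isomorphic (_ :: 'm itself) k C \<longleftrightarrow>
    (\<exists>\<eta> :: ('k, 'c, 'm) rcomodule \<Rightarrow> ('m \<Rightarrow> 'c) \<Rightarrow> ('m \<Rightarrow> 'c \<Rightarrow> 'k).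
      (\<forall>M. right_comodule k C M \<longrightarrow>
        \<eta> M \<in> Hom_mod (dual_algebra k C) (functor_G k C M) (functor_H k C M) \<and>
        bij_betw (\<eta> M) (carrier (functor_G k C M)) (carrier (functor_H k C M))) \<and>
      (\<forall>M N. \<forall>h\<in>Hom_rcomod k C M N. right_comodule k C M \<and> right_comodule k C N \<longrightarrow>
        (\<forall>f\<in>carrier (functor_G k C N).
          \<eta> M (compose (carrier M) f h) = compose (carrier M) (\<eta> N f) h)))"

text \<open>
  A type large enough to contain, up to isomorphism, \<open>C\<close> itself and every finite-dimensional
  comodule (if \<open>C = 0\<close>, all comodules vanish), hence also every simple comodule and its injective envelope. Injectivity of
  comodules can be tested on finite-dimensional comodules, so over such a type
  \<^const>\<open>semiperfect\<close> does not depend on the choice of the type.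
\<close>

definition large_universe :: "'m itself \<Rightarrow> ('k, 'c, 'y) coalgebra_scheme \<Rightarrow> bool"
  where "large_universe (_ :: 'm itself) C \<longleftrightarrow>
    infinite (UNIV :: 'm set) \<and> (\<exists>e :: 'c \<Rightarrow> 'm. inj_on e (carrier C))"

end

theory Submission
  imports Defs
begin

text \<open>
  A map \<open>\<alpha> : C \<rightarrow> C*\<close> amounts to a bilinear form \<open>B x y = \<alpha> x y\<close> on \<open>C\<close>, and both directions exploit
  that composing with \<open>\<alpha>\<close> turns a map \<open>M \<rightarrow> C\<close> into a map \<open>M \<rightarrow> C*\<close>.
  
  Let \<open>\<alpha>\<close> be an injective bimodule map. Then \<open>f \<mapsto> \<alpha> \<circ> f\<close> is a natural injective transformation from
  \<open>G\<close> to \<open>H\<close>, and the point is surjectivity: every \<open>C*\<close>-linear \<open>\<phi> : M \<rightarrow> C*\<close> that starts at a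
  comodule has values in \<open>\<alpha>(C)\<close> (\<open>symmetric_map_image\<close>). The form \<open>B\<close> is symmetric
  (\<open>coalgebra_dual_map_symmetric\<close>). The coaction of \<open>m\<close> involves finitely many elements \<open>x\<^sub>p\<close> of \<open>C\<close>,
  and if \<open>y\<close> is orthogonal to all of them, then \<open>\<alpha> y\<close> annihilates \<open>m\<close>, from which
  \<open>\<phi> m y = 0\<close> follows by the right linearity of \<open>\<alpha>\<close>. A functional that vanishes on a finite intersection
  of kernels is a combination of the functionals in question (\<open>functional_in_span\<close>), so \<open>\<phi> m\<close> is a
  combination of the \<open>\<alpha> x\<^sub>p\<close>.
  
  Conversely, let \<open>\<eta> : G \<rightarrow> H\<close> be a natural isomorphism. As \<open>C\<close> itself is a comodule, the argument of
  Yoneda shows that \<open>\<eta>\<close> is composition with \<open>\<alpha> = \<eta>\<^sub>C(id)\<close> on maps that arise from comodule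
  morphisms, and that \<open>\<alpha>\<close> is a bimodule map. The kernel of \<open>\<alpha>\<close> is a subcomodule whose inclusion into
  \<open>C\<close> is killed by \<open>\<eta>\<close>, so it is zero (\<open>isomorphic_imp_symmetric\<close>).
  
  This needs the kernel as a comodule in its own right. A subspace \<open>N\<close> of \<open>C\<close> that is stable under
  \<open>C*\<close> receives the coaction \<open>(\<pi> \<otimes> 1) \<Delta>\<close> for any linear projection \<open>\<pi>\<close> of \<open>C\<close> onto \<open>N\<close>
  (\<open>retract_comodule\<close>). It agrees with \<open>\<Delta>\<close> on \<open>N\<close> because the maps \<open>1 \<otimes> g\<close> for functionals \<open>g\<close>
  separate tensors (\<open>tensor_eqI\<close>). The projection and the functionals come from Zorn's lemma
  (\<open>projection_exists\<close>).
\<close>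

section \<open>Linear maps and functionals\<close>

text \<open>
  The extensional variant of this predicate is \<^const>\<open>Hom_mod\<close>. Here a map may be arbitrary outside
  the carrier, so that \<^const>\<open>id\<close> and plain abstractions are linear. Because the record \<open>module\<close>
  also stores actions of non-commutative rings, the lemmas on \<^const>\<open>Hom_mod\<close> apply to \<open>C*\<close>-linear
  maps as well.
\<close>

definition linear_map ::
  "('k, 'x) ring_scheme \<Rightarrow> ('k, 'm, 'y) module_scheme \<Rightarrow> ('k, 'n, 'z) module_scheme \<Rightarrow> ('m \<Rightarrow> 'n) \<Rightarrow> bool"
  where "linear_map k V W f \<longleftrightarrow> f \<in> carrier V \<rightarrow> carrier W \<and>
    (\<forall>x\<in>carrier V. \<forall>y\<in>carrier V. f (x \<oplus>\<^bsub>V\<^esub> y) = f x \<oplus>\<^bsub>W\<^esub> f y) \<and>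
    (\<forall>r\<in>carrier k. \<forall>x\<in>carrier V. f (r \<odot>\<^bsub>V\<^esub> x) = r \<odot>\<^bsub>W\<^esub> f x)"

lemma (in abelian_group) eq_if_minus_zero:
  assumes "x \<in> carrier G" "y \<in> carrier G" "x \<ominus> y = \<zero>" shows "x = y"
  using minus_equality[of x "\<ominus> y"] assms by (simp add: a_minus_def)

lemma linear_mapI:
  assumes "\<And>x. x \<in> carrier V \<Longrightarrow> f x \<in> carrier W"
    and "\<And>x y. x \<in> carrier V \<Longrightarrow> y \<in> carrier V \<Longrightarrow> f (x \<oplus>\<^bsub>V\<^esub> y) = f x \<oplus>\<^bsub>W\<^esub> f y"
    and "\<And>r x. r \<in> carrier k \<Longrightarrow> x \<in> carrier V \<Longrightarrow> f (r \<odot>\<^bsub>V\<^esub> x) = r \<odot>\<^bsub>W\<^esub> f x"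
  shows "linear_map k V W f"
  using assms by (auto simp: linear_map_def)

lemma linear_mapD:
  assumes "linear_map k V W f"
  shows "x \<in> carrier V \<Longrightarrow> f x \<in> carrier W"
    and "x \<in> carrier V \<Longrightarrow> y \<in> carrier V \<Longrightarrow> f (x \<oplus>\<^bsub>V\<^esub> y) = f x \<oplus>\<^bsub>W\<^esub> f y"
    and "r \<in> carrier k \<Longrightarrow> x \<in> carrier V \<Longrightarrow> f (r \<odot>\<^bsub>V\<^esub> x) = r \<odot>\<^bsub>W\<^esub> f x"
  using assms by (auto simp: linear_map_def)

lemma Hom_mod_iff: "f \<in> Hom_mod k V W \<longleftrightarrow> linear_map k V W f \<and> f \<in> extensional (carrier V)"
  by (auto simp: Hom_mod_def linear_map_def PiE_def)

lemma Hom_mod_linear: "f \<in> Hom_mod k V W \<Longrightarrow> linear_map k V W f"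
  by (simp add: Hom_mod_iff)

lemma Hom_mod_eqI:
  assumes "f \<in> Hom_mod k V W" "g \<in> Hom_mod k V W" "\<And>x. x \<in> carrier V \<Longrightarrow> f x = g x"
  shows "f = g"
  using assms by (auto simp: Hom_mod_iff intro: extensionalityI)

lemma linear_map_cong:
  assumes "module k V" "linear_map k V W f" "\<And>x. x \<in> carrier V \<Longrightarrow> f x = g x"
  shows "linear_map k V W g"
proof -
  interpret V: module k V by fact
  show ?thesis
    using assms(2) by (intro linear_mapI) (simp_all add: linear_mapD flip: assms(3))
qed

lemma restrict_Hom_mod:
  assumes "module k V" "linear_map k V W f"
  shows "restrict f (carrier V) \<in> Hom_mod k V W"
  unfolding Hom_mod_iff using linear_map_cong[OF assms] by simp

lemma linear_map_comp:
  assumes "linear_map k U V f" "linear_map k V W g"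
  shows "linear_map k U W (\<lambda>x. g (f x))"
  using assms by (intro linear_mapI) (simp_all add: linear_mapD)

lemma linear_map_id: "linear_map k V V id"
  by (intro linear_mapI) simp_all

lemma linear_map_zero:
  assumes "module k V" "module k W" "linear_map k V W f"
  shows "f \<zero>\<^bsub>V\<^esub> = \<zero>\<^bsub>W\<^esub>"
proof -
  interpret V: module k V by fact
  interpret W: module k W by fact
  have "f (\<zero>\<^bsub>k\<^esub> \<odot>\<^bsub>V\<^esub> \<zero>\<^bsub>V\<^esub>) = \<zero>\<^bsub>k\<^esub> \<odot>\<^bsub>W\<^esub> f \<zero>\<^bsub>V\<^esub>"
    by (intro linear_mapD(3)[OF assms(3)]) simp_all
  moreover have "f \<zero>\<^bsub>V\<^esub> \<in> carrier W" using assms(3) by (simp add: linear_mapD)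
  ultimately show ?thesis by simp
qed

lemma linear_map_neg:
  assumes "module k V" "module k W" "linear_map k V W f" "x \<in> carrier V"
  shows "f (\<ominus>\<^bsub>V\<^esub> x) = \<ominus>\<^bsub>W\<^esub> f x"
proof -
  interpret V: module k V by fact
  interpret W: module k W by fact
  have "f (\<ominus>\<^bsub>V\<^esub> x) \<oplus>\<^bsub>W\<^esub> f x = f (\<ominus>\<^bsub>V\<^esub> x \<oplus>\<^bsub>V\<^esub> x)"
    using assms(3,4) by (simp add: linear_mapD)
  also have "\<dots> = \<zero>\<^bsub>W\<^esub>" using linear_map_zero[OF assms(1-3)] assms(4) by (simp add: V.l_neg)
  finally show ?thesis
    using assms(3,4) by (intro W.minus_equality[symmetric]) (simp_all add: linear_mapD)
qed

lemma linear_map_minus: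
  assumes "module k V" "module k W" "linear_map k V W f" "x \<in> carrier V" "y \<in> carrier V"
  shows "f (x \<ominus>\<^bsub>V\<^esub> y) = f x \<ominus>\<^bsub>W\<^esub> f y"
proof -
  interpret V: module k V by fact
  interpret W: module k W by fact
  show ?thesis
    using assms(3-) linear_map_neg[OF assms(1-3)]
    by (simp add: a_minus_def linear_mapD)
qed

lemma linear_map_finsum:
  assumes "module k V" "module k W" "linear_map k V W f" "g \<in> I \<rightarrow> carrier V"
  shows "f (\<Oplus>\<^bsub>V\<^esub>i\<in>I. g i) = (\<Oplus>\<^bsub>W\<^esub>i\<in>I. f (g i))"
proof -
  interpret V: module k V by fact
  interpret W: module k W by fact
  show ?thesis
  proof (cases "finite I")
    case True
    then show ?thesis using assms(4)
    proof induction
      case empty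
      then show ?case using linear_map_zero[OF assms(1-3)] by simp
    next
      case (insert i I)
      then have "g i \<in> carrier V" "g \<in> I \<rightarrow> carrier V" by auto
      with insert show ?case
        using assms(3) by (simp add: V.finsum_insert W.finsum_insert linear_mapD Pi_def V.finsum_closed)
    qed
  next
    case False
    then show ?thesis using linear_map_zero[OF assms(1-3)] by simp
  qed
qed

lemma left_regular_simps [simp]:
  "carrier (left_regular R) = carrier R" "zero (left_regular R) = zero R"
  "add (left_regular R) = add R" "smult (left_regular R) = mult R"
  "mult (left_regular R) = mult R" "one (left_regular R) = one R"
  by (simp_all add: left_regular_def fun_eq_iff)

lemma left_regular_module:
  assumes "cring k" shows "module k (left_regular k)"
proof -
  interpret cring k by fact
  have "abelian_group (left_regular k)"
    by (rule abelian_groupI) (auto simp: a_ac intro: l_neg)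
  then show ?thesis
    by (intro moduleI) (auto simp: l_distr r_distr m_assoc assms)
qed

lemma kernel_submodule:
  assumes "module k V" "module k W" "linear_map k V W f"
  shows "submodule {x \<in> carrier V. f x = \<zero>\<^bsub>W\<^esub>} k V"
proof -
  interpret V: module k V by fact
  interpret W: module k W by fact
  show ?thesis
    using linear_map_zero[OF assms] linear_map_neg[OF assms] assms(3)
    by (intro V.submoduleI) (auto simp: linear_mapD)
qed

lemma submodule_zero:
  assumes "module k V" "submodule N k V" shows "\<zero>\<^bsub>V\<^esub> \<in> N"
proof -
  interpret V: module k V by fact
  obtain a where a: "a \<in> N" using V.submoduleE(2)[OF assms(2)] by auto
  then have "\<ominus>\<^bsub>V\<^esub> a \<oplus>\<^bsub>V\<^esub> a \<in> N" by (intro V.submoduleE(5)[OF assms(2)] V.submoduleE(3)[OF assms(2)])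
  with a V.submoduleE(1)[OF assms(2)] show ?thesis by (auto simp: V.l_neg)
qed

lemma submodule_finsum:
  assumes "module k V" "submodule N k V" "g \<in> I \<rightarrow> N"
  shows "(\<Oplus>\<^bsub>V\<^esub>i\<in>I. g i) \<in> N"
proof -
  interpret V: module k V by fact
  note E = V.submoduleE[OF assms(2)]
  show ?thesis
  proof (cases "finite I")
    case True
    then show ?thesis using assms(3)
    proof induction
      case empty
      then show ?case using submodule_zero[OF assms(1,2)] by simp
    next
      case (insert i I)
      then have g: "g i \<in> carrier V" "g \<in> I \<rightarrow> carrier V" using E(1) by auto
      show ?case unfolding V.finsum_insert[OF insert(1,2) g(2,1)]
        using insert by (intro E(5)) auto
    qed
  qed (simp add: submodule_zero[OF assms(1,2)])
qed

lemma span_submodule: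
  assumes "module k V" "S \<subseteq> carrier V"
  shows "submodule (module_span k V S) k V" "S \<subseteq> module_span k V S"
    and "\<And>N. submodule N k V \<Longrightarrow> S \<subseteq> N \<Longrightarrow> module_span k V S \<subseteq> N"
proof -
  interpret V: module k V by fact
  show "S \<subseteq> module_span k V S" by (auto simp: module_span_def)
  show "\<And>N. submodule N k V \<Longrightarrow> S \<subseteq> N \<Longrightarrow> module_span k V S \<subseteq> N" by (auto simp: module_span_def)
  show "submodule (module_span k V S) k V"
  proof (rule V.submoduleI)
    show "module_span k V S \<subseteq> carrier V"
      using V.carrier_is_submodule assms(2) by (auto simp: module_span_def)
  qed (auto simp: module_span_def submodule_zero[OF assms(1)] V.submoduleE)
qed

context field
begin

text \<open>
  Zorn's lemma gives a maximal submodule \<open>D \<supseteq> A\<close> that meets \<open>B\<close> trivially. Over a field \<open>D\<close> is a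
  complement of \<open>B\<close>: if \<open>x \<notin> D + B\<close>, then \<open>D + k x\<close> would still meet \<open>B\<close> trivially. The map is the
  projection onto \<open>B\<close> along \<open>D\<close>. It serves twice: with \<open>A = 0\<close> as a retraction onto a subspace, and
  with \<open>B\<close> a line as a source of functionals.
\<close>

lemma projection_exists:
  assumes X: "module R X" and A: "submodule A R X" and B: "submodule B R X"
    and AB: "A \<inter> B = {\<zero>\<^bsub>X\<^esub>}"
  obtains P where "linear_map R X X P" "\<And>x. x \<in> carrier X \<Longrightarrow> P x \<in> B"
    "\<And>a. a \<in> A \<Longrightarrow> P a = \<zero>\<^bsub>X\<^esub>" "\<And>b. b \<in> B \<Longrightarrow> P b = b"
proof -
  interpret X: module R X by fact
  define S where "S = {D. submodule D R X \<and> A \<subseteq> D \<and> D \<inter> B = {\<zero>\<^bsub>X\<^esub>}}"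
  have "\<exists>D\<in>S. \<forall>E\<in>S. D \<subseteq> E \<longrightarrow> E = D"
  proof (rule subset_Zorn_nonempty)
    show "S \<noteq> {}" using A AB by (auto simp: S_def)
  next
    fix \<C> assume ne: "\<C> \<noteq> {}" and ch: "subset.chain S \<C>"
    have sub: "\<And>D. D \<in> \<C> \<Longrightarrow> submodule D R X \<and> A \<subseteq> D \<and> D \<inter> B = {\<zero>\<^bsub>X\<^esub>}"
      using ch by (auto simp: subset.chain_def S_def)
    have tot: "\<And>D E. D \<in> \<C> \<Longrightarrow> E \<in> \<C> \<Longrightarrow> D \<subseteq> E \<or> E \<subseteq> D"
      using ch by (auto simp: subset.chain_def)
    have "submodule (\<Union>\<C>) R X"
    proof (rule X.submoduleI)
      show "\<Union>\<C> \<subseteq> carrier X" using sub X.submoduleE(1) by blast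
      show "\<zero>\<^bsub>X\<^esub> \<in> \<Union>\<C>" using ne sub by auto
      show "\<And>a. a \<in> \<Union>\<C> \<Longrightarrow> \<ominus>\<^bsub>X\<^esub> a \<in> \<Union>\<C>" using sub X.submoduleE(3) by blast
      show "\<And>a x. a \<in> carrier R \<Longrightarrow> x \<in> \<Union>\<C> \<Longrightarrow> a \<odot>\<^bsub>X\<^esub> x \<in> \<Union>\<C>" using sub X.submoduleE(4) by blast
      fix a b assume "a \<in> \<Union>\<C>" "b \<in> \<Union>\<C>"
      then obtain D E where "D \<in> \<C>" "E \<in> \<C>" "a \<in> D" "b \<in> E" by auto
      then obtain F where "F \<in> \<C>" "a \<in> F" "b \<in> F" using tot by blast
      then show "a \<oplus>\<^bsub>X\<^esub> b \<in> \<Union>\<C>" using sub X.submoduleE(5) by blast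
    qed
    moreover have "A \<subseteq> \<Union>\<C>" using ne sub by blast
    moreover have "\<Union>\<C> \<inter> B = {\<zero>\<^bsub>X\<^esub>}" using ne sub by blast
    ultimately show "\<Union>\<C> \<in> S" by (simp add: S_def)
  qed
  then obtain D where D: "submodule D R X" "A \<subseteq> D" "D \<inter> B = {\<zero>\<^bsub>X\<^esub>}"
    and max: "\<And>E. E \<in> S \<Longrightarrow> D \<subseteq> E \<Longrightarrow> E = D" by (auto simp: S_def)
  note DE = X.submoduleE[OF D(1)] and BE = X.submoduleE[OF B]
  have D0: "\<zero>\<^bsub>X\<^esub> \<in> D" and B0: "\<zero>\<^bsub>X\<^esub> \<in> B" using D(3) by auto
  have Dc: "\<And>d. d \<in> D \<Longrightarrow> d \<in> carrier X" and Bc: "\<And>d. d \<in> B \<Longrightarrow> d \<in> carrier X"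
    using DE(1) BE(1) by auto
  have decomp: "\<exists>d\<in>D. \<exists>b\<in>B. x = d \<oplus>\<^bsub>X\<^esub> b" if x: "x \<in> carrier X" for x
  proof -
    define E where "E = {d \<oplus>\<^bsub>X\<^esub> r \<odot>\<^bsub>X\<^esub> x | d r. d \<in> D \<and> r \<in> carrier R}"
    have EI: "\<And>d r. d \<in> D \<Longrightarrow> r \<in> carrier R \<Longrightarrow> d \<oplus>\<^bsub>X\<^esub> r \<odot>\<^bsub>X\<^esub> x \<in> E" by (auto simp: E_def)
    have "submodule E R X"
    proof (rule X.submoduleI)
      show "E \<subseteq> carrier X" using Dc x by (auto simp: E_def)
      show "\<zero>\<^bsub>X\<^esub> \<in> E" using EI[OF D0 zero_closed] x by simp
    next
      fix a assume "a \<in> E"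
      then obtain d r where a: "a = d \<oplus>\<^bsub>X\<^esub> r \<odot>\<^bsub>X\<^esub> x" "d \<in> D" "r \<in> carrier R" by (auto simp: E_def)
      then have "\<ominus>\<^bsub>X\<^esub> a = (\<ominus>\<^bsub>X\<^esub> d) \<oplus>\<^bsub>X\<^esub> (\<ominus> r) \<odot>\<^bsub>X\<^esub> x"
        using x Dc by (simp add: X.minus_add X.smult_l_minus)
      then show "\<ominus>\<^bsub>X\<^esub> a \<in> E" using EI a DE(3) by simp
    next
      fix a b assume "a \<in> E" "b \<in> E"
      then obtain d r e s where a: "a = d \<oplus>\<^bsub>X\<^esub> r \<odot>\<^bsub>X\<^esub> x" "d \<in> D" "r \<in> carrier R"
         "b = e \<oplus>\<^bsub>X\<^esub> s \<odot>\<^bsub>X\<^esub> x" "e \<in> D" "s \<in> carrier R" by (auto simp: E_def)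
      then have "a \<oplus>\<^bsub>X\<^esub> b = (d \<oplus>\<^bsub>X\<^esub> e) \<oplus>\<^bsub>X\<^esub> (r \<oplus> s) \<odot>\<^bsub>X\<^esub> x"
        using x Dc by (simp add: X.smult_l_distr X.a_ac)
      then show "a \<oplus>\<^bsub>X\<^esub> b \<in> E" using EI a DE(5) by simp
    next
      fix t a assume "t \<in> carrier R" "a \<in> E"
      then obtain d r where a: "a = d \<oplus>\<^bsub>X\<^esub> r \<odot>\<^bsub>X\<^esub> x" "d \<in> D" "r \<in> carrier R" by (auto simp: E_def)
      with \<open>t \<in> carrier R\<close> have "t \<odot>\<^bsub>X\<^esub> a = (t \<odot>\<^bsub>X\<^esub> d) \<oplus>\<^bsub>X\<^esub> (t \<otimes> r) \<odot>\<^bsub>X\<^esub> x"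
        using x Dc by (simp add: X.smult_r_distr X.smult_assoc1)
      then show "t \<odot>\<^bsub>X\<^esub> a \<in> E" using EI a DE(4) \<open>t \<in> carrier R\<close> by simp
    qed
    have DsE: "D \<subseteq> E"
    proof
      fix d assume "d \<in> D"
      with EI[OF this zero_closed] x Dc show "d \<in> E" by simp
    qed
    show ?thesis
    proof (cases "E \<inter> B = {\<zero>\<^bsub>X\<^esub>}")
      case True
      then have "E = D" using \<open>submodule E R X\<close> DsE D(2) by (intro max) (auto simp: S_def)
      moreover have "x \<in> E" using EI[OF D0 one_closed] x by simp
      ultimately have "x \<in> D" by simp
      then show ?thesis using B0 x by (intro bexI[of _ x] bexI[of _ "\<zero>\<^bsub>X\<^esub>"]) auto
    next
      case False
      then obtain b where b: "b \<in> E" "b \<in> B" "b \<noteq> \<zero>\<^bsub>X\<^esub>" using DsE D0 B0 by blast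
      then obtain d r where d: "b = d \<oplus>\<^bsub>X\<^esub> r \<odot>\<^bsub>X\<^esub> x" "d \<in> D" "r \<in> carrier R" by (auto simp: E_def)
      \<comment> \<open>The vector \<open>b\<close> of \<open>B\<close> lies in \<open>D + k x\<close> but not in \<open>D\<close>, so the coefficient of \<open>x\<close> is
        invertible and \<open>x\<close> can be solved for.\<close>
      have "r \<noteq> \<zero>"
      proof
        assume "r = \<zero>"
        then have "b = d" using d x Dc by simp
        then show False using d b D(3) by auto
      qed
      then have r: "inv r \<in> carrier R" "inv r \<otimes> r = \<one>" using d field_Units by auto
      have "r \<odot>\<^bsub>X\<^esub> x = \<ominus>\<^bsub>X\<^esub> d \<oplus>\<^bsub>X\<^esub> b" using d x Dc by (simp add: X.r_neg1)
      moreover have "inv r \<odot>\<^bsub>X\<^esub> (\<ominus>\<^bsub>X\<^esub> d \<oplus>\<^bsub>X\<^esub> b) = inv r \<odot>\<^bsub>X\<^esub> (\<ominus>\<^bsub>X\<^esub> d) \<oplus>\<^bsub>X\<^esub> inv r \<odot>\<^bsub>X\<^esub> b"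
        by (intro X.smult_r_distr r X.a_inv_closed Dc Bc d b)
      ultimately have "inv r \<odot>\<^bsub>X\<^esub> (r \<odot>\<^bsub>X\<^esub> x) = inv r \<odot>\<^bsub>X\<^esub> (\<ominus>\<^bsub>X\<^esub> d) \<oplus>\<^bsub>X\<^esub> inv r \<odot>\<^bsub>X\<^esub> b" by simp
      then have "x = inv r \<odot>\<^bsub>X\<^esub> (\<ominus>\<^bsub>X\<^esub> d) \<oplus>\<^bsub>X\<^esub> inv r \<odot>\<^bsub>X\<^esub> b"
        using r d(3) x by (simp flip: X.smult_assoc1)
      then show ?thesis using DE(3,4) BE(4) r d b by blast
    qed
  qed
  have uniq: "b = b'" if "d \<in> D" "d' \<in> D" "b \<in> B" "b' \<in> B" "d \<oplus>\<^bsub>X\<^esub> b = d' \<oplus>\<^bsub>X\<^esub> b'" for d d' b b'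
  proof -
    note c = Dc[OF that(1)] Dc[OF that(2)] Bc[OF that(3)] Bc[OF that(4)]
    have "b \<oplus>\<^bsub>X\<^esub> \<ominus>\<^bsub>X\<^esub> b' = \<ominus>\<^bsub>X\<^esub> d \<oplus>\<^bsub>X\<^esub> (d \<oplus>\<^bsub>X\<^esub> b) \<oplus>\<^bsub>X\<^esub> \<ominus>\<^bsub>X\<^esub> b'" using c by (simp add: X.r_neg1)
    also have "\<dots> = \<ominus>\<^bsub>X\<^esub> d \<oplus>\<^bsub>X\<^esub> (d' \<oplus>\<^bsub>X\<^esub> b') \<oplus>\<^bsub>X\<^esub> \<ominus>\<^bsub>X\<^esub> b'" using that by simp
    also have "\<dots> = \<ominus>\<^bsub>X\<^esub> d \<oplus>\<^bsub>X\<^esub> d'" using c by (simp add: X.a_assoc X.r_neg)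
    finally have eq: "b \<oplus>\<^bsub>X\<^esub> \<ominus>\<^bsub>X\<^esub> b' = \<ominus>\<^bsub>X\<^esub> d \<oplus>\<^bsub>X\<^esub> d'" .
    have "b \<oplus>\<^bsub>X\<^esub> \<ominus>\<^bsub>X\<^esub> b' \<in> B" using that BE(3,5) by simp
    moreover have "b \<oplus>\<^bsub>X\<^esub> \<ominus>\<^bsub>X\<^esub> b' \<in> D" unfolding eq using that DE(3,5) by simp
    ultimately have "b \<oplus>\<^bsub>X\<^esub> \<ominus>\<^bsub>X\<^esub> b' = \<zero>\<^bsub>X\<^esub>" using D(3) by auto
    then show ?thesis using c X.minus_equality[of b "\<ominus>\<^bsub>X\<^esub> b'"] by simp
  qed
  define P where "P x = (THE b. b \<in> B \<and> (\<exists>d\<in>D. x = d \<oplus>\<^bsub>X\<^esub> b))" for x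
  have PI: "P (d \<oplus>\<^bsub>X\<^esub> b) = b" if "d \<in> D" "b \<in> B" for d b
    unfolding P_def using that uniq by (intro the_equality) blast+
  have PB: "P x \<in> B" if "x \<in> carrier X" for x
    using decomp[OF that] PI by auto
  show thesis
  proof
    show "linear_map R X X P"
    proof (rule linear_mapI)
      show "\<And>x. x \<in> carrier X \<Longrightarrow> P x \<in> carrier X" using PB Bc by auto
    next
      fix x y assume "x \<in> carrier X" "y \<in> carrier X"
      then obtain d b e c where h: "d \<in> D" "b \<in> B" "x = d \<oplus>\<^bsub>X\<^esub> b" "e \<in> D" "c \<in> B" "y = e \<oplus>\<^bsub>X\<^esub> c"
        using decomp by meson
      have "x \<oplus>\<^bsub>X\<^esub> y = (d \<oplus>\<^bsub>X\<^esub> e) \<oplus>\<^bsub>X\<^esub> (b \<oplus>\<^bsub>X\<^esub> c)" using h Dc Bc by (simp add: X.a_ac)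
      then show "P (x \<oplus>\<^bsub>X\<^esub> y) = P x \<oplus>\<^bsub>X\<^esub> P y" using h PI DE(5) BE(5) by simp
    next
      fix r x assume "r \<in> carrier R" "x \<in> carrier X"
      moreover from \<open>x \<in> carrier X\<close> obtain d b where h: "d \<in> D" "b \<in> B" "x = d \<oplus>\<^bsub>X\<^esub> b"
        using decomp by meson
      ultimately have "r \<odot>\<^bsub>X\<^esub> x = (r \<odot>\<^bsub>X\<^esub> d) \<oplus>\<^bsub>X\<^esub> (r \<odot>\<^bsub>X\<^esub> b)" using Dc Bc by (simp add: X.smult_r_distr)
      then show "P (r \<odot>\<^bsub>X\<^esub> x) = r \<odot>\<^bsub>X\<^esub> P x" using h PI DE(4) BE(4) \<open>r \<in> carrier R\<close> by simp
    qed
    show "\<And>x. x \<in> carrier X \<Longrightarrow> P x \<in> B" by (rule PB)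
    show "P a = \<zero>\<^bsub>X\<^esub>" if "a \<in> A" for a using PI[of a "\<zero>\<^bsub>X\<^esub>"] B0 D(2) that Dc by auto
    show "P b = b" if "b \<in> B" for b using PI[of "\<zero>\<^bsub>X\<^esub>" b] D0 that Bc by auto
  qed
qed

text \<open>
  The coordinate of the projection onto the line \<open>k x\<close> along a complement that contains \<open>A\<close>.
\<close>

lemma functional_separates:
  assumes X: "module R X" and A: "submodule A R X" and x: "x \<in> carrier X" "x \<notin> A"
  obtains f where "f \<in> Hom_mod R X (left_regular R)" "\<And>a. a \<in> A \<Longrightarrow> f a = \<zero>" "f x = \<one>"
proof -
  interpret X: module R X by fact
  note L = left_regular_module[OF is_cring]
  define B where "B = {r \<odot>\<^bsub>X\<^esub> x | r. r \<in> carrier R}"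
  note AE = X.submoduleE[OF A]
  have inj: "r \<odot>\<^bsub>X\<^esub> x \<in> A \<Longrightarrow> r \<in> carrier R \<Longrightarrow> r = \<zero>" for r
  proof (rule ccontr)
    assume r: "r \<odot>\<^bsub>X\<^esub> x \<in> A" "r \<in> carrier R" "r \<noteq> \<zero>"
    then have i: "inv r \<in> carrier R" "inv r \<otimes> r = \<one>" using field_Units by auto
    then have "inv r \<odot>\<^bsub>X\<^esub> (r \<odot>\<^bsub>X\<^esub> x) = x" using r x by (simp flip: X.smult_assoc1)
    then show False using AE(4)[OF i(1) r(1)] x by simp
  qed
  have B: "submodule B R X"
  proof (rule X.submoduleI)
    have I: "r \<odot>\<^bsub>X\<^esub> x \<in> B" if "r \<in> carrier R" for r using that by (auto simp: B_def)
    show "B \<subseteq> carrier X" using x by (auto simp: B_def)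
    show "\<zero>\<^bsub>X\<^esub> \<in> B" using I[of \<zero>] x by simp
    show "\<And>a. a \<in> B \<Longrightarrow> \<ominus>\<^bsub>X\<^esub> a \<in> B" using I x by (auto simp: B_def simp flip: X.smult_l_minus)
    show "\<And>a b. a \<in> B \<Longrightarrow> b \<in> B \<Longrightarrow> a \<oplus>\<^bsub>X\<^esub> b \<in> B"
      using I x by (auto simp: B_def simp flip: X.smult_l_distr)
    show "\<And>a b. a \<in> carrier R \<Longrightarrow> b \<in> B \<Longrightarrow> a \<odot>\<^bsub>X\<^esub> b \<in> B"
      using I x by (auto simp: B_def simp flip: X.smult_assoc1)
  qed
  have "A \<inter> B = {\<zero>\<^bsub>X\<^esub>}"
  proof (intro equalityI subsetI)
    fix z assume "z \<in> A \<inter> B"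
    then obtain r where "z = r \<odot>\<^bsub>X\<^esub> x" "r \<in> carrier R" "r \<odot>\<^bsub>X\<^esub> x \<in> A" by (auto simp: B_def)
    with inj[of r] x show "z \<in> {\<zero>\<^bsub>X\<^esub>}" by simp
  qed (use submodule_zero[OF X A] submodule_zero[OF X B] in auto)
  then obtain P where P: "linear_map R X X P" "\<And>x. x \<in> carrier X \<Longrightarrow> P x \<in> B"
    "\<And>a. a \<in> A \<Longrightarrow> P a = \<zero>\<^bsub>X\<^esub>" "\<And>b. b \<in> B \<Longrightarrow> P b = b"
    using projection_exists[OF X A B] by blast
  have uniq: "r = s" if "r \<odot>\<^bsub>X\<^esub> x = s \<odot>\<^bsub>X\<^esub> x" "r \<in> carrier R" "s \<in> carrier R" for r s
  proof -
    have "(r \<ominus> s) \<odot>\<^bsub>X\<^esub> x = \<zero>\<^bsub>X\<^esub>"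
      using that x by (simp add: a_minus_def X.smult_l_distr X.smult_l_minus X.r_neg)
    then have "r \<ominus> s = \<zero>" using inj[of "r \<ominus> s"] submodule_zero[OF X A] that by simp
    then show ?thesis using that eq_if_minus_zero by simp
  qed
  define f where "f y = (THE r. r \<in> carrier R \<and> P y = r \<odot>\<^bsub>X\<^esub> x)" for y
  have fI: "f y = r" if "r \<in> carrier R" "P y = r \<odot>\<^bsub>X\<^esub> x" for y r
    unfolding f_def using that uniq by (intro the_equality) auto
  have f: "f y \<in> carrier R \<and> P y = f y \<odot>\<^bsub>X\<^esub> x" if y: "y \<in> carrier X" for y
  proof -
    obtain r where "r \<in> carrier R" "P y = r \<odot>\<^bsub>X\<^esub> x" using P(2)[OF y] by (auto simp: B_def)
    with fI show ?thesis by auto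
  qed
  have lin: "linear_map R X (left_regular R) f"
  proof (rule linear_mapI)
    show "\<And>y. y \<in> carrier X \<Longrightarrow> f y \<in> carrier (left_regular R)" using f by simp
    show "f (y \<oplus>\<^bsub>X\<^esub> z) = f y \<oplus>\<^bsub>left_regular R\<^esub> f z" if "y \<in> carrier X" "z \<in> carrier X" for y z
      using that f[of y] f[of z] x P(1) by (intro fI) (simp_all add: linear_mapD X.smult_l_distr)
    show "f (r \<odot>\<^bsub>X\<^esub> y) = r \<odot>\<^bsub>left_regular R\<^esub> f y" if "r \<in> carrier R" "y \<in> carrier X" for r y
      using that f[of y] x P(1) by (intro fI) (simp_all add: linear_mapD X.smult_assoc1)
  qed
  show thesis
  proof
    show "restrict f (carrier X) \<in> Hom_mod R X (left_regular R)" by (rule restrict_Hom_mod[OF X lin])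
    show "restrict f (carrier X) a = \<zero>" if "a \<in> A" for a
      using that P(3) AE(1) x by (auto intro!: fI)
    have "x \<in> B" using x one_closed by (force simp: B_def intro: exI[of _ \<one>])
    then show "restrict f (carrier X) x = \<one>" using x P(4) by (auto intro!: fI)
  qed
qed

text \<open>
  A functional that vanishes on the common kernel of finitely many functionals is a linear combination
  of them. By induction on the number of functionals: on the common kernel \<open>K\<close> of the functionals in
  \<open>I\<close>, the functional \<open>u\<close> vanishes wherever \<open>f j\<close> does, so \<open>u\<close> is a multiple \<open>c f j\<close> on \<open>K\<close>, and the
  induction hypothesis applies to \<open>u - c f j\<close>.
\<close>

lemma functional_in_span:
  assumes X: "module R X" and I: "finite I"
    and f: "\<And>i. i \<in> I \<Longrightarrow> linear_map R X (left_regular R) (f i)"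
    and u: "linear_map R X (left_regular R) u"
    and ker: "\<And>x. x \<in> carrier X \<Longrightarrow> (\<And>i. i \<in> I \<Longrightarrow> f i x = \<zero>) \<Longrightarrow> u x = \<zero>"
  shows "\<exists>c. c \<in> I \<rightarrow> carrier R \<and> (\<forall>x\<in>carrier X. u x = (\<Oplus>i\<in>I. c i \<otimes> f i x))"
  using I f u ker
proof (induction I arbitrary: u)
  case empty
  then show ?case by auto
next
  case (insert j I)
  interpret X: module R X by fact
  have u: "\<And>x. x \<in> carrier X \<Longrightarrow> u x \<in> carrier R" using insert.prems(2) by (simp add: linear_map_def Pi_def)
  have fc: "\<And>x. x \<in> carrier X \<Longrightarrow> i \<in> insert j I \<Longrightarrow> f i x \<in> carrier R" for i
    using insert.prems(1)[of i] by (simp add: linear_map_def Pi_def)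
  have "\<exists>c\<in>carrier R. \<forall>x\<in>carrier X. (\<forall>i\<in>I. f i x = \<zero>) \<longrightarrow> u x = c \<otimes> f j x"
  proof (cases "\<forall>x\<in>carrier X. (\<forall>i\<in>I. f i x = \<zero>) \<longrightarrow> f j x = \<zero>")
    case True
    then have "\<forall>x\<in>carrier X. (\<forall>i\<in>I. f i x = \<zero>) \<longrightarrow> u x = \<zero>"
      using insert.prems(3) by blast
    with True show ?thesis by (intro bexI[of _ \<zero>]) auto
  next
    case False
    then obtain y where y: "y \<in> carrier X" "\<And>i. i \<in> I \<Longrightarrow> f i y = \<zero>" "f j y \<noteq> \<zero>" by auto
    then have i: "inv (f j y) \<in> carrier R" "inv (f j y) \<otimes> f j y = \<one>" using fc field_Units by auto
    show ?thesis
    proof (intro bexI ballI impI)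
      show "u y \<otimes> inv (f j y) \<in> carrier R" using i y u by simp
      fix x assume x: "x \<in> carrier X" and z: "\<forall>i\<in>I. f i x = \<zero>"
      \<comment> \<open>Subtracting \<open>s y\<close> moves \<open>x\<close> into the kernel of \<open>f j\<close> without leaving \<open>K\<close>.\<close>
      define s where "s = f j x \<otimes> inv (f j y)"
      have s: "s \<in> carrier R" using i x fc by (simp add: s_def)
      have lin: "g (x \<ominus>\<^bsub>X\<^esub> s \<odot>\<^bsub>X\<^esub> y) = g x \<ominus> s \<otimes> g y" if "linear_map R X (left_regular R) g" for g
      proof -
        have "g (x \<ominus>\<^bsub>X\<^esub> s \<odot>\<^bsub>X\<^esub> y) \<oplus> s \<otimes> g y = g ((x \<ominus>\<^bsub>X\<^esub> s \<odot>\<^bsub>X\<^esub> y) \<oplus>\<^bsub>X\<^esub> s \<odot>\<^bsub>X\<^esub> y)"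
          using that x y s by (simp add: linear_mapD)
        also have "\<dots> = g x" using x y s by (simp add: a_minus_def X.a_assoc X.l_neg)
        finally have "g x = g (x \<ominus>\<^bsub>X\<^esub> s \<odot>\<^bsub>X\<^esub> y) \<oplus> s \<otimes> g y" ..
        moreover have "g (x \<ominus>\<^bsub>X\<^esub> s \<odot>\<^bsub>X\<^esub> y) \<in> carrier R" "g y \<in> carrier R"
          using linear_mapD(1)[OF that] x y s by auto
        ultimately show ?thesis using s by (simp add: a_minus_def a_assoc r_neg)
      qed
      have "u (x \<ominus>\<^bsub>X\<^esub> s \<odot>\<^bsub>X\<^esub> y) = \<zero>"
      proof (rule insert.prems(3))
        show "x \<ominus>\<^bsub>X\<^esub> s \<odot>\<^bsub>X\<^esub> y \<in> carrier X" using x y s by simp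
        fix i assume "i \<in> insert j I"
        then show "f i (x \<ominus>\<^bsub>X\<^esub> s \<odot>\<^bsub>X\<^esub> y) = \<zero>"
        proof
          assume "i = j"
          then show ?thesis using insert.prems(1)[of j] lin[of "f j"] x y i fc
            by (simp add: s_def m_assoc r_neg a_minus_def)
        next
          assume "i \<in> I"
          then show ?thesis using insert.prems(1)[of i] lin[of "f i"] z y s by (simp add: a_minus_def)
        qed
      qed
      then have "u x = s \<otimes> u y" using lin[OF insert.prems(2)] u x y s eq_if_minus_zero[of "u x" "s \<otimes> u y"] by simp
      also have "\<dots> = u y \<otimes> inv (f j y) \<otimes> f j x" using i u x y fc by (simp add: s_def m_ac)
      finally show "u x = u y \<otimes> inv (f j y) \<otimes> f j x" .
    qed
  qed
  then obtain c where c: "c \<in> carrier R"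
    and cu: "\<And>x. x \<in> carrier X \<Longrightarrow> (\<And>i. i \<in> I \<Longrightarrow> f i x = \<zero>) \<Longrightarrow> u x = c \<otimes> f j x" by blast
  define v where "v x = u x \<ominus> c \<otimes> f j x" for x
  have "linear_map R X (left_regular R) v"
  proof (rule linear_mapI)
    note lj = linear_mapD[OF insert.prems(1)[of j]] linear_mapD[OF insert.prems(2)]
    show "\<And>x. x \<in> carrier X \<Longrightarrow> v x \<in> carrier (left_regular R)" using u c fc by (simp add: v_def)
    show "v (x \<oplus>\<^bsub>X\<^esub> y) = v x \<oplus>\<^bsub>left_regular R\<^esub> v y" if "x \<in> carrier X" "y \<in> carrier X" for x y
      using that lj c by (simp add: v_def a_minus_def r_distr minus_add a_ac)
    show "v (r \<odot>\<^bsub>X\<^esub> x) = r \<odot>\<^bsub>left_regular R\<^esub> v x" if "r \<in> carrier R" "x \<in> carrier X" for r x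
      using that lj c by (simp add: v_def a_minus_def r_distr r_minus m_ac)
  qed
  moreover have "v x = \<zero>" if "x \<in> carrier X" "\<And>i. i \<in> I \<Longrightarrow> f i x = \<zero>" for x
    using that cu c fc by (simp add: v_def a_minus_def r_neg)
  ultimately have "\<exists>d. d \<in> I \<rightarrow> carrier R \<and> (\<forall>x\<in>carrier X. v x = (\<Oplus>i\<in>I. d i \<otimes> f i x))"
    using insert.prems(1) by (intro insert.IH) auto
  then obtain d where d: "d \<in> I \<rightarrow> carrier R" "\<And>x. x \<in> carrier X \<Longrightarrow> v x = (\<Oplus>i\<in>I. d i \<otimes> f i x)" by blast
  show ?case
  proof (intro exI[of _ "d(j := c)"] conjI ballI)
    show "d(j := c) \<in> insert j I \<rightarrow> carrier R" using d c by auto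
    fix x assume x: "x \<in> carrier X"
    have "(\<Oplus>i\<in>insert j I. (d(j := c)) i \<otimes> f i x) = c \<otimes> f j x \<oplus> (\<Oplus>i\<in>I. (d(j := c)) i \<otimes> f i x)"
      using insert.hyps d c fc[OF x] by (subst finsum_insert) (auto simp: Pi_iff)
    also have "(\<Oplus>i\<in>I. (d(j := c)) i \<otimes> f i x) = (\<Oplus>i\<in>I. d i \<otimes> f i x)"
      using insert.hyps d fc[OF x] by (intro finsum_cong') (auto simp: Pi_iff)
    also have "\<dots> = v x" using d x by simp
    also have "c \<otimes> f j x \<oplus> v x = u x"
      using u[OF x] c fc[OF x, of j] by (simp add: v_def a_minus_def a_lcomm[of _ "u x"] r_neg)
    finally show "u x = (\<Oplus>i\<in>insert j I. (d(j := c)) i \<otimes> f i x)" ..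
  qed
qed

end

lemma linear_map_smult:
  assumes "module k V" "module k W" "linear_map k V W f" "r \<in> carrier k"
  shows "linear_map k V W (\<lambda>x. r \<odot>\<^bsub>W\<^esub> f x)"
proof -
  interpret V: module k V by fact
  interpret W: module k W by fact
  note l = linear_mapD[OF assms(3)]
  show ?thesis using assms(4)
    by (intro linear_mapI) (simp_all add: l W.smult_r_distr V.m_comm flip: W.smult_assoc1)
qed

lemma equalizer_submodule:
  assumes "module k V" "module k W" "linear_map k V W f" "linear_map k V W g"
  shows "submodule {x \<in> carrier V. f x = g x} k V"
proof -
  interpret V: module k V by fact
  interpret W: module k W by fact
  show ?thesis
    using linear_map_zero[OF assms(1,2,3)] linear_map_neg[OF assms(1,2,3)]
      linear_map_zero[OF assms(1,2,4)] linear_map_neg[OF assms(1,2,4)] assms(3,4)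
    by (intro V.submoduleI) (auto simp: linear_mapD)
qed

lemma vimage_submodule:
  assumes "module k V" "module k W" "linear_map k V W f" "submodule N k W"
  shows "submodule {x \<in> carrier V. f x \<in> N} k V"
proof -
  interpret V: module k V by fact
  interpret W: module k W by fact
  note N = W.submoduleE[OF assms(4)]
  show ?thesis
    using linear_map_zero[OF assms(1,2,3)] linear_map_neg[OF assms(1,2,3)] assms(3)
      submodule_zero[OF assms(2,4)] N
    by (intro V.submoduleI) (auto simp: linear_mapD)
qed

section \<open>Quotient modules\<close>

lemma quotient_coset:
  assumes M: "module k M" and N: "submodule N k M" and a: "a \<in> carrier M"
  shows "b \<in> N +>\<^bsub>M\<^esub> a \<longleftrightarrow> b \<in> carrier M \<and> b \<ominus>\<^bsub>M\<^esub> a \<in> N"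
    and "b \<in> carrier M \<Longrightarrow> N +>\<^bsub>M\<^esub> a = N +>\<^bsub>M\<^esub> b \<longleftrightarrow> a \<ominus>\<^bsub>M\<^esub> b \<in> N"
proof -
  interpret M: module k M by fact
  interpret abelian_subgroup N M
    using submodule.axioms(1)[OF N] by (intro abelian_subgroupI3 additive_subgroup.intro M.abelian_group_axioms)
  have *: "b \<in> N +>\<^bsub>M\<^esub> a \<longleftrightarrow> b \<in> carrier M \<and> b \<ominus>\<^bsub>M\<^esub> a \<in> N" if "a \<in> carrier M" for a b
    using a_rcos_module[OF that, of b] a_elemrcos_carrier[OF that, of b] by (auto simp: a_minus_def)
  show "b \<in> N +>\<^bsub>M\<^esub> a \<longleftrightarrow> b \<in> carrier M \<and> b \<ominus>\<^bsub>M\<^esub> a \<in> N" by (rule *[OF a])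
  show "N +>\<^bsub>M\<^esub> a = N +>\<^bsub>M\<^esub> b \<longleftrightarrow> a \<ominus>\<^bsub>M\<^esub> b \<in> N" if "b \<in> carrier M"
    using a_rcos_self[OF a] a_repr_independence'[of a b] that a *[OF that, of a] by auto
qed

lemma quotient_module_module:
  assumes M: "module k M" and N: "submodule N k M"
  shows "module k (quotient_module M N)"
    and "linear_map k M (quotient_module M N) (\<lambda>a. N +>\<^bsub>M\<^esub> a)"
    and "carrier (quotient_module M N) = (\<lambda>a. N +>\<^bsub>M\<^esub> a) ` carrier M"
proof -
  interpret M: module k M by fact
  interpret abelian_subgroup N M
    using submodule.axioms(1)[OF N] by (intro abelian_subgroupI3 additive_subgroup.intro M.abelian_group_axioms)
  note NE = M.submoduleE[OF N]
  let ?Q = "quotient_module M N" and ?q = "\<lambda>a. N +>\<^bsub>M\<^esub> a"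
  show car: "carrier ?Q = ?q ` carrier M"
    by (auto simp: quotient_module_def A_RCOSETS_def')
  have add: "?q a \<oplus>\<^bsub>?Q\<^esub> ?q b = ?q (a \<oplus>\<^bsub>M\<^esub> b)" if "a \<in> carrier M" "b \<in> carrier M" for a b
    using a_rcos_sum[OF that] by (simp add: quotient_module_def)
  have zero: "\<zero>\<^bsub>?Q\<^esub> = ?q \<zero>\<^bsub>M\<^esub>"
    using NE(1) by (simp add: quotient_module_def)
  have smult: "r \<odot>\<^bsub>?Q\<^esub> ?q a = ?q (r \<odot>\<^bsub>M\<^esub> a)" if "r \<in> carrier k" "a \<in> carrier M" for r a
  proof -
    have 1: "?q (r \<odot>\<^bsub>M\<^esub> x) = ?q (r \<odot>\<^bsub>M\<^esub> a)" if "x \<in> ?q a" for x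
    proof -
      have x: "x \<in> carrier M" "x \<ominus>\<^bsub>M\<^esub> a \<in> N" using that quotient_coset(1)[OF M N \<open>a \<in> carrier M\<close>] by auto
      have "r \<odot>\<^bsub>M\<^esub> x \<ominus>\<^bsub>M\<^esub> r \<odot>\<^bsub>M\<^esub> a = r \<odot>\<^bsub>M\<^esub> (x \<ominus>\<^bsub>M\<^esub> a)"
        using x \<open>r \<in> carrier k\<close> \<open>a \<in> carrier M\<close> by (simp add: a_minus_def M.smult_r_distr M.smult_r_minus)
      then have "r \<odot>\<^bsub>M\<^esub> x \<ominus>\<^bsub>M\<^esub> r \<odot>\<^bsub>M\<^esub> a \<in> N" using NE(4) x \<open>r \<in> carrier k\<close> by simp
      then show ?thesis using quotient_coset(2)[OF M N] x \<open>r \<in> carrier k\<close> \<open>a \<in> carrier M\<close> by simp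
    qed
    have "r \<odot>\<^bsub>?Q\<^esub> ?q a = (\<Union>x\<in>?q a. ?q (r \<odot>\<^bsub>M\<^esub> x))" by (simp add: quotient_module_def)
    also have "\<dots> = (\<Union>x\<in>?q a. ?q (r \<odot>\<^bsub>M\<^esub> a))" by (rule SUP_cong[OF refl 1])
    also have "\<dots> = ?q (r \<odot>\<^bsub>M\<^esub> a)" using a_rcos_self[OF that(2)] by blast
    finally show ?thesis .
  qed
  have "abelian_group ?Q"
  proof (rule abelian_groupI)
    fix x assume "x \<in> carrier ?Q"
    then obtain a where a: "a \<in> carrier M" "x = ?q a" by (auto simp: car)
    then show "\<exists>y\<in>carrier ?Q. y \<oplus>\<^bsub>?Q\<^esub> x = \<zero>\<^bsub>?Q\<^esub>"
      by (intro bexI[of _ "?q (\<ominus>\<^bsub>M\<^esub> a)"]) (auto simp: car add zero M.l_neg)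
  qed (auto simp: car add zero M.a_ac)
  then show "module k ?Q"
    by (intro moduleI) (auto simp: car add smult M.smult_l_distr M.smult_r_distr M.smult_assoc1 M.R.cring_axioms)
  show "linear_map k M ?Q ?q"
    by (intro linear_mapI) (auto simp: car add smult)
qed

section \<open>Bilinear maps and free modules\<close>

definition bilinear_map ::
  "('k, 'x) ring_scheme \<Rightarrow> ('k, 'v, 'y) module_scheme \<Rightarrow> ('k, 'w, 'z) module_scheme \<Rightarrow>
    ('k, 'n, 'a) module_scheme \<Rightarrow> ('v \<Rightarrow> 'w \<Rightarrow> 'n) \<Rightarrow> bool"
  where "bilinear_map k V W X \<beta> \<longleftrightarrow>
    (\<forall>v\<in>carrier V. linear_map k W X (\<beta> v)) \<and> (\<forall>w\<in>carrier W. linear_map k V X (\<lambda>v. \<beta> v w))"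

lemma bilinear_mapI:
  assumes "\<And>v. v \<in> carrier V \<Longrightarrow> linear_map k W X (\<beta> v)"
    and "\<And>w. w \<in> carrier W \<Longrightarrow> linear_map k V X (\<lambda>v. \<beta> v w)"
  shows "bilinear_map k V W X \<beta>"
  using assms by (auto simp: bilinear_map_def)

lemma bilinear_mapD:
  assumes "bilinear_map k V W X \<beta>"
  shows "v \<in> carrier V \<Longrightarrow> linear_map k W X (\<beta> v)"
    and "w \<in> carrier W \<Longrightarrow> linear_map k V X (\<lambda>v. \<beta> v w)"
    and "v \<in> carrier V \<Longrightarrow> w \<in> carrier W \<Longrightarrow> \<beta> v w \<in> carrier X"
  using assms by (auto simp: bilinear_map_def intro: linear_mapD(1))

lemma bilinear_map_comp:
  assumes "linear_map k V' V f" "linear_map k W' W g" "bilinear_map k V W X \<beta>" "linear_map k X Y h"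
  shows "bilinear_map k V' W' Y (\<lambda>v w. h (\<beta> (f v) (g w)))"
proof (rule bilinear_mapI)
  show "linear_map k W' Y (\<lambda>w. h (\<beta> (f v) (g w)))" if "v \<in> carrier V'" for v
    using linear_map_comp[OF linear_map_comp[OF assms(2) bilinear_mapD(1)[OF assms(3)]] assms(4)]
      linear_mapD(1)[OF assms(1) that] by simp
  show "linear_map k V' Y (\<lambda>v. h (\<beta> (f v) (g w)))" if "w \<in> carrier W'" for w
    using linear_map_comp[OF linear_map_comp[OF assms(1) bilinear_mapD(2)[OF assms(3)]] assms(4)]
      linear_mapD(1)[OF assms(2) that] by simp
qed

lemma scaled_bilinear:
  assumes "module k V" "linear_map k W (left_regular k) g" "linear_map k V X f" "module k X"
  shows "bilinear_map k V W X (\<lambda>v w. g w \<odot>\<^bsub>X\<^esub> f v)"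
    and "bilinear_map k W V X (\<lambda>w v. g w \<odot>\<^bsub>X\<^esub> f v)"
proof -
  interpret X: module k X by fact
  note l = linear_mapD[OF assms(2), simplified] linear_mapD[OF assms(3)]
  have 1: "linear_map k W X (\<lambda>w. g w \<odot>\<^bsub>X\<^esub> f v)" if "v \<in> carrier V" for v
    using that by (intro linear_mapI) (simp_all add: l X.smult_l_distr X.smult_assoc1)
  have 2: "linear_map k V X (\<lambda>v. g w \<odot>\<^bsub>X\<^esub> f v)" if "w \<in> carrier W" for w
    using that assms by (intro linear_map_smult) (simp_all add: l)
  show "bilinear_map k V W X (\<lambda>v w. g w \<odot>\<^bsub>X\<^esub> f v)" "bilinear_map k W V X (\<lambda>w v. g w \<odot>\<^bsub>X\<^esub> f v)"
    using 1 2 by (auto intro: bilinear_mapI)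
qed

text \<open>
  The linear extension to \<^const>\<open>free_module\<close> of a map on the generators. On a representative
  of a tensor it computes \<^const>\<open>tensor_lift\<close>.
\<close>

definition free_lift ::
  "('k, 'x) ring_scheme \<Rightarrow> ('k, 'n, 'y) module_scheme \<Rightarrow> ('s \<Rightarrow> 'n) \<Rightarrow> ('s \<Rightarrow> 'k) \<Rightarrow> 'n"
  where "free_lift k X \<beta> a = (\<Oplus>\<^bsub>X\<^esub>p\<in>{p. a p \<noteq> \<zero>\<^bsub>k\<^esub>}. a p \<odot>\<^bsub>X\<^esub> \<beta> p)"

context field
begin

lemma free_module_module: "module R (free_module R S)"
proof -
  have s: "finite {s. a s \<noteq> \<zero>} \<Longrightarrow> finite {s. b s \<noteq> \<zero>} \<Longrightarrow> finite {s. a s \<oplus> b s \<noteq> \<zero>}"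
    if "\<And>s. a s \<in> carrier R" "\<And>s. b s \<in> carrier R" for a b :: "_ \<Rightarrow> 'a"
    by (rule finite_subset[of _ "{s. a s \<noteq> \<zero>} \<union> {s. b s \<noteq> \<zero>}"]) (use that in auto)
  have m: "finite {s. a s \<noteq> \<zero>} \<Longrightarrow> finite {s. r \<otimes> a s \<noteq> \<zero>}"
    if "r \<in> carrier R" for a :: "_ \<Rightarrow> 'a" and r
    by (rule finite_subset[of _ "{s. a s \<noteq> \<zero>}"]) (use that in auto)
  have n: "finite {s. a s \<noteq> \<zero>} \<Longrightarrow> finite {s. \<ominus> a s \<noteq> \<zero>}"
    if "\<And>s. a s \<in> carrier R" for a :: "_ \<Rightarrow> 'a"
    by (rule finite_subset[of _ "{s. a s \<noteq> \<zero>}"]) (use that in auto)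
  have "abelian_group (free_module R S)"
  proof (rule abelian_groupI)
    fix a assume "a \<in> carrier (free_module R S)"
    then show "\<exists>b\<in>carrier (free_module R S). b \<oplus>\<^bsub>free_module R S\<^esub> a = \<zero>\<^bsub>free_module R S\<^esub>"
      by (intro bexI[of _ "\<lambda>s. \<ominus> a s"]) (auto simp: free_module_def fun_eq_iff n l_neg)
  qed (auto simp: free_module_def fun_eq_iff s a_ac)
  then show ?thesis
    by (intro moduleI) (auto simp: free_module_def fun_eq_iff m l_distr r_distr m_ac is_cring)
qed

lemma free_gen_closed: "s \<in> S \<Longrightarrow> free_gen R s \<in> carrier (free_module R S)"
  by (auto simp: free_gen_def free_module_def)

text \<open>
  The sum over the support depends on the element; to compare two elements, both sums are extended to a
  common finite set, where the additional terms vanish.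
\<close>

lemma free_lift_superset:
  assumes X: "module R X" and a: "a \<in> carrier (free_module R S)" and \<beta>: "\<beta> \<in> S \<rightarrow> carrier X"
    and T: "finite T" "{p. a p \<noteq> \<zero>} \<subseteq> T" "T \<subseteq> S"
  shows "free_lift R X \<beta> a = (\<Oplus>\<^bsub>X\<^esub>p\<in>T. a p \<odot>\<^bsub>X\<^esub> \<beta> p)"
proof -
  interpret X: module R X by fact
  show ?thesis unfolding free_lift_def
  proof (rule X.add.finprod_mono_neutral_cong_left)
    have \<beta>T: "\<beta> p \<in> carrier X" if "p \<in> T" for p using \<beta> T(3) that by auto
    show "a p \<odot>\<^bsub>X\<^esub> \<beta> p = \<zero>\<^bsub>X\<^esub>" if "p \<in> T - {p. a p \<noteq> \<zero>}" for p
      using that \<beta>T by simp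
    show "(\<lambda>p. a p \<odot>\<^bsub>X\<^esub> \<beta> p) \<in> T \<rightarrow> carrier X"
      using \<beta>T a by (auto simp: free_module_def)
  qed (use T in auto)
qed

lemma free_lift_closed:
  assumes X: "module R X" and a: "a \<in> carrier (free_module R S)" and \<beta>: "\<beta> \<in> S \<rightarrow> carrier X"
  shows "free_lift R X \<beta> a \<in> carrier X"
proof -
  interpret X: module R X by fact
  show ?thesis unfolding free_lift_def using a \<beta>
    by (intro X.finsum_closed) (auto simp: free_module_def)
qed

lemma free_lift_linear:
  assumes X: "module R X" and \<beta>: "\<beta> \<in> S \<rightarrow> carrier X"
  shows "linear_map R (free_module R S) X (free_lift R X \<beta>)"
proof (rule linear_mapI)
  interpret X: module R X by fact
  interpret F: module R "free_module R S" by (rule free_module_module)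
  show "\<And>a. a \<in> carrier (free_module R S) \<Longrightarrow> free_lift R X \<beta> a \<in> carrier X"
    by (rule free_lift_closed[OF X _ \<beta>])
  show "free_lift R X \<beta> (a \<oplus>\<^bsub>free_module R S\<^esub> b) = free_lift R X \<beta> a \<oplus>\<^bsub>X\<^esub> free_lift R X \<beta> b"
    if ab: "a \<in> carrier (free_module R S)" "b \<in> carrier (free_module R S)" for a b
  proof -
    let ?T = "{p. a p \<noteq> \<zero>} \<union> {p. b p \<noteq> \<zero>}"
    have T: "finite ?T" "?T \<subseteq> S" using ab by (auto simp: free_module_def)
    have c: "\<And>p. p \<in> ?T \<Longrightarrow> a p \<in> carrier R \<and> b p \<in> carrier R \<and> \<beta> p \<in> carrier X"
      using ab \<beta> T(2) by (auto simp: free_module_def)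
    have "free_lift R X \<beta> (a \<oplus>\<^bsub>free_module R S\<^esub> b) = (\<Oplus>\<^bsub>X\<^esub>p\<in>?T. (a p \<oplus> b p) \<odot>\<^bsub>X\<^esub> \<beta> p)"
      using F.a_closed[OF ab] by (subst free_lift_superset[OF X _ \<beta> T(1) _ T(2)]) (use ab in \<open>auto simp: free_module_def\<close>)
    also have "\<dots> = (\<Oplus>\<^bsub>X\<^esub>p\<in>?T. a p \<odot>\<^bsub>X\<^esub> \<beta> p \<oplus>\<^bsub>X\<^esub> b p \<odot>\<^bsub>X\<^esub> \<beta> p)"
      using c by (intro X.finsum_cong') (auto simp: X.smult_l_distr)
    also have "\<dots> = (\<Oplus>\<^bsub>X\<^esub>p\<in>?T. a p \<odot>\<^bsub>X\<^esub> \<beta> p) \<oplus>\<^bsub>X\<^esub> (\<Oplus>\<^bsub>X\<^esub>p\<in>?T. b p \<odot>\<^bsub>X\<^esub> \<beta> p)"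
      using c by (intro X.finsum_addf) auto
    also have "\<dots> = free_lift R X \<beta> a \<oplus>\<^bsub>X\<^esub> free_lift R X \<beta> b"
      using free_lift_superset[OF X ab(1) \<beta> T(1) _ T(2)] free_lift_superset[OF X ab(2) \<beta> T(1) _ T(2)] by auto
    finally show ?thesis .
  qed
  show "free_lift R X \<beta> (r \<odot>\<^bsub>free_module R S\<^esub> a) = r \<odot>\<^bsub>X\<^esub> free_lift R X \<beta> a"
    if r: "r \<in> carrier R" and a: "a \<in> carrier (free_module R S)" for r a
  proof -
    let ?T = "{p. a p \<noteq> \<zero>}"
    have T: "finite ?T" "?T \<subseteq> S" using a by (auto simp: free_module_def)
    have c: "\<And>p. p \<in> ?T \<Longrightarrow> a p \<in> carrier R \<and> \<beta> p \<in> carrier X"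
      using a \<beta> T(2) by (auto simp: free_module_def)
    have "free_lift R X \<beta> (r \<odot>\<^bsub>free_module R S\<^esub> a) = (\<Oplus>\<^bsub>X\<^esub>p\<in>?T. (r \<otimes> a p) \<odot>\<^bsub>X\<^esub> \<beta> p)"
      using F.smult_closed[OF r a] by (subst free_lift_superset[OF X _ \<beta> T(1) _ T(2)]) (use a r in \<open>auto simp: free_module_def\<close>)
    also have "\<dots> = (\<Oplus>\<^bsub>X\<^esub>p\<in>?T. r \<odot>\<^bsub>X\<^esub> (a p \<odot>\<^bsub>X\<^esub> \<beta> p))"
      using c r by (intro X.finsum_cong') (auto simp: X.smult_assoc1)
    also have "\<dots> = r \<odot>\<^bsub>X\<^esub> free_lift R X \<beta> a"
      unfolding free_lift_def using T c r by (intro X.finsum_smult_ldistr[symmetric]) auto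
    finally show ?thesis .
  qed
qed

lemma free_lift_gen:
  assumes X: "module R X" and "\<beta> s \<in> carrier X"
  shows "free_lift R X \<beta> (free_gen R s) = \<beta> s"
proof -
  interpret X: module R X by fact
  have "{p. free_gen R s p \<noteq> \<zero>} = {s}" by (auto simp: free_gen_def)
  then show ?thesis using assms(2) by (simp add: free_lift_def X.finsum_insert) (simp add: free_gen_def)
qed

lemma free_module_generated:
  assumes N: "submodule N R (free_module R S)" and gen: "\<And>s. s \<in> S \<Longrightarrow> free_gen R s \<in> N"
    and a: "a \<in> carrier (free_module R S)"
  shows "a \<in> N"
proof -
  interpret F: module R "free_module R S" by (rule free_module_module)
  note E = F.submoduleE[OF N]
  have *: "a \<in> N" if "finite T" "{p. a p \<noteq> \<zero>} = T" "a \<in> carrier (free_module R S)" for T a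
    using that
  proof (induction T arbitrary: a)
    case empty
    then have "a = \<zero>\<^bsub>free_module R S\<^esub>" by (auto simp: free_module_def)
    then show ?case using submodule_zero[OF F.module_axioms N] by simp
  next
    case (insert t T)
    let ?b = "a(t := \<zero>)"
    have b: "{p. ?b p \<noteq> \<zero>} = T" using insert by auto
    have "?b \<in> carrier (free_module R S)" using insert.prems insert.hyps(1) b by (auto simp: free_module_def)
    then have "?b \<in> N" using insert.IH b by blast
    moreover have t: "t \<in> S" "a t \<in> carrier R" using insert.prems by (auto simp: free_module_def)
    then have "a t \<odot>\<^bsub>free_module R S\<^esub> free_gen R t \<in> N" using gen E(4) by blast
    ultimately have "?b \<oplus>\<^bsub>free_module R S\<^esub> a t \<odot>\<^bsub>free_module R S\<^esub> free_gen R t \<in> N" by (rule E(5))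
    also have "?b \<oplus>\<^bsub>free_module R S\<^esub> a t \<odot>\<^bsub>free_module R S\<^esub> free_gen R t = a"
      using insert.prems t by (auto simp: free_module_def free_gen_def fun_eq_iff)
    finally show ?case .
  qed
  show ?thesis by (rule *[OF _ refl a]) (use a in \<open>auto simp: free_module_def\<close>)
qed

end

section \<open>Tensor products\<close>

text \<open>
  The representative of a coset that \<^const>\<open>tensor_lift\<close> chooses. Closure and compatibility
  with linear maps hold for each single representative; bilinearity enters through the independence of
  the choice.
\<close>

definition tensor_rep :: "('k, 'v, 'w) tensor \<Rightarrow> 'v \<times> 'w \<Rightarrow> 'k"
  where "tensor_rep t = (SOME a. a \<in> t)"

lemma tensor_lift_rep:
  "tensor_lift k X \<beta> t = free_lift k X (\<lambda>p. \<beta> (fst p) (snd p)) (tensor_rep t)"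
  by (simp add: tensor_lift_def free_lift_def tensor_rep_def Let_def)

context field
begin

abbreviation (input) "free_on V W \<equiv> free_module R (carrier V \<times> carrier W)"

lemma tensor_relations_subset:
  assumes V: "module R V" and W: "module R W"
  shows "tensor_relations R V W \<subseteq> carrier (free_on V W)"
proof -
  interpret V: module R V by fact
  interpret W: module R W by fact
  interpret F: module R "free_on V W" by (rule free_module_module)
  show ?thesis unfolding tensor_relations_def Let_def
    by (auto intro!: F.minus_closed F.a_closed F.smult_closed free_gen_closed)
qed

lemma tensor_null_submodule:
  assumes "module R V" "module R W"
  shows "submodule (tensor_null R V W) R (free_on V W)"
  unfolding tensor_null_def
  by (rule span_submodule(1)[OF free_module_module tensor_relations_subset[OF assms]])

lemma tensor_module:
  assumes "module R V" "module R W" shows "module R (tensor R V W)"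
  unfolding tensor_def
  by (rule quotient_module_module(1)[OF free_module_module tensor_null_submodule[OF assms]])

abbreviation (input) "tensor_class V W a \<equiv> tensor_null R V W +>\<^bsub>free_on V W\<^esub> a"

lemma tensor_class_linear:
  assumes "module R V" "module R W"
  shows "linear_map R (free_on V W) (tensor R V W) (tensor_class V W)"
  unfolding tensor_def
  by (rule quotient_module_module(2)[OF free_module_module tensor_null_submodule[OF assms]])

lemma tensor_rep:
  assumes V: "module R V" and W: "module R W" and t: "t \<in> carrier (tensor R V W)"
  shows "tensor_rep t \<in> carrier (free_on V W)" "tensor_class V W (tensor_rep t) = t"
proof -
  note F = free_module_module[of "carrier V \<times> carrier W"] and N = tensor_null_submodule[OF V W]
  interpret F: module R "free_on V W" by (rule F)
  obtain a where a: "a \<in> carrier (free_on V W)" "t = tensor_class V W a"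
    using t quotient_module_module(3)[OF F N] by (auto simp: tensor_def)
  have "a \<in> t" unfolding a(2) quotient_coset(1)[OF F N a(1)]
    using a(1) submodule_zero[OF F N] by (simp add: a_minus_def F.r_neg)
  then have "tensor_rep t \<in> t" unfolding tensor_rep_def by (rule someI[of "\<lambda>a. a \<in> t"])
  then have *: "tensor_rep t \<in> carrier (free_on V W)" "tensor_rep t \<ominus>\<^bsub>free_on V W\<^esub> a \<in> tensor_null R V W"
    using quotient_coset(1)[OF F N a(1)] a(2) by auto
  then show "tensor_rep t \<in> carrier (free_on V W)" "tensor_class V W (tensor_rep t) = t"
    using quotient_coset(2)[OF F N *(1) a(1)] a(2) by auto
qed

lemma tensor_lift_closed:
  assumes V: "module R V" and W: "module R W" and X: "module R X" and t: "t \<in> carrier (tensor R V W)"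
    and \<beta>: "\<And>v w. v \<in> carrier V \<Longrightarrow> w \<in> carrier W \<Longrightarrow> \<beta> v w \<in> carrier X"
  shows "tensor_lift R X \<beta> t \<in> carrier X"
  unfolding tensor_lift_rep
  by (rule free_lift_closed[OF X tensor_rep(1)[OF V W t]]) (use \<beta> in auto)

lemma tensor_lift_cong:
  assumes V: "module R V" and W: "module R W" and X: "module R X" and t: "t \<in> carrier (tensor R V W)"
    and \<beta>: "\<And>v w. v \<in> carrier V \<Longrightarrow> w \<in> carrier W \<Longrightarrow> \<beta> v w \<in> carrier X"
    and eq: "\<And>v w. v \<in> carrier V \<Longrightarrow> w \<in> carrier W \<Longrightarrow> \<beta> v w = \<gamma> v w"
  shows "tensor_lift R X \<beta> t = tensor_lift R X \<gamma> t"
proof -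
  interpret X: module R X by fact
  show ?thesis unfolding tensor_lift_rep free_lift_def
  proof (rule X.finsum_cong'[OF refl])
    have c: "fst p \<in> carrier V \<and> snd p \<in> carrier W \<and> tensor_rep t p \<in> carrier R" if "tensor_rep t p \<noteq> \<zero>" for p
      using tensor_rep(1)[OF V W t] that by (cases p) (auto simp: free_module_def)
    show "(\<lambda>p. tensor_rep t p \<odot>\<^bsub>X\<^esub> \<gamma> (fst p) (snd p)) \<in> {p. tensor_rep t p \<noteq> \<zero>} \<rightarrow> carrier X"
    proof (rule Pi_I)
      fix p assume "p \<in> {p. tensor_rep t p \<noteq> \<zero>}"
      then have "fst p \<in> carrier V" "snd p \<in> carrier W" "tensor_rep t p \<in> carrier R" using c by auto
      then show "tensor_rep t p \<odot>\<^bsub>X\<^esub> \<gamma> (fst p) (snd p) \<in> carrier X"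
        using \<beta>[of "fst p" "snd p"] by (simp add: eq)
    qed
    show "tensor_rep t p \<odot>\<^bsub>X\<^esub> \<beta> (fst p) (snd p) = tensor_rep t p \<odot>\<^bsub>X\<^esub> \<gamma> (fst p) (snd p)"
      if "p \<in> {p. tensor_rep t p \<noteq> \<zero>}" for p using that c[of p] eq by simp
  qed
qed

lemma linear_tensor_lift:
  assumes V: "module R V" and W: "module R W" and X: "module R X" and Y: "module R Y"
    and f: "linear_map R X Y f" and t: "t \<in> carrier (tensor R V W)"
    and \<beta>: "\<And>v w. v \<in> carrier V \<Longrightarrow> w \<in> carrier W \<Longrightarrow> \<beta> v w \<in> carrier X"
  shows "f (tensor_lift R X \<beta> t) = tensor_lift R Y (\<lambda>v w. f (\<beta> v w)) t"
proof -
  interpret X: module R X by fact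
  interpret Y: module R Y by fact
  have c: "fst p \<in> carrier V \<and> snd p \<in> carrier W \<and> tensor_rep t p \<in> carrier R" if "tensor_rep t p \<noteq> \<zero>" for p
    using tensor_rep(1)[OF V W t] that by (cases p) (auto simp: free_module_def)
  have "f (tensor_lift R X \<beta> t) = (\<Oplus>\<^bsub>Y\<^esub>p\<in>{p. tensor_rep t p \<noteq> \<zero>}. f (tensor_rep t p \<odot>\<^bsub>X\<^esub> \<beta> (fst p) (snd p)))"
    unfolding tensor_lift_rep free_lift_def using c \<beta> by (intro linear_map_finsum[OF X Y f]) auto
  also have "\<dots> = tensor_lift R Y (\<lambda>v w. f (\<beta> v w)) t"
    unfolding tensor_lift_rep free_lift_def
    using c \<beta> linear_mapD[OF f] by (intro Y.finsum_cong') auto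
  finally show ?thesis .
qed

text \<open>
  The universal property: for bilinear \<open>\<beta>\<close> the kernel of the extension of \<open>\<beta>\<close> to the free module is a
  submodule that contains the defining relations, so the value does not depend on the representative.
\<close>

lemma tensor_lift_class:
  assumes V: "module R V" and W: "module R W" and X: "module R X"
    and \<beta>: "bilinear_map R V W X \<beta>" and a: "a \<in> carrier (free_on V W)"
  shows "tensor_lift R X \<beta> (tensor_class V W a) = free_lift R X (\<lambda>p. \<beta> (fst p) (snd p)) a"
proof -
  interpret V: module R V by fact
  interpret W: module R W by fact
  interpret X: module R X by fact
  let ?F = "free_on V W" and ?L = "free_lift R X (\<lambda>p. \<beta> (fst p) (snd p))"
  note F = free_module_module[of "carrier V \<times> carrier W"] and N = tensor_null_submodule[OF V W]
  interpret F: module R ?F by (rule F)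
  have bc: "(\<lambda>p. \<beta> (fst p) (snd p)) \<in> carrier V \<times> carrier W \<rightarrow> carrier X"
    using bilinear_mapD(3)[OF \<beta>] by auto
  have lin: "linear_map R ?F X ?L" by (rule free_lift_linear[OF X bc])
  note lm = linear_map_minus[OF F X lin] linear_mapD[OF lin]
  have Lg: "?L (free_gen R (v, w)) = \<beta> v w" if "v \<in> carrier V" "w \<in> carrier W" for v w
    using free_lift_gen[OF X, of "\<lambda>p. \<beta> (fst p) (snd p)" "(v, w)"] bilinear_mapD(3)[OF \<beta> that] by simp
  note g = free_gen_closed[of _ "carrier V \<times> carrier W"]
  note bl = linear_mapD[OF bilinear_mapD(1)[OF \<beta>]] linear_mapD[OF bilinear_mapD(2)[OF \<beta>]]
  have mm: "x \<ominus>\<^bsub>X\<^esub> x = \<zero>\<^bsub>X\<^esub>" if "x \<in> carrier X" for x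
    using that by (simp add: a_minus_def X.r_neg)
  have "tensor_relations R V W \<subseteq> {a \<in> carrier ?F. ?L a = \<zero>\<^bsub>X\<^esub>}"
    unfolding tensor_relations_def Let_def
    by (auto simp: lm g Lg bl bilinear_mapD(3)[OF \<beta>] mm)
  then have null: "tensor_null R V W \<subseteq> {a \<in> carrier ?F. ?L a = \<zero>\<^bsub>X\<^esub>}"
    unfolding tensor_null_def
    by (intro span_submodule(3)[OF F tensor_relations_subset[OF V W]] kernel_submodule[OF F X lin])
  let ?t = "tensor_class V W a"
  have t: "?t \<in> carrier (tensor R V W)" by (rule linear_mapD(1)[OF tensor_class_linear[OF V W] a])
  note r = tensor_rep[OF V W t]
  have "tensor_rep ?t \<ominus>\<^bsub>?F\<^esub> a \<in> tensor_null R V W"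
    using quotient_coset(2)[OF F N r(1) a] r(2) by simp
  then have "?L (tensor_rep ?t) \<ominus>\<^bsub>X\<^esub> ?L a = \<zero>\<^bsub>X\<^esub>"
    using null lm(1)[OF r(1) a] by auto
  then show ?thesis
    unfolding tensor_lift_rep
    using linear_mapD(1)[OF lin r(1)] linear_mapD(1)[OF lin a] X.eq_if_minus_zero by blast
qed

lemma tensor_lift_linear:
  assumes V: "module R V" and W: "module R W" and X: "module R X" and \<beta>: "bilinear_map R V W X \<beta>"
  shows "linear_map R (tensor R V W) X (tensor_lift R X \<beta>)"
proof -
  let ?F = "free_on V W" and ?L = "free_lift R X (\<lambda>p. \<beta> (fst p) (snd p))"
  note F = free_module_module[of "carrier V \<times> carrier W"]
  interpret F: module R ?F by (rule F)
  interpret T: module R "tensor R V W" by (rule tensor_module[OF V W])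
  have bc: "(\<lambda>p. \<beta> (fst p) (snd p)) \<in> carrier V \<times> carrier W \<rightarrow> carrier X"
    using bilinear_mapD(3)[OF \<beta>] by auto
  note lin = linear_mapD[OF free_lift_linear[OF X bc]]
  note q = linear_mapD[OF tensor_class_linear[OF V W]]
  note l = tensor_lift_class[OF V W X \<beta>]
  have ex: "\<exists>a. a \<in> carrier ?F \<and> t = tensor_class V W a" if "t \<in> carrier (tensor R V W)" for t
    using tensor_rep[OF V W that] by metis
  show ?thesis
  proof (rule linear_mapI)
    fix t assume "t \<in> carrier (tensor R V W)"
    then show "tensor_lift R X \<beta> t \<in> carrier X"
      by (rule tensor_lift_closed[OF V W X]) (rule bilinear_mapD(3)[OF \<beta>])
  next
    fix s t assume "s \<in> carrier (tensor R V W)" "t \<in> carrier (tensor R V W)"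
    then obtain a b where ab: "a \<in> carrier ?F" "s = tensor_class V W a" "b \<in> carrier ?F" "t = tensor_class V W b"
      using ex by meson
    have "s \<oplus>\<^bsub>tensor R V W\<^esub> t = tensor_class V W (a \<oplus>\<^bsub>?F\<^esub> b)" using ab q(2) by simp
    then show "tensor_lift R X \<beta> (s \<oplus>\<^bsub>tensor R V W\<^esub> t) = tensor_lift R X \<beta> s \<oplus>\<^bsub>X\<^esub> tensor_lift R X \<beta> t"
      using ab l lin(2) by simp
  next
    fix r t assume r: "r \<in> carrier R" and "t \<in> carrier (tensor R V W)"
    then obtain a where ab: "a \<in> carrier ?F" "t = tensor_class V W a"
      using ex by meson
    have "r \<odot>\<^bsub>tensor R V W\<^esub> t = tensor_class V W (r \<odot>\<^bsub>?F\<^esub> a)" using ab q(3) r by simp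
    then show "tensor_lift R X \<beta> (r \<odot>\<^bsub>tensor R V W\<^esub> t) = r \<odot>\<^bsub>X\<^esub> tensor_lift R X \<beta> t"
      using ab l lin(3) r by simp
  qed
qed

lemma tensor_lift_pure:
  assumes V: "module R V" and W: "module R W" and X: "module R X" and \<beta>: "bilinear_map R V W X \<beta>"
    and vw: "v \<in> carrier V" "w \<in> carrier W"
  shows "tensor_lift R X \<beta> (pure_tensor R V W v w) = \<beta> v w"
proof -
  have "free_gen R (v, w) \<in> carrier (free_on V W)" using vw by (intro free_gen_closed) auto
  then have "tensor_lift R X \<beta> (pure_tensor R V W v w) = free_lift R X (\<lambda>p. \<beta> (fst p) (snd p)) (free_gen R (v, w))"
    unfolding pure_tensor_def by (rule tensor_lift_class[OF V W X \<beta>])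
  also have "\<dots> = \<beta> (fst (v, w)) (snd (v, w))"
    using bilinear_mapD(3)[OF \<beta> vw] by (intro free_lift_gen[OF X]) simp
  finally show ?thesis by simp
qed

lemma pure_tensor_bilinear:
  assumes V: "module R V" and W: "module R W"
  shows "bilinear_map R V W (tensor R V W) (pure_tensor R V W)"
proof -
  interpret V: module R V by fact
  interpret W: module R W by fact
  let ?F = "free_on V W"
  note F = free_module_module[of "carrier V \<times> carrier W"] and N = tensor_null_submodule[OF V W]
  interpret F: module R ?F by (rule F)
  note g = free_gen_closed[of _ "carrier V \<times> carrier W"]
  note q = linear_mapD[OF tensor_class_linear[OF V W]]
  have rel: "tensor_class V W a = tensor_class V W b"
    if "a \<ominus>\<^bsub>?F\<^esub> b \<in> tensor_relations R V W" "a \<in> carrier ?F" "b \<in> carrier ?F" for a b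
  proof -
    have "a \<ominus>\<^bsub>?F\<^esub> b \<in> tensor_null R V W"
      unfolding tensor_null_def
      by (rule subsetD[OF span_submodule(2)[OF F tensor_relations_subset[OF V W]] that(1)])
    then show ?thesis using quotient_coset(2)[OF F N that(2,3)] by blast
  qed
  show ?thesis
  proof (rule bilinear_mapI)
    fix v assume v: "v \<in> carrier V"
    show "linear_map R W (tensor R V W) (pure_tensor R V W v)"
    proof (rule linear_mapI)
      show "pure_tensor R V W v w \<in> carrier (tensor R V W)" if "w \<in> carrier W" for w
        unfolding pure_tensor_def using v that by (intro q(1) g) auto
      show "pure_tensor R V W v (w \<oplus>\<^bsub>W\<^esub> w') = pure_tensor R V W v w \<oplus>\<^bsub>tensor R V W\<^esub> pure_tensor R V W v w'"
        if "w \<in> carrier W" "w' \<in> carrier W" for w w'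
      proof -
        have "tensor_class V W (free_gen R (v, w \<oplus>\<^bsub>W\<^esub> w')) = tensor_class V W (free_gen R (v, w) \<oplus>\<^bsub>?F\<^esub> free_gen R (v, w'))"
        proof (rule rel)
          show "free_gen R (v, w \<oplus>\<^bsub>W\<^esub> w') \<ominus>\<^bsub>?F\<^esub> (free_gen R (v, w) \<oplus>\<^bsub>?F\<^esub> free_gen R (v, w')) \<in> tensor_relations R V W"
            unfolding tensor_relations_def Let_def using v that by blast
        qed (use v that in \<open>auto intro!: F.a_closed g\<close>)
        then show ?thesis unfolding pure_tensor_def using v that q(2) g by simp
      qed
      show "pure_tensor R V W v (r \<odot>\<^bsub>W\<^esub> w) = r \<odot>\<^bsub>tensor R V W\<^esub> pure_tensor R V W v w"
        if "r \<in> carrier R" "w \<in> carrier W" for r w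
      proof -
        have "tensor_class V W (free_gen R (v, r \<odot>\<^bsub>W\<^esub> w)) = tensor_class V W (r \<odot>\<^bsub>?F\<^esub> free_gen R (v, w))"
        proof (rule rel)
          show "free_gen R (v, r \<odot>\<^bsub>W\<^esub> w) \<ominus>\<^bsub>?F\<^esub> (r \<odot>\<^bsub>?F\<^esub> free_gen R (v, w)) \<in> tensor_relations R V W"
            unfolding tensor_relations_def Let_def using v that by blast
        qed (use v that in \<open>auto intro!: F.smult_closed g\<close>)
        then show ?thesis unfolding pure_tensor_def using v that q(3) g by simp
      qed
    qed
  next
    fix w assume w: "w \<in> carrier W"
    show "linear_map R V (tensor R V W) (\<lambda>v. pure_tensor R V W v w)"
    proof (rule linear_mapI)
      show "pure_tensor R V W v w \<in> carrier (tensor R V W)" if "v \<in> carrier V" for v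
        unfolding pure_tensor_def using w that by (intro q(1) g) auto
      show "pure_tensor R V W (v \<oplus>\<^bsub>V\<^esub> v') w = pure_tensor R V W v w \<oplus>\<^bsub>tensor R V W\<^esub> pure_tensor R V W v' w"
        if "v \<in> carrier V" "v' \<in> carrier V" for v v'
      proof -
        have "tensor_class V W (free_gen R (v \<oplus>\<^bsub>V\<^esub> v', w)) = tensor_class V W (free_gen R (v, w) \<oplus>\<^bsub>?F\<^esub> free_gen R (v', w))"
        proof (rule rel)
          show "free_gen R (v \<oplus>\<^bsub>V\<^esub> v', w) \<ominus>\<^bsub>?F\<^esub> (free_gen R (v, w) \<oplus>\<^bsub>?F\<^esub> free_gen R (v', w)) \<in> tensor_relations R V W"
            unfolding tensor_relations_def Let_def using w that by blast
        qed (use w that in \<open>auto intro!: F.a_closed g\<close>)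
        then show ?thesis unfolding pure_tensor_def using w that q(2) g by simp
      qed
      show "pure_tensor R V W (r \<odot>\<^bsub>V\<^esub> v) w = r \<odot>\<^bsub>tensor R V W\<^esub> pure_tensor R V W v w"
        if "r \<in> carrier R" "v \<in> carrier V" for r v
      proof -
        have "tensor_class V W (free_gen R (r \<odot>\<^bsub>V\<^esub> v, w)) = tensor_class V W (r \<odot>\<^bsub>?F\<^esub> free_gen R (v, w))"
        proof (rule rel)
          show "free_gen R (r \<odot>\<^bsub>V\<^esub> v, w) \<ominus>\<^bsub>?F\<^esub> (r \<odot>\<^bsub>?F\<^esub> free_gen R (v, w)) \<in> tensor_relations R V W"
            unfolding tensor_relations_def Let_def using w that by blast
        qed (use w that in \<open>auto intro!: F.smult_closed g\<close>)
        then show ?thesis unfolding pure_tensor_def using w that q(3) g by simp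
      qed
    qed
  qed
qed

lemma pure_tensor_closed:
  assumes "module R V" "module R W" "v \<in> carrier V" "w \<in> carrier W"
  shows "pure_tensor R V W v w \<in> carrier (tensor R V W)"
  by (rule bilinear_mapD(3)[OF pure_tensor_bilinear[OF assms(1,2)] assms(3,4)])

lemma tensor_generated:
  assumes V: "module R V" and W: "module R W" and N: "submodule N R (tensor R V W)"
    and pure: "\<And>v w. v \<in> carrier V \<Longrightarrow> w \<in> carrier W \<Longrightarrow> pure_tensor R V W v w \<in> N"
    and t: "t \<in> carrier (tensor R V W)"
  shows "t \<in> N"
proof -
  let ?F = "free_on V W"
  note F = free_module_module[of "carrier V \<times> carrier W"]
  have "tensor_rep t \<in> {a \<in> carrier ?F. tensor_class V W a \<in> N}"
  proof (rule free_module_generated[OF vimage_submodule[OF F tensor_module[OF V W] tensor_class_linear[OF V W] N]])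
    show "tensor_rep t \<in> carrier ?F" by (rule tensor_rep(1)[OF V W t])
    show "free_gen R s \<in> {a \<in> carrier ?F. tensor_class V W a \<in> N}" if "s \<in> carrier V \<times> carrier W" for s
      using that pure by (cases s) (auto simp: pure_tensor_def intro!: free_gen_closed)
  qed
  then show ?thesis using tensor_rep(2)[OF V W t] by simp
qed

text \<open>
  The pure tensors generate, so linear maps are compared on them. All identities between composites of
  \<^const>\<open>tensor_lift\<close>, \<^const>\<open>tensor_map\<close> and \<^const>\<open>tensor_assoc\<close> below are reduced to this.
\<close>

lemma tensor_ext:
  assumes V: "module R V" and W: "module R W" and X: "module R X"
    and f: "linear_map R (tensor R V W) X f" and g: "linear_map R (tensor R V W) X g"
    and eq: "\<And>v w. v \<in> carrier V \<Longrightarrow> w \<in> carrier W \<Longrightarrow> f (pure_tensor R V W v w) = g (pure_tensor R V W v w)"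
    and t: "t \<in> carrier (tensor R V W)"
  shows "f t = g t"
  using tensor_generated[OF V W equalizer_submodule[OF tensor_module[OF V W] X f g] _ t]
    eq pure_tensor_closed[OF V W] by auto

lemma tensor_lift_add:
  assumes V: "module R V" and W: "module R W" and X: "module R X" and t: "t \<in> carrier (tensor R V W)"
    and \<beta>: "\<And>v w. v \<in> carrier V \<Longrightarrow> w \<in> carrier W \<Longrightarrow> \<beta> v w \<in> carrier X"
    and \<gamma>: "\<And>v w. v \<in> carrier V \<Longrightarrow> w \<in> carrier W \<Longrightarrow> \<gamma> v w \<in> carrier X"
  shows "tensor_lift R X (\<lambda>v w. \<beta> v w \<oplus>\<^bsub>X\<^esub> \<gamma> v w) t = tensor_lift R X \<beta> t \<oplus>\<^bsub>X\<^esub> tensor_lift R X \<gamma> t"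
proof -
  interpret X: module R X by fact
  have c: "fst p \<in> carrier V \<and> snd p \<in> carrier W \<and> tensor_rep t p \<in> carrier R" if "tensor_rep t p \<noteq> \<zero>" for p
    using tensor_rep(1)[OF V W t] that by (cases p) (auto simp: free_module_def)
  have "tensor_lift R X (\<lambda>v w. \<beta> v w \<oplus>\<^bsub>X\<^esub> \<gamma> v w) t =
    (\<Oplus>\<^bsub>X\<^esub>p\<in>{p. tensor_rep t p \<noteq> \<zero>}. tensor_rep t p \<odot>\<^bsub>X\<^esub> \<beta> (fst p) (snd p) \<oplus>\<^bsub>X\<^esub> tensor_rep t p \<odot>\<^bsub>X\<^esub> \<gamma> (fst p) (snd p))"
    unfolding tensor_lift_rep free_lift_def
    using c \<beta> \<gamma> by (intro X.finsum_cong') (auto simp: X.smult_r_distr)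
  also have "\<dots> = tensor_lift R X \<beta> t \<oplus>\<^bsub>X\<^esub> tensor_lift R X \<gamma> t"
    unfolding tensor_lift_rep free_lift_def
    using c \<beta> \<gamma> by (intro X.finsum_addf) auto
  finally show ?thesis .
qed

lemma tensor_lift_smult:
  assumes V: "module R V" and W: "module R W" and X: "module R X" and t: "t \<in> carrier (tensor R V W)"
    and \<beta>: "\<And>v w. v \<in> carrier V \<Longrightarrow> w \<in> carrier W \<Longrightarrow> \<beta> v w \<in> carrier X" and r: "r \<in> carrier R"
  shows "tensor_lift R X (\<lambda>v w. r \<odot>\<^bsub>X\<^esub> \<beta> v w) t = r \<odot>\<^bsub>X\<^esub> tensor_lift R X \<beta> t"
proof -
  have l: "linear_map R X X (\<lambda>x. r \<odot>\<^bsub>X\<^esub> x)" using linear_map_smult[OF X X linear_map_id r] by simp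
  show ?thesis by (rule linear_tensor_lift[symmetric, OF V W X X l t \<beta>])
qed

lemma tensor_lift_zero:
  assumes V: "module R V" and W: "module R W" and X: "module R X" and t: "t \<in> carrier (tensor R V W)"
    and \<beta>: "\<And>p. tensor_rep t p \<noteq> \<zero> \<Longrightarrow> \<beta> (fst p) (snd p) = \<zero>\<^bsub>X\<^esub>"
  shows "tensor_lift R X \<beta> t = \<zero>\<^bsub>X\<^esub>"
proof -
  interpret X: module R X by fact
  have "tensor_lift R X \<beta> t = (\<Oplus>\<^bsub>X\<^esub>p\<in>{p. tensor_rep t p \<noteq> \<zero>}. \<zero>\<^bsub>X\<^esub>)"
    unfolding tensor_lift_rep free_lift_def
    using \<beta> tensor_rep(1)[OF V W t] by (intro X.finsum_cong') (auto simp: free_module_def)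
  then show ?thesis by simp
qed

lemma tensor_map_bilinear:
  assumes "module R V'" "module R W'" "linear_map R V V' f" "linear_map R W W' g"
  shows "bilinear_map R V W (tensor R V' W') (\<lambda>v w. pure_tensor R V' W' (f v) (g w))"
  using bilinear_map_comp[OF assms(3,4) pure_tensor_bilinear[OF assms(1,2)] linear_map_id] by simp

lemma tensor_map_linear:
  assumes "module R V" "module R W" "module R V'" "module R W'" "linear_map R V V' f" "linear_map R W W' g"
  shows "linear_map R (tensor R V W) (tensor R V' W') (tensor_map R V' W' f g)"
  unfolding tensor_map_def
  by (intro tensor_lift_linear assms tensor_module tensor_map_bilinear)

lemma tensor_map_pure:
  assumes "module R V" "module R W" "module R V'" "module R W'" "linear_map R V V' f" "linear_map R W W' g"
    "v \<in> carrier V" "w \<in> carrier W"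
  shows "tensor_map R V' W' f g (pure_tensor R V W v w) = pure_tensor R V' W' (f v) (g w)"
  unfolding tensor_map_def
  by (intro tensor_lift_pure assms tensor_module tensor_map_bilinear)

lemma tensor_lift_tensor_map:
  assumes V: "module R V" and W: "module R W" and V': "module R V'" and W': "module R W'" and X: "module R X"
    and f: "linear_map R V V' f" and g: "linear_map R W W' g" and \<beta>: "bilinear_map R V' W' X \<beta>"
    and t: "t \<in> carrier (tensor R V W)"
  shows "tensor_lift R X \<beta> (tensor_map R V' W' f g t) = tensor_lift R X (\<lambda>v w. \<beta> (f v) (g w)) t"
proof -
  have b: "bilinear_map R V W X (\<lambda>v w. \<beta> (f v) (g w))"
    using bilinear_map_comp[OF f g \<beta> linear_map_id] by simp
  show ?thesis
    by (rule tensor_ext[OF V W X linear_map_comp[OF tensor_map_linear[OF V W V' W' f g]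
          tensor_lift_linear[OF V' W' X \<beta>]] tensor_lift_linear[OF V W X b] _ t])
     (simp add: tensor_map_pure[OF V W V' W' f g] tensor_lift_pure[OF V' W' X \<beta>] tensor_lift_pure[OF V W X b]
      linear_mapD(1)[OF f] linear_mapD(1)[OF g])
qed

lemma tensor_map_comp:
  assumes "module R U" "module R V" "module R U'" "module R V'" "module R U''" "module R V''"
    "linear_map R U U' f" "linear_map R V V' g" "linear_map R U' U'' f'" "linear_map R V' V'' g'"
    "t \<in> carrier (tensor R U V)"
  shows "tensor_map R U'' V'' f' g' (tensor_map R U' V' f g t) = tensor_map R U'' V'' (\<lambda>x. f' (f x)) (\<lambda>x. g' (g x)) t"
  using tensor_lift_tensor_map[OF assms(1-4) tensor_module[OF assms(5,6)] assms(7,8)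
      tensor_map_bilinear[OF assms(5,6,9,10)] assms(11)]
  by (simp add: tensor_map_def)

lemma tensor_map_cong:
  assumes "module R V" "module R W" "module R V'" "module R W'" "linear_map R V V' f" "linear_map R W W' g"
    and "\<And>v. v \<in> carrier V \<Longrightarrow> f v = f' v" "\<And>w. w \<in> carrier W \<Longrightarrow> g w = g' w"
    and "t \<in> carrier (tensor R V W)"
  shows "tensor_map R V' W' f g t = tensor_map R V' W' f' g' t"
  unfolding tensor_map_def
  by (rule tensor_lift_cong[OF assms(1,2) tensor_module[OF assms(3,4)] assms(9)])
    (simp_all add: assms(7,8)[symmetric] pure_tensor_closed assms(3,4) linear_mapD(1)[OF assms(5)] linear_mapD(1)[OF assms(6)])

lemma tensor_map_ident:
  assumes V: "module R V" and W: "module R W" and f: "\<And>v. v \<in> carrier V \<Longrightarrow> f v = v"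
    and g: "\<And>w. w \<in> carrier W \<Longrightarrow> g w = w" and t: "t \<in> carrier (tensor R V W)"
  shows "tensor_map R V W f g t = t"
proof -
  have l: "linear_map R V V f" "linear_map R W W g"
    using linear_map_cong[OF V linear_map_id, of f] linear_map_cong[OF W linear_map_id, of g] f g by auto
  have "tensor_map R V W f g t = id t"
    by (rule tensor_ext[OF V W tensor_module[OF V W] tensor_map_linear[OF V W V W l] linear_map_id _ t])
      (simp add: tensor_map_pure[OF V W V W l] f g)
  then show ?thesis by simp
qed

text \<open>
  For trilinear \<open>\<beta>\<close> the map \<open>(t, w) \<mapsto> \<Sum> \<beta> u v w\<close> with \<open>t = \<Sum> u \<otimes> v\<close> is bilinear. Therefore both lifts in
  \<^const>\<open>tensor_assoc\<close> are independent of representatives.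
\<close>

lemma nested_tensor_lift_bilinear:
  assumes U: "module R U" and V: "module R V" and W: "module R W" and X: "module R X"
    and \<beta>1: "\<And>w. w \<in> carrier W \<Longrightarrow> bilinear_map R U V X (\<lambda>u v. \<beta> u v w)"
    and \<beta>2: "\<And>u v. u \<in> carrier U \<Longrightarrow> v \<in> carrier V \<Longrightarrow> linear_map R W X (\<beta> u v)"
  shows "bilinear_map R (tensor R U V) W X (\<lambda>t w. tensor_lift R X (\<lambda>u v. \<beta> u v w) t)"
proof (rule bilinear_mapI)
  interpret W: module R W by fact
  interpret X: module R X by fact
  show "linear_map R (tensor R U V) X (tensor_lift R X (\<lambda>u v. \<beta> u v w))" if "w \<in> carrier W" for w
    by (rule tensor_lift_linear[OF U V X \<beta>1[OF that]])
  fix t assume t: "t \<in> carrier (tensor R U V)"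
  note b = linear_mapD[OF \<beta>2]
  show "linear_map R W X (\<lambda>w. tensor_lift R X (\<lambda>u v. \<beta> u v w) t)"
  proof (rule linear_mapI)
    show "tensor_lift R X (\<lambda>u v. \<beta> u v w) t \<in> carrier X" if "w \<in> carrier W" for w
      by (rule tensor_lift_closed[OF U V X t b(1)[OF _ _ that]])
    show "tensor_lift R X (\<lambda>u v. \<beta> u v (w \<oplus>\<^bsub>W\<^esub> w')) t = tensor_lift R X (\<lambda>u v. \<beta> u v w) t \<oplus>\<^bsub>X\<^esub> tensor_lift R X (\<lambda>u v. \<beta> u v w') t"
      if "w \<in> carrier W" "w' \<in> carrier W" for w w'
    proof -
      have "tensor_lift R X (\<lambda>u v. \<beta> u v (w \<oplus>\<^bsub>W\<^esub> w')) t = tensor_lift R X (\<lambda>u v. \<beta> u v w \<oplus>\<^bsub>X\<^esub> \<beta> u v w') t"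
        by (rule tensor_lift_cong[OF U V X t]) (use that in \<open>simp_all add: b\<close>)
      also have "\<dots> = tensor_lift R X (\<lambda>u v. \<beta> u v w) t \<oplus>\<^bsub>X\<^esub> tensor_lift R X (\<lambda>u v. \<beta> u v w') t"
        by (rule tensor_lift_add[OF U V X t]) (use that in \<open>simp_all add: b\<close>)
      finally show ?thesis .
    qed
    show "tensor_lift R X (\<lambda>u v. \<beta> u v (r \<odot>\<^bsub>W\<^esub> w)) t = r \<odot>\<^bsub>X\<^esub> tensor_lift R X (\<lambda>u v. \<beta> u v w) t"
      if r: "r \<in> carrier R" and w: "w \<in> carrier W" for r w
    proof -
      have l: "linear_map R X X (\<lambda>x. r \<odot>\<^bsub>X\<^esub> x)" using linear_map_smult[OF X X linear_map_id r] by simp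
      have "tensor_lift R X (\<lambda>u v. \<beta> u v (r \<odot>\<^bsub>W\<^esub> w)) t = tensor_lift R X (\<lambda>u v. r \<odot>\<^bsub>X\<^esub> \<beta> u v w) t"
        by (rule tensor_lift_cong[OF U V X t]) (use w r in \<open>simp_all add: b\<close>)
      also have "\<dots> = r \<odot>\<^bsub>X\<^esub> tensor_lift R X (\<lambda>u v. \<beta> u v w) t"
        by (rule linear_tensor_lift[symmetric, OF U V X X l t]) (use w in \<open>simp add: b\<close>)
      finally show ?thesis .
    qed
  qed
qed

lemma triple_pure_multilinear:
  assumes U: "module R U" and V: "module R V" and W: "module R W"
  shows "w \<in> carrier W \<Longrightarrow> bilinear_map R U V (tensor R U (tensor R V W))
      (\<lambda>u v. pure_tensor R U (tensor R V W) u (pure_tensor R V W v w))"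
    and "u \<in> carrier U \<Longrightarrow> v \<in> carrier V \<Longrightarrow> linear_map R W (tensor R U (tensor R V W))
      (\<lambda>w. pure_tensor R U (tensor R V W) u (pure_tensor R V W v w))"
proof -
  note VW = tensor_module[OF V W]
  show "bilinear_map R U V (tensor R U (tensor R V W))
      (\<lambda>u v. pure_tensor R U (tensor R V W) u (pure_tensor R V W v w))" if w: "w \<in> carrier W" for w
    using tensor_map_bilinear[OF U VW linear_map_id bilinear_mapD(2)[OF pure_tensor_bilinear[OF V W] w]] by simp
  show "linear_map R W (tensor R U (tensor R V W))
      (\<lambda>w. pure_tensor R U (tensor R V W) u (pure_tensor R V W v w))" if "u \<in> carrier U" "v \<in> carrier V" for u v
    by (rule linear_map_comp[OF bilinear_mapD(1)[OF pure_tensor_bilinear[OF V W] that(2)]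
          bilinear_mapD(1)[OF pure_tensor_bilinear[OF U VW] that(1)]])
qed

lemma tensor_assoc_linear:
  assumes U: "module R U" and V: "module R V" and W: "module R W"
  shows "linear_map R (tensor R (tensor R U V) W) (tensor R U (tensor R V W)) (tensor_assoc R U V W)"
  unfolding tensor_assoc_def Let_def
  by (intro tensor_lift_linear nested_tensor_lift_bilinear triple_pure_multilinear tensor_module assms)

lemma tensor_assoc_pure:
  assumes U: "module R U" and V: "module R V" and W: "module R W" and t: "t \<in> carrier (tensor R U V)" and w: "w \<in> carrier W"
  shows "tensor_assoc R U V W (pure_tensor R (tensor R U V) W t w) =
    tensor_map R U (tensor R V W) id (\<lambda>v. pure_tensor R V W v w) t"
proof -
  have "tensor_assoc R U V W (pure_tensor R (tensor R U V) W t w) = 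
   tensor_lift R (tensor R U (tensor R V W)) (\<lambda>u v. pure_tensor R U (tensor R V W) u (pure_tensor R V W v w)) t"
    unfolding tensor_assoc_def Let_def
    by (subst tensor_lift_pure) (auto intro!: nested_tensor_lift_bilinear triple_pure_multilinear tensor_module assms)
  then show ?thesis by (simp add: tensor_map_def)
qed

lemma tensor_assoc_natural:
  assumes M: "module R M" and V: "module R V" and U: "module R U" and W: "module R W"
    and i: "linear_map R M U i" and t: "t \<in> carrier (tensor R (tensor R M V) W)"
  shows "tensor_map R U (tensor R V W) i id (tensor_assoc R M V W t) =
    tensor_assoc R U V W (tensor_map R (tensor R U V) W (tensor_map R U V i id) id t)"
proof -
  note VW = tensor_module[OF V W] and MV = tensor_module[OF M V] and UV = tensor_module[OF U V]
  note J = tensor_map_linear[OF M V U V i linear_map_id]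
  show ?thesis
  proof (rule tensor_ext[OF MV W tensor_module[OF U VW] _ _ _ t])
    show "linear_map R (tensor R (tensor R M V) W) (tensor R U (tensor R V W))
       (\<lambda>t. tensor_map R U (tensor R V W) i id (tensor_assoc R M V W t))"
      by (rule linear_map_comp[OF tensor_assoc_linear[OF M V W] tensor_map_linear[OF M VW U VW i linear_map_id]])
    show "linear_map R (tensor R (tensor R M V) W) (tensor R U (tensor R V W))
       (\<lambda>t. tensor_assoc R U V W (tensor_map R (tensor R U V) W (tensor_map R U V i id) id t))"
      by (rule linear_map_comp[OF tensor_map_linear[OF MV W UV W J linear_map_id] tensor_assoc_linear[OF U V W]])
    fix s w assume s: "s \<in> carrier (tensor R M V)" and w: "w \<in> carrier W"
    note pl = bilinear_mapD(2)[OF pure_tensor_bilinear[OF V W] w]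
    have "tensor_map R U (tensor R V W) i id (tensor_assoc R M V W (pure_tensor R (tensor R M V) W s w)) =
      tensor_map R U (tensor R V W) i (\<lambda>v. pure_tensor R V W v w) s"
      using tensor_map_comp[OF M V M VW U VW linear_map_id pl i linear_map_id s]
      by (simp add: tensor_assoc_pure[OF M V W s w])
    also have "\<dots> = tensor_map R U (tensor R V W) id (\<lambda>v. pure_tensor R V W v w) (tensor_map R U V i id s)"
      using tensor_map_comp[OF M V U V U VW i linear_map_id linear_map_id pl s] by simp
    also have "\<dots> = tensor_assoc R U V W (tensor_map R (tensor R U V) W (tensor_map R U V i id) id (pure_tensor R (tensor R M V) W s w))"
      using tensor_map_pure[OF MV W UV W J linear_map_id s w]
        tensor_assoc_pure[OF U V W linear_mapD(1)[OF J s] w] by simp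
    finally show "tensor_map R U (tensor R V W) i id (tensor_assoc R M V W (pure_tensor R (tensor R M V) W s w)) =
      tensor_assoc R U V W (tensor_map R (tensor R U V) W (tensor_map R U V i id) id (pure_tensor R (tensor R M V) W s w))" .
  qed
qed

section \<open>Functionals separate tensors\<close>

text \<open>
  If \<open>1 \<otimes> g\<close> kills \<open>\<Sum> v\<^sub>i \<otimes> w\<^sub>i\<close> for every functional \<open>g\<close>, then the sum is zero. By induction on the number
  of terms: when \<open>w\<^sub>j\<close> is a combination of the other \<open>w\<^sub>i\<close>, its term is absorbed into the others;
  otherwise some functional is 1 on \<open>w\<^sub>j\<close> and 0 on the others, and the hypothesis for it says
  \<open>v\<^sub>j = 0\<close>.
\<close>

lemma tensor_sum_eq_zero:
  assumes V: "module R V" and W: "module R W" and I: "finite I"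
    and v: "v \<in> I \<rightarrow> carrier V" and w: "w \<in> I \<rightarrow> carrier W"
    and sep: "\<And>g. g \<in> Hom_mod R W (left_regular R) \<Longrightarrow> (\<Oplus>\<^bsub>V\<^esub>i\<in>I. g (w i) \<odot>\<^bsub>V\<^esub> v i) = \<zero>\<^bsub>V\<^esub>"
  shows "(\<Oplus>\<^bsub>tensor R V W\<^esub>i\<in>I. pure_tensor R V W (v i) (w i)) = \<zero>\<^bsub>tensor R V W\<^esub>"
  using I v w sep
proof (induction I arbitrary: v)
  case empty
  interpret T: module R "tensor R V W" by (rule tensor_module[OF V W])
  show ?case by simp
next
  case (insert j I)
  interpret V: module R V by fact
  interpret W: module R W by fact
  interpret T: module R "tensor R V W" by (rule tensor_module[OF V W])
  note bil = pure_tensor_bilinear[OF V W]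
  note p1 = linear_mapD[OF bilinear_mapD(1)[OF bil]] and p2 = linear_mapD[OF bilinear_mapD(2)[OF bil]]
  have vj: "v j \<in> carrier V" "w j \<in> carrier W" and vI: "v \<in> I \<rightarrow> carrier V" "w \<in> I \<rightarrow> carrier W"
    using insert.prems by auto
  have vi: "\<And>i. i \<in> I \<Longrightarrow> v i \<in> carrier V" "\<And>i. i \<in> I \<Longrightarrow> w i \<in> carrier W" using vI by auto
  have gc: "g (w i) \<in> carrier R" if "g \<in> Hom_mod R W (left_regular R)" "i \<in> insert j I" for g i
    using linear_mapD(1)[OF Hom_mod_linear[OF that(1)]] vj vi that(2) by auto
  define A where "A = {\<Oplus>\<^bsub>W\<^esub>i\<in>I. c i \<odot>\<^bsub>W\<^esub> w i | c. c \<in> I \<rightarrow> carrier R}"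
  have AI: "(\<Oplus>\<^bsub>W\<^esub>i\<in>I. c i \<odot>\<^bsub>W\<^esub> w i) \<in> A" if "c \<in> I \<rightarrow> carrier R" for c using that by (auto simp: A_def)
  have cl: "(\<lambda>i. c i \<odot>\<^bsub>W\<^esub> w i) \<in> I \<rightarrow> carrier W" if "c \<in> I \<rightarrow> carrier R" for c using that vI by auto
  have A_smult: "r \<odot>\<^bsub>W\<^esub> x \<in> A" if r: "r \<in> carrier R" and x: "x \<in> A" for r x
  proof -
    obtain c where c: "c \<in> I \<rightarrow> carrier R" "x = (\<Oplus>\<^bsub>W\<^esub>i\<in>I. c i \<odot>\<^bsub>W\<^esub> w i)" using x by (auto simp: A_def)
    have "r \<odot>\<^bsub>W\<^esub> x = (\<Oplus>\<^bsub>W\<^esub>i\<in>I. r \<odot>\<^bsub>W\<^esub> (c i \<odot>\<^bsub>W\<^esub> w i))"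
      unfolding c(2) by (rule W.finsum_smult_ldistr[OF insert.hyps(1) r cl[OF c(1)]])
    also have "\<dots> = (\<Oplus>\<^bsub>W\<^esub>i\<in>I. (r \<otimes> c i) \<odot>\<^bsub>W\<^esub> w i)"
      using r c(1) vI by (intro W.finsum_cong') (auto simp: W.smult_assoc1 Pi_iff)
    also have "\<dots> \<in> A" using r c(1) by (intro AI) auto
    finally show ?thesis .
  qed
  have A: "submodule A R W"
  proof (rule W.submoduleI)
    show Ac: "A \<subseteq> carrier W" using cl by (auto simp: A_def intro!: W.finsum_closed)
    have "(\<Oplus>\<^bsub>W\<^esub>i\<in>I. \<zero> \<odot>\<^bsub>W\<^esub> w i) = (\<Oplus>\<^bsub>W\<^esub>i\<in>I. \<zero>\<^bsub>W\<^esub>)" using vi by (intro W.finsum_cong') auto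
    then show "\<zero>\<^bsub>W\<^esub> \<in> A" using AI[of "\<lambda>_. \<zero>"] by simp
    show "\<ominus>\<^bsub>W\<^esub> a \<in> A" if "a \<in> A" for a
      using A_smult[of "\<ominus> \<one>" a] that Ac by (auto simp: W.smult_l_minus)
    show "a \<oplus>\<^bsub>W\<^esub> b \<in> A" if ab: "a \<in> A" "b \<in> A" for a b
    proof -
      obtain c d where c: "c \<in> I \<rightarrow> carrier R" "a = (\<Oplus>\<^bsub>W\<^esub>i\<in>I. c i \<odot>\<^bsub>W\<^esub> w i)"
        and d: "d \<in> I \<rightarrow> carrier R" "b = (\<Oplus>\<^bsub>W\<^esub>i\<in>I. d i \<odot>\<^bsub>W\<^esub> w i)" using ab unfolding A_def by blast
      have "a \<oplus>\<^bsub>W\<^esub> b = (\<Oplus>\<^bsub>W\<^esub>i\<in>I. c i \<odot>\<^bsub>W\<^esub> w i \<oplus>\<^bsub>W\<^esub> d i \<odot>\<^bsub>W\<^esub> w i)"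
        unfolding c(2) d(2) by (rule W.finsum_addf[symmetric, OF cl[OF c(1)] cl[OF d(1)]])
      also have "\<dots> = (\<Oplus>\<^bsub>W\<^esub>i\<in>I. (c i \<oplus> d i) \<odot>\<^bsub>W\<^esub> w i)"
        using c(1) d(1) vI by (intro W.finsum_cong') (auto simp: W.smult_l_distr Pi_iff)
      also have "\<dots> \<in> A" using c(1) d(1) by (intro AI) auto
      finally show ?thesis .
    qed
  qed (rule A_smult)
  have sum: "(\<Oplus>\<^bsub>tensor R V W\<^esub>i\<in>insert j I. pure_tensor R V W (v i) (w i)) =
    pure_tensor R V W (v j) (w j) \<oplus>\<^bsub>tensor R V W\<^esub> (\<Oplus>\<^bsub>tensor R V W\<^esub>i\<in>I. pure_tensor R V W (v i) (w i))"
    using insert.hyps vj vi by (intro T.finsum_insert) (auto simp: p1)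
  have sumV: "(\<Oplus>\<^bsub>V\<^esub>i\<in>insert j I. g (w i) \<odot>\<^bsub>V\<^esub> v i) = g (w j) \<odot>\<^bsub>V\<^esub> v j \<oplus>\<^bsub>V\<^esub> (\<Oplus>\<^bsub>V\<^esub>i\<in>I. g (w i) \<odot>\<^bsub>V\<^esub> v i)"
    if "g \<in> Hom_mod R W (left_regular R)" for g
    using insert.hyps vj vi gc[OF that] by (intro V.finsum_insert) auto
  show ?case
  proof (cases "w j \<in> A")
    case True
    then obtain c where c: "c \<in> I \<rightarrow> carrier R" "w j = (\<Oplus>\<^bsub>W\<^esub>i\<in>I. c i \<odot>\<^bsub>W\<^esub> w i)" by (auto simp: A_def)
    have ci: "\<And>i. i \<in> I \<Longrightarrow> c i \<in> carrier R" using c(1) by auto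
    \<comment> \<open>\<open>v\<^sub>j \<otimes> w\<^sub>j = \<Sum> c\<^sub>i v\<^sub>j \<otimes> w\<^sub>i\<close> is distributed over the terms in \<open>I\<close>.\<close>
    define v' where "v' i = c i \<odot>\<^bsub>V\<^esub> v j \<oplus>\<^bsub>V\<^esub> v i" for i
    have "(\<Oplus>\<^bsub>tensor R V W\<^esub>i\<in>I. pure_tensor R V W (v' i) (w i)) = \<zero>\<^bsub>tensor R V W\<^esub>"
    proof (rule insert.IH)
      show "v' \<in> I \<rightarrow> carrier V" using ci vj vi by (auto simp: v'_def)
      fix g assume g: "g \<in> Hom_mod R W (left_regular R)"
      note gl = Hom_mod_linear[OF g] and gc = gc[OF g]
      have "g (w j) = (\<Oplus>\<^bsub>left_regular R\<^esub>i\<in>I. g (c i \<odot>\<^bsub>W\<^esub> w i))"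
        unfolding c(2) by (rule linear_map_finsum[OF W left_regular_module[OF is_cring] gl cl[OF c(1)]])
      moreover have "linear_map R (left_regular R) V (\<lambda>r. r \<odot>\<^bsub>V\<^esub> v j)" (is "linear_map _ _ _ ?m")
        using vj by (intro linear_mapI) (auto simp: V.smult_l_distr V.smult_assoc1)
      ultimately have "g (w j) \<odot>\<^bsub>V\<^esub> v j = (\<Oplus>\<^bsub>V\<^esub>i\<in>I. g (c i \<odot>\<^bsub>W\<^esub> w i) \<odot>\<^bsub>V\<^esub> v j)"
        using linear_map_finsum[OF left_regular_module[OF is_cring] V, of ?m "\<lambda>i. g (c i \<odot>\<^bsub>W\<^esub> w i)" I]
          linear_mapD(1)[OF gl] cl[OF c(1)]
        by (simp add: Pi_iff)
      also have "\<dots> = (\<Oplus>\<^bsub>V\<^esub>i\<in>I. (g (w i) \<otimes> c i) \<odot>\<^bsub>V\<^esub> v j)"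
        using linear_mapD(3)[OF gl] ci vi vj gc by (intro V.finsum_cong') (auto simp: m_comm)
      finally have "(\<Oplus>\<^bsub>V\<^esub>i\<in>I. (g (w i) \<otimes> c i) \<odot>\<^bsub>V\<^esub> v j) \<oplus>\<^bsub>V\<^esub> (\<Oplus>\<^bsub>V\<^esub>i\<in>I. g (w i) \<odot>\<^bsub>V\<^esub> v i) = \<zero>\<^bsub>V\<^esub>"
        using insert.prems(3)[OF g] sumV[OF g] by simp
      moreover have "(\<Oplus>\<^bsub>V\<^esub>i\<in>I. (g (w i) \<otimes> c i) \<odot>\<^bsub>V\<^esub> v j) \<oplus>\<^bsub>V\<^esub> (\<Oplus>\<^bsub>V\<^esub>i\<in>I. g (w i) \<odot>\<^bsub>V\<^esub> v i) =
        (\<Oplus>\<^bsub>V\<^esub>i\<in>I. (g (w i) \<otimes> c i) \<odot>\<^bsub>V\<^esub> v j \<oplus>\<^bsub>V\<^esub> g (w i) \<odot>\<^bsub>V\<^esub> v i)"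
        using ci vi vj gc by (intro V.finsum_addf[symmetric]) auto
      moreover have "\<dots> = (\<Oplus>\<^bsub>V\<^esub>i\<in>I. g (w i) \<odot>\<^bsub>V\<^esub> v' i)"
        using ci vi vj gc by (intro V.finsum_cong') (auto simp: v'_def V.smult_r_distr V.smult_assoc1)
      ultimately show "(\<Oplus>\<^bsub>V\<^esub>i\<in>I. g (w i) \<odot>\<^bsub>V\<^esub> v' i) = \<zero>\<^bsub>V\<^esub>" by simp
    qed (use vI in auto)
    also have "(\<Oplus>\<^bsub>tensor R V W\<^esub>i\<in>I. pure_tensor R V W (v' i) (w i)) =
      (\<Oplus>\<^bsub>tensor R V W\<^esub>i\<in>I. pure_tensor R V W (v j) (c i \<odot>\<^bsub>W\<^esub> w i) \<oplus>\<^bsub>tensor R V W\<^esub> pure_tensor R V W (v i) (w i))"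
      using ci vi vj by (intro T.finsum_cong') (auto simp: v'_def p1 p2)
    also have "\<dots> = (\<Oplus>\<^bsub>tensor R V W\<^esub>i\<in>I. pure_tensor R V W (v j) (c i \<odot>\<^bsub>W\<^esub> w i)) \<oplus>\<^bsub>tensor R V W\<^esub>
        (\<Oplus>\<^bsub>tensor R V W\<^esub>i\<in>I. pure_tensor R V W (v i) (w i))"
      using ci vi vj by (intro T.finsum_addf) (auto simp: p1)
    also have "(\<Oplus>\<^bsub>tensor R V W\<^esub>i\<in>I. pure_tensor R V W (v j) (c i \<odot>\<^bsub>W\<^esub> w i)) = pure_tensor R V W (v j) (w j)"
      unfolding c(2) by (rule linear_map_finsum[symmetric, OF W T.module_axioms bilinear_mapD(1)[OF bil vj(1)] cl[OF c(1)]])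
    finally show ?thesis by (simp add: sum)
  next
    case False
    then obtain g where g: "g \<in> Hom_mod R W (left_regular R)" "\<And>a. a \<in> A \<Longrightarrow> g a = \<zero>" "g (w j) = \<one>"
      using functional_separates[OF W A vj(2)] by blast
    have wA: "w i \<in> A" if "i \<in> I" for i
    proof -
      let ?c = "\<lambda>l. if i = l then \<one> else \<zero>"
      have "(\<Oplus>\<^bsub>W\<^esub>l\<in>I. ?c l \<odot>\<^bsub>W\<^esub> w l) = (\<Oplus>\<^bsub>W\<^esub>l\<in>I. if i = l then w l else \<zero>\<^bsub>W\<^esub>)"
        using vi by (intro W.finsum_cong') auto
      also have "\<dots> = w i" using that vI insert.hyps by (intro W.finsum_singleton) auto
      finally show ?thesis using AI[of ?c] by auto
    qed
    have "(\<Oplus>\<^bsub>V\<^esub>i\<in>I. g (w i) \<odot>\<^bsub>V\<^esub> v i) = (\<Oplus>\<^bsub>V\<^esub>i\<in>I. \<zero>\<^bsub>V\<^esub>)"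
      using wA g(2) vi by (intro V.finsum_cong') auto
    then have vj0: "v j = \<zero>\<^bsub>V\<^esub>" using sumV[OF g(1)] insert.prems(3)[OF g(1)] g(3) vj by simp
    have "(\<Oplus>\<^bsub>tensor R V W\<^esub>i\<in>I. pure_tensor R V W (v i) (w i)) = \<zero>\<^bsub>tensor R V W\<^esub>"
    proof (rule insert.IH[OF vI])
      fix h assume h: "h \<in> Hom_mod R W (left_regular R)"
      have "(\<Oplus>\<^bsub>V\<^esub>i\<in>I. h (w i) \<odot>\<^bsub>V\<^esub> v i) \<in> carrier V" using gc[OF h] vi by (intro V.finsum_closed) auto
      then show "(\<Oplus>\<^bsub>V\<^esub>i\<in>I. h (w i) \<odot>\<^bsub>V\<^esub> v i) = \<zero>\<^bsub>V\<^esub>"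
        using sumV[OF h] insert.prems(3)[OF h] vj0 gc[OF h, of j] by simp
    qed
    moreover have "pure_tensor R V W (v j) (w j) = \<zero>\<^bsub>tensor R V W\<^esub>"
      using linear_map_zero[OF V T.module_axioms bilinear_mapD(2)[OF bil vj(2)]] vj0 by simp
    ultimately show ?thesis by (simp add: sum)
  qed
qed

lemma tensor_eq_zero:
  assumes V: "module R V" and W: "module R W" and t: "t \<in> carrier (tensor R V W)"
    and sep: "\<And>g. g \<in> Hom_mod R W (left_regular R) \<Longrightarrow> tensor_lift R V (\<lambda>v w. g w \<odot>\<^bsub>V\<^esub> v) t = \<zero>\<^bsub>V\<^esub>"
  shows "t = \<zero>\<^bsub>tensor R V W\<^esub>"
proof -
  interpret V: module R V by fact
  interpret T: module R "tensor R V W" by (rule tensor_module[OF V W])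
  note bil = pure_tensor_bilinear[OF V W]
  note p = linear_mapD[OF bilinear_mapD(2)[OF bil]]
  let ?I = "{p. tensor_rep t p \<noteq> \<zero>}" and ?v = "\<lambda>p. tensor_rep t p \<odot>\<^bsub>V\<^esub> fst p"
  have c: "fst p \<in> carrier V \<and> snd p \<in> carrier W \<and> tensor_rep t p \<in> carrier R" if "p \<in> ?I" for p
    using tensor_rep(1)[OF V W t] that by (cases p) (auto simp: free_module_def)
  have fin: "finite ?I" using tensor_rep(1)[OF V W t] by (auto simp: free_module_def)
  have "t = tensor_map R V W id id t" by (rule tensor_map_ident[symmetric, OF V W _ _ t]) simp_all
  also have "\<dots> = (\<Oplus>\<^bsub>tensor R V W\<^esub>p\<in>?I. pure_tensor R V W (?v p) (snd p))"
    unfolding tensor_map_def tensor_lift_rep free_lift_def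
    using c by (intro T.finsum_cong') (auto simp: p)
  also have "\<dots> = \<zero>\<^bsub>tensor R V W\<^esub>"
  proof (rule tensor_sum_eq_zero[OF V W fin])
    fix g assume g: "g \<in> Hom_mod R W (left_regular R)"
    have "(\<Oplus>\<^bsub>V\<^esub>i\<in>?I. g (snd i) \<odot>\<^bsub>V\<^esub> ?v i) = tensor_lift R V (\<lambda>v w. g w \<odot>\<^bsub>V\<^esub> v) t"
      unfolding tensor_lift_rep free_lift_def
      using c linear_mapD(1)[OF Hom_mod_linear[OF g]] by (intro V.finsum_cong') (auto simp: m_comm simp flip: V.smult_assoc1)
    then show "(\<Oplus>\<^bsub>V\<^esub>i\<in>?I. g (snd i) \<odot>\<^bsub>V\<^esub> ?v i) = \<zero>\<^bsub>V\<^esub>" using sep[OF g] by simp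
  qed (use c in auto)
  finally show ?thesis .
qed

lemma tensor_eqI:
  assumes V: "module R V" and W: "module R W" and s: "s \<in> carrier (tensor R V W)" and t: "t \<in> carrier (tensor R V W)"
    and sep: "\<And>g. g \<in> Hom_mod R W (left_regular R) \<Longrightarrow>
      tensor_lift R V (\<lambda>v w. g w \<odot>\<^bsub>V\<^esub> v) s = tensor_lift R V (\<lambda>v w. g w \<odot>\<^bsub>V\<^esub> v) t"
  shows "s = t"
proof -
  interpret V: module R V by fact
  interpret T: module R "tensor R V W" by (rule tensor_module[OF V W])
  have "s \<ominus>\<^bsub>tensor R V W\<^esub> t = \<zero>\<^bsub>tensor R V W\<^esub>"
  proof (rule tensor_eq_zero[OF V W T.minus_closed[OF s t]])
    fix g assume g: "g \<in> Hom_mod R W (left_regular R)"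
    have b: "bilinear_map R V W V (\<lambda>v w. g w \<odot>\<^bsub>V\<^esub> v)"
      using scaled_bilinear(1)[OF V Hom_mod_linear[OF g] linear_map_id V] by simp
    note l = tensor_lift_linear[OF V W V b]
    show "tensor_lift R V (\<lambda>v w. g w \<odot>\<^bsub>V\<^esub> v) (s \<ominus>\<^bsub>tensor R V W\<^esub> t) = \<zero>\<^bsub>V\<^esub>"
      using linear_map_minus[OF T.module_axioms V l s t] sep[OF g] linear_mapD(1)[OF l t]
      by (simp add: a_minus_def V.r_neg)
  qed
  then show ?thesis using T.eq_if_minus_zero s t by blast
qed

end

section \<open>The dual algebra and its actions\<close>

lemma comodule_simps [simp]:
  "carrier (comodule_left k M) = carrier M"
  "zero (comodule_left k M) = zero M" "add (comodule_left k M) = add M"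
  "smult (comodule_left k M) = (\<lambda>f m. tensor_lift k M (\<lambda>m0 m1. f m1 \<odot>\<^bsub>M\<^esub> m0) (coact M m))"
  "carrier (coalgebra_left k C) = carrier C"
  "zero (coalgebra_left k C) = zero C" "add (coalgebra_left k C) = add C"
  "carrier (coalgebra_right k C) = carrier C"
  "zero (coalgebra_right k C) = zero C" "add (coalgebra_right k C) = add C"
  by (simp_all add: comodule_left_def coalgebra_left_def coalgebra_right_def)

lemma right_regular_simps [simp]:
  "carrier (right_regular R) = carrier R" "zero (right_regular R) = zero R"
  "add (right_regular R) = add R" "smult (right_regular R) = (\<lambda>r x. x \<otimes>\<^bsub>R\<^esub> r)"
  by (simp_all add: right_regular_def fun_eq_iff)

context coalgebra
begin

abbreviation "dual \<equiv> dual_algebra k C"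

text \<open>
  The action \<open>c \<cdot> x\<close>, written \<open>c \<rightharpoonup> x\<close> to tell it apart from \<open>x \<cdot> c\<close>, written \<open>x \<leftharpoonup> c\<close>.
\<close>

definition lact (infixr "\<rightharpoonup>" 75) where "c \<rightharpoonup> x = tensor_lift k C (\<lambda>x1 x2. c x2 \<odot>\<^bsub>C\<^esub> x1) (comult C x)"
definition ract (infixl "\<leftharpoonup>" 75) where "x \<leftharpoonup> c = tensor_lift k C (\<lambda>x1 x2. c x1 \<odot>\<^bsub>C\<^esub> x2) (comult C x)"

lemma coalgebra_smult [simp]: "smult (coalgebra_left k C) = lact" "smult (coalgebra_right k C) = (\<lambda>c x. x \<leftharpoonup> c)"
  by (simp_all add: coalgebra_left_def coalgebra_right_def lact_def ract_def fun_eq_iff)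

lemma C_module: "module k C" ..
lemma k_module: "module k (left_regular k)" by (rule left_regular_module[OF is_cring])

lemma dual_carrier: "carrier dual = Hom_mod k C (left_regular k)"
  by (simp add: dual_algebra_def)

lemma dual_linear: "c \<in> carrier dual \<Longrightarrow> linear_map k C (left_regular k) c"
  by (simp add: dual_carrier Hom_mod_iff)

lemma dual_app_closed: "c \<in> carrier dual \<Longrightarrow> x \<in> carrier C \<Longrightarrow> c x \<in> carrier k"
  using linear_mapD(1)[OF dual_linear] by simp

lemma dual_eqI:
  assumes "c \<in> carrier dual" "d \<in> carrier dual" "\<And>x. x \<in> carrier C \<Longrightarrow> c x = d x"
  shows "c = d"
  using assms Hom_mod_eqI by (metis dual_carrier)

lemma dual_add: "x \<in> carrier C \<Longrightarrow> (c \<oplus>\<^bsub>dual\<^esub> d) x = c x \<oplus>\<^bsub>k\<^esub> d x"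
  and dual_zero: "x \<in> carrier C \<Longrightarrow> \<zero>\<^bsub>dual\<^esub> x = \<zero>\<^bsub>k\<^esub>"
  and dual_mult: "x \<in> carrier C \<Longrightarrow> (c \<otimes>\<^bsub>dual\<^esub> d) x = tensor_lift k (left_regular k) (\<lambda>x1 x2. c x1 \<otimes>\<^bsub>k\<^esub> d x2) (comult C x)"
  by (simp_all add: dual_algebra_def)

lemma dual_zero_closed: "\<zero>\<^bsub>dual\<^esub> \<in> carrier dual"
  unfolding dual_carrier Hom_mod_def by (auto simp: dual_algebra_def)

lemma comult_closed: "x \<in> carrier C \<Longrightarrow> comult C x \<in> carrier (tensor k C C)"
  by (rule linear_mapD(1)[OF Hom_mod_linear[OF comult_linear]])

lemma counit_lin: "linear_map k C (left_regular k) (counit C)"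
  by (rule Hom_mod_linear[OF counit_linear])

lemma counit_closed: "x \<in> carrier C \<Longrightarrow> counit C x \<in> carrier k"
  using linear_mapD(1)[OF counit_lin] by simp

lemma lact_closed: "c \<in> carrier dual \<Longrightarrow> x \<in> carrier C \<Longrightarrow> c \<rightharpoonup> x \<in> carrier C"
  unfolding lact_def by (rule tensor_lift_closed[OF C_module C_module C_module comult_closed])
    (simp_all add: dual_app_closed)

lemma ract_linear:
  assumes "c \<in> carrier dual" shows "linear_map k C C (\<lambda>x. x \<leftharpoonup> c)"
  unfolding ract_def
  by (rule linear_map_comp[OF Hom_mod_linear[OF comult_linear] tensor_lift_linear[OF C_module C_module C_module]])
    (use scaled_bilinear(2)[OF C_module dual_linear[OF assms] linear_map_id C_module] in simp)

lemma ract_closed: "c \<in> carrier dual \<Longrightarrow> x \<in> carrier C \<Longrightarrow> x \<leftharpoonup> c \<in> carrier C"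
  using linear_mapD(1)[OF ract_linear] .

text \<open>
  The counit recovers a functional from its action: this is how an identity between functionals is read
  off from an identity in \<open>C\<close>.
\<close>

lemma counit_lact:
  assumes c: "c \<in> carrier dual" and x: "x \<in> carrier C"
  shows "counit C (c \<rightharpoonup> x) = c x"
proof -
  note cl = dual_app_closed[OF c] counit_closed
  have "counit C (c \<rightharpoonup> x) = tensor_lift k (left_regular k) (\<lambda>x1 x2. counit C (c x2 \<odot>\<^bsub>C\<^esub> x1)) (comult C x)"
    unfolding lact_def
    by (rule linear_tensor_lift[OF C_module C_module C_module k_module counit_lin comult_closed[OF x]]) (simp add: cl)
  also have "\<dots> = tensor_lift k (left_regular k) (\<lambda>x1 x2. c (counit C x1 \<odot>\<^bsub>C\<^esub> x2)) (comult C x)"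
    by (rule tensor_lift_cong[OF C_module C_module k_module comult_closed[OF x]])
      (simp_all add: cl linear_mapD[OF counit_lin] linear_mapD[OF dual_linear[OF c]] m_comm)
  also have "\<dots> = c (tensor_lift k C (\<lambda>x1 x2. counit C x1 \<odot>\<^bsub>C\<^esub> x2) (comult C x))"
    by (rule linear_tensor_lift[symmetric, OF C_module C_module C_module k_module dual_linear[OF c] comult_closed[OF x]]) (simp add: cl)
  also have "\<dots> = c x" by (simp add: counit_left[OF x])
  finally show ?thesis .
qed

lemma counit_ract:
  assumes c: "c \<in> carrier dual" and x: "x \<in> carrier C"
  shows "counit C (x \<leftharpoonup> c) = c x"
proof -
  note cl = dual_app_closed[OF c] counit_closed
  have "counit C (x \<leftharpoonup> c) = tensor_lift k (left_regular k) (\<lambda>x1 x2. counit C (c x1 \<odot>\<^bsub>C\<^esub> x2)) (comult C x)"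
    unfolding ract_def
    by (rule linear_tensor_lift[OF C_module C_module C_module k_module counit_lin comult_closed[OF x]]) (simp add: cl)
  also have "\<dots> = tensor_lift k (left_regular k) (\<lambda>x1 x2. c (counit C x2 \<odot>\<^bsub>C\<^esub> x1)) (comult C x)"
    by (rule tensor_lift_cong[OF C_module C_module k_module comult_closed[OF x]])
      (simp_all add: cl linear_mapD[OF counit_lin] linear_mapD[OF dual_linear[OF c]] m_comm)
  also have "\<dots> = c (tensor_lift k C (\<lambda>x1 x2. counit C x2 \<odot>\<^bsub>C\<^esub> x1) (comult C x))"
    by (rule linear_tensor_lift[symmetric, OF C_module C_module C_module k_module dual_linear[OF c] comult_closed[OF x]]) (simp add: cl)
  also have "\<dots> = c x" by (simp add: counit_right[OF x])
  finally show ?thesis .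
qed

text \<open>
  The functional \<open>r \<epsilon>\<close>. It acts on \<open>C\<close>, on every comodule and on the dual algebra as the scalar \<open>r\<close>,
  which is why \<open>C*\<close>-linear maps are automatically \<open>k\<close>-linear.
\<close>

definition scalar_functional :: "'k \<Rightarrow> 'c \<Rightarrow> 'k"
  where "scalar_functional r = (\<lambda>x\<in>carrier C. r \<otimes>\<^bsub>k\<^esub> counit C x)"

lemma scalar_functional_closed:
  assumes r: "r \<in> carrier k" shows "scalar_functional r \<in> carrier dual"
  unfolding dual_carrier scalar_functional_def
  using linear_map_smult[OF C_module k_module counit_lin r] by (intro restrict_Hom_mod C_module) simp

lemma scalar_lact:
  assumes r: "r \<in> carrier k" and x: "x \<in> carrier C"
  shows "scalar_functional r \<rightharpoonup> x = r \<odot>\<^bsub>C\<^esub> x"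
proof -
  have "scalar_functional r \<rightharpoonup> x = tensor_lift k C (\<lambda>x1 x2. r \<odot>\<^bsub>C\<^esub> (counit C x2 \<odot>\<^bsub>C\<^esub> x1)) (comult C x)"
    unfolding lact_def
    by (rule tensor_lift_cong[OF C_module C_module C_module comult_closed[OF x]])
      (simp_all add: scalar_functional_def counit_closed r smult_assoc1)
  also have "\<dots> = r \<odot>\<^bsub>C\<^esub> x"
    by (subst tensor_lift_smult[OF C_module C_module C_module comult_closed[OF x] _ r])
      (simp_all add: counit_closed counit_right[OF x])
  finally show ?thesis .
qed

lemma scalar_mult:
  assumes r: "r \<in> carrier k" and c: "c \<in> carrier dual" and x: "x \<in> carrier C"
  shows "(scalar_functional r \<otimes>\<^bsub>dual\<^esub> c) x = r \<otimes>\<^bsub>k\<^esub> c x"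
proof -
  note cl = dual_app_closed[OF c] counit_closed
  have "(scalar_functional r \<otimes>\<^bsub>dual\<^esub> c) x = tensor_lift k (left_regular k) (\<lambda>x1 x2. c (r \<odot>\<^bsub>C\<^esub> (counit C x1 \<odot>\<^bsub>C\<^esub> x2))) (comult C x)"
    unfolding dual_mult[OF x]
    by (rule tensor_lift_cong[OF C_module C_module k_module comult_closed[OF x]])
      (simp_all add: scalar_functional_def cl r linear_mapD[OF dual_linear[OF c]] m_assoc)
  also have "\<dots> = c (tensor_lift k C (\<lambda>x1 x2. r \<odot>\<^bsub>C\<^esub> (counit C x1 \<odot>\<^bsub>C\<^esub> x2)) (comult C x))"
    by (rule linear_tensor_lift[symmetric, OF C_module C_module C_module k_module dual_linear[OF c] comult_closed[OF x]])
      (simp add: cl r)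
  also have "\<dots> = r \<otimes>\<^bsub>k\<^esub> c x"
    by (subst tensor_lift_smult[OF C_module C_module C_module comult_closed[OF x] _ r])
      (simp_all add: counit_closed counit_left[OF x] linear_mapD[OF dual_linear[OF c]] r x)
  finally show ?thesis .
qed

lemma right_comoduleD:
  assumes "right_comodule k C M"
  shows "module k M" "linear_map k M (tensor k M C) (coact M)"
    and "m \<in> carrier M \<Longrightarrow> coact M m \<in> carrier (tensor k M C)"
    and "m \<in> carrier M \<Longrightarrow> tensor_lift k M (\<lambda>m0 m1. counit C m1 \<odot>\<^bsub>M\<^esub> m0) (coact M m) = m"
proof -
  show 1: "linear_map k M (tensor k M C) (coact M)"
    using assms by (simp add: right_comodule_def Hom_mod_linear)
  then show "m \<in> carrier M \<Longrightarrow> coact M m \<in> carrier (tensor k M C)"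
    by (rule linear_mapD(1))
qed (use assms in \<open>auto simp: right_comodule_def\<close>)

lemma scalar_comodule_act:
  assumes M: "right_comodule k C M" and r: "r \<in> carrier k" and m: "m \<in> carrier M"
  shows "scalar_functional r \<odot>\<^bsub>comodule_left k M\<^esub> m = r \<odot>\<^bsub>M\<^esub> m"
proof -
  note D = right_comoduleD[OF M]
  interpret M: module k M by (rule D(1))
  have "scalar_functional r \<odot>\<^bsub>comodule_left k M\<^esub> m = tensor_lift k M (\<lambda>m0 m1. r \<odot>\<^bsub>M\<^esub> (counit C m1 \<odot>\<^bsub>M\<^esub> m0)) (coact M m)"
    unfolding comodule_simps
    by (rule tensor_lift_cong[OF D(1) C_module D(1) D(3)[OF m]])
      (simp_all add: scalar_functional_def counit_closed r M.smult_assoc1)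
  also have "\<dots> = r \<odot>\<^bsub>M\<^esub> m"
    by (subst tensor_lift_smult[OF D(1) C_module D(1) D(3)[OF m] _ r])
      (simp_all add: counit_closed D(4)[OF m])
  finally show ?thesis .
qed

text \<open>
  Evaluation at \<open>y\<close> turns a \<open>C*\<close>-linear map into a \<open>k\<close>-linear functional. The dual algebra is only a
  ring record, so linearity over \<open>k\<close> has to be expressed pointwise. The record \<open>L\<close> stands for the
  \<open>C*\<close>-module that underlies \<open>M\<close>, which is either a comodule or \<open>C\<close> itself.
\<close>

lemma dual_valued_linear:
  assumes M: "module k M" and car: "carrier L = carrier M" "add L = add M"
    and scal: "\<And>r m. r \<in> carrier k \<Longrightarrow> m \<in> carrier M \<Longrightarrow> scalar_functional r \<odot>\<^bsub>L\<^esub> m = r \<odot>\<^bsub>M\<^esub> m"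
    and \<phi>: "\<phi> \<in> Hom_mod dual L (left_regular dual)" and y: "y \<in> carrier C"
  shows "linear_map k M (left_regular k) (\<lambda>m. \<phi> m y)"
proof -
  note h = linear_mapD[OF Hom_mod_linear[OF \<phi>], unfolded car, simplified]
  show ?thesis
  proof (rule linear_mapI)
    show "\<phi> m y \<in> carrier (left_regular k)" if "m \<in> carrier M" for m
      using dual_app_closed[OF h(1)[OF that] y] by simp
    show "\<phi> (m \<oplus>\<^bsub>M\<^esub> n) y = \<phi> m y \<oplus>\<^bsub>left_regular k\<^esub> \<phi> n y" if "m \<in> carrier M" "n \<in> carrier M" for m n
      using h(2)[OF that] y by (simp add: dual_add)
    show "\<phi> (r \<odot>\<^bsub>M\<^esub> m) y = r \<odot>\<^bsub>left_regular k\<^esub> \<phi> m y" if "r \<in> carrier k" "m \<in> carrier M" for r m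
      using h(3)[OF scalar_functional_closed[OF that(1)] that(2)] scal[OF that]
        scalar_mult[OF that(1) h(1)[OF that(2)] y] by simp
  qed
qed

section \<open>Bimodule maps from a coalgebra to its dual\<close>

lemma coalgebra_dual_map_linear:
  assumes "\<alpha> \<in> Hom_mod dual (coalgebra_left k C) (left_regular dual)" "y \<in> carrier C"
  shows "linear_map k C (left_regular k) (\<lambda>x. \<alpha> x y)"
  by (rule dual_valued_linear[OF C_module _ _ _ assms]) (simp_all add: scalar_lact)

text \<open>
  The form \<open>B x y = \<alpha> x y\<close> of an injective bimodule map is symmetric: \<open>\<alpha> (\<alpha> x \<rightharpoonup> y)\<close> and
  \<open>\<alpha> (x \<leftharpoonup> \<alpha> y)\<close> are both the product of \<open>\<alpha> x\<close> and \<open>\<alpha> y\<close>, so \<open>\<alpha> x \<rightharpoonup> y = x \<leftharpoonup> \<alpha> y\<close>, and the counit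
  sends the two sides to \<open>\<alpha> x y\<close> and \<open>\<alpha> y x\<close>.
\<close>

lemma coalgebra_dual_map_symmetric:
  assumes l: "\<alpha> \<in> Hom_mod dual (coalgebra_left k C) (left_regular dual)"
    and r: "\<alpha> \<in> Hom_mod dual (coalgebra_right k C) (right_regular dual)"
    and inj: "inj_on \<alpha> (carrier C)" and x: "x \<in> carrier C" and y: "y \<in> carrier C"
  shows "\<alpha> x y = \<alpha> y x"
proof -
  note L = linear_mapD[OF Hom_mod_linear[OF l], simplified]
  note R = linear_mapD[OF Hom_mod_linear[OF r], simplified]
  have "\<alpha> (\<alpha> x \<rightharpoonup> y) = \<alpha> (x \<leftharpoonup> \<alpha> y)"
    using L(3)[OF L(1)[OF x] y] R(3)[OF L(1)[OF y] x] by simp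
  then have "\<alpha> x \<rightharpoonup> y = x \<leftharpoonup> \<alpha> y"
    using inj lact_closed ract_closed L(1) x y by (auto dest: inj_onD)
  then show ?thesis
    using counit_lact[OF L(1)[OF x] y] counit_ract[OF L(1)[OF y] x] by simp
qed

text \<open>
  This makes \<open>f \<mapsto> \<alpha> \<circ> f\<close> surjective. Let \<open>u = \<phi> m\<close> and let \<open>\<Sum> m\<^sub>p \<otimes> x\<^sub>p\<close> be the coaction of \<open>m\<close>. If
  \<open>\<alpha> x\<^sub>p y = 0\<close> for all \<open>p\<close>, then by symmetry \<open>\<alpha> y\<close> annihilates \<open>m\<close>, and \<open>\<alpha> (y \<leftharpoonup> u)\<close>, which is the
  product of \<open>\<alpha> y\<close> and \<open>\<phi> m\<close>, is zero; hence \<open>y \<leftharpoonup> u = 0\<close> and \<open>u y = 0\<close>. So \<open>u\<close> vanishes on the common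
  kernel of the finitely many functionals \<open>\<alpha> x\<^sub>p\<close> and is a combination of them.
\<close>

lemma symmetric_map_image:
  assumes l: "\<alpha> \<in> Hom_mod dual (coalgebra_left k C) (left_regular dual)"
    and r: "\<alpha> \<in> Hom_mod dual (coalgebra_right k C) (right_regular dual)"
    and inj: "inj_on \<alpha> (carrier C)"
    and M: "right_comodule k C M" and \<phi>: "\<phi> \<in> Hom_mod dual (comodule_left k M) (left_regular dual)"
    and m: "m \<in> carrier M"
  shows "\<phi> m \<in> \<alpha> ` carrier C"
proof -
  note L = linear_mapD[OF Hom_mod_linear[OF l], simplified]
  note R = linear_mapD[OF Hom_mod_linear[OF r], simplified]
  note h = linear_mapD[OF Hom_mod_linear[OF \<phi>], simplified]
  note D = right_comoduleD[OF M]
  interpret M: module k M by (rule D(1))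
  note t = D(3)[OF m]
  define u where "u = \<phi> m"
  have u: "u \<in> carrier dual" using h(1)[OF m] by (simp add: u_def)
  define I where "I = {p. tensor_rep (coact M m) p \<noteq> \<zero>\<^bsub>k\<^esub>}"
  have fin: "finite I" and sc: "\<And>p. p \<in> I \<Longrightarrow> snd p \<in> carrier C"
    using tensor_rep(1)[OF D(1) C_module t] by (force simp: free_module_def I_def)+
  note \<phi>lin = dual_valued_linear[OF D(1) _ _ scalar_comodule_act[OF M] \<phi>, simplified]
  note \<alpha>lin = coalgebra_dual_map_linear[OF l]
  have ker: "u y = \<zero>\<^bsub>k\<^esub>" if y: "y \<in> carrier C" and z: "\<And>p. p \<in> I \<Longrightarrow> \<alpha> (snd p) y = \<zero>\<^bsub>k\<^esub>" for y
  proof -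
    have "\<alpha> (y \<leftharpoonup> u) = \<phi> (tensor_lift k M (\<lambda>m0 m1. \<alpha> y m1 \<odot>\<^bsub>M\<^esub> m0) (coact M m))"
      using R(3)[OF u y] h(3)[OF L(1)[OF y] m] by (simp add: u_def)
    also have "\<dots> = \<phi> \<zero>\<^bsub>M\<^esub>"
    proof -
      have "tensor_lift k M (\<lambda>m0 m1. \<alpha> y m1 \<odot>\<^bsub>M\<^esub> m0) (coact M m) = \<zero>\<^bsub>M\<^esub>"
      proof (rule tensor_lift_zero[OF D(1) C_module D(1) t])
        fix p assume p: "tensor_rep (coact M m) p \<noteq> \<zero>\<^bsub>k\<^esub>"
        then have "p \<in> I" "fst p \<in> carrier M"
          using tensor_rep(1)[OF D(1) C_module t] by (cases p, force simp: free_module_def I_def)+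
        then show "\<alpha> y (snd p) \<odot>\<^bsub>M\<^esub> fst p = \<zero>\<^bsub>M\<^esub>"
          using z coalgebra_dual_map_symmetric[OF l r inj y sc] by simp
      qed
      then show ?thesis by simp
    qed
    also have "\<dots> = \<alpha> \<zero>\<^bsub>C\<^esub>"
    proof (rule dual_eqI)
      fix x assume x: "x \<in> carrier C"
      show "\<phi> \<zero>\<^bsub>M\<^esub> x = \<alpha> \<zero>\<^bsub>C\<^esub> x"
        using linear_map_zero[OF D(1) k_module \<phi>lin[OF x]] linear_map_zero[OF C_module k_module \<alpha>lin[OF x]] by simp
    qed (use h(1) L(1) in auto)
    finally have "y \<leftharpoonup> u = \<zero>\<^bsub>C\<^esub>"
      using inj ract_closed[OF u y] by (auto dest: inj_onD)
    then show ?thesis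
      using counit_ract[OF u y] linear_map_zero[OF C_module k_module counit_lin] by simp
  qed
  have "\<exists>c. c \<in> I \<rightarrow> carrier k \<and> (\<forall>y\<in>carrier C. u y = (\<Oplus>\<^bsub>k\<^esub>p\<in>I. c p \<otimes>\<^bsub>k\<^esub> \<alpha> (snd p) y))"
    using dual_linear L(1) sc u ker by (intro functional_in_span[OF C_module fin]) auto
  then obtain c where c: "c \<in> I \<rightarrow> carrier k"
    and uc: "\<And>y. y \<in> carrier C \<Longrightarrow> u y = (\<Oplus>\<^bsub>k\<^esub>p\<in>I. c p \<otimes>\<^bsub>k\<^esub> \<alpha> (snd p) y)" by blast
  let ?z = "\<Oplus>\<^bsub>C\<^esub>p\<in>I. c p \<odot>\<^bsub>C\<^esub> snd p"
  have cl: "(\<lambda>p. c p \<odot>\<^bsub>C\<^esub> snd p) \<in> I \<rightarrow> carrier C" using c sc by auto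
  interpret K: module k "left_regular k" by (rule k_module)
  have fs: "finsum (left_regular k) f A = finsum k f A" for f :: "'c2 \<Rightarrow> 'k" and A
    by (simp add: finsum_def finprod_def)
  have "u = \<alpha> ?z"
  proof (rule dual_eqI[OF u L(1)])
    show "?z \<in> carrier C" by (rule submodule_finsum[OF C_module module.carrier_is_submodule[OF C_module] cl])
    fix y assume y: "y \<in> carrier C"
    have "\<alpha> ?z y = (\<Oplus>\<^bsub>left_regular k\<^esub>p\<in>I. \<alpha> (c p \<odot>\<^bsub>C\<^esub> snd p) y)"
      by (rule linear_map_finsum[OF C_module k_module \<alpha>lin[OF y] cl])
    also have "\<dots> = (\<Oplus>\<^bsub>left_regular k\<^esub>p\<in>I. c p \<otimes>\<^bsub>k\<^esub> \<alpha> (snd p) y)"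
      using linear_mapD[OF \<alpha>lin[OF y], simplified] c sc by (intro K.finsum_cong') (auto simp: Pi_iff)
    finally show "u y = \<alpha> ?z y" using uc[OF y] by (simp add: fs)
  qed
  then show ?thesis using submodule_finsum[OF C_module module.carrier_is_submodule[OF C_module] cl] by (auto simp: u_def)
qed

section \<open>Retracts as comodules\<close>

text \<open>
  Let \<open>i\<close> embed \<open>M\<close> into \<open>C\<close> as a subspace that is stable under the left action, with linear retraction
  \<open>\<pi>\<close>. Then \<open>\<Delta>\<close> maps the image of \<open>i\<close> into the image of \<open>i \<otimes> 1\<close>: the tensors \<open>(i \<pi> \<otimes> 1) (\<Delta> x)\<close> and
  \<open>\<Delta> x\<close> are sent by \<open>1 \<otimes> g\<close> to \<open>i (\<pi> (g \<rightharpoonup> x))\<close> and \<open>g \<rightharpoonup> x\<close>, which agree by stability, and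
  functionals separate tensors.
\<close>

lemma coact_recovers_comult:
  fixes M :: "('k, 'c, 'm) rcomodule"
  assumes M: "module k M" and i: "linear_map k M C i" and \<pi>: "linear_map k C M \<pi>"
    and stable: "\<And>g v. g \<in> carrier dual \<Longrightarrow> v \<in> carrier M \<Longrightarrow> i (\<pi> (g \<rightharpoonup> i v)) = g \<rightharpoonup> i v"
    and v: "v \<in> carrier M"
  shows "tensor_map k C C i id (tensor_map k M C \<pi> id (comult C (i v))) = comult C (i v)"
proof -
  note iv = linear_mapD(1)[OF i v] and P = linear_map_comp[OF \<pi> i]
  note t = comult_closed[OF iv]
  have eq: "tensor_map k C C i id (tensor_map k M C \<pi> id (comult C (i v))) = tensor_map k C C (\<lambda>x. i (\<pi> x)) id (comult C (i v))"
    using tensor_map_comp[OF C_module C_module M C_module C_module C_module \<pi> linear_map_id i linear_map_id t]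
    by (simp add: id_def)
  have "tensor_map k C C (\<lambda>x. i (\<pi> x)) id (comult C (i v)) = comult C (i v)"
  proof (rule tensor_eqI[OF C_module C_module linear_mapD(1)[OF tensor_map_linear[OF C_module C_module C_module C_module P linear_map_id] t] t])
    fix g assume g: "g \<in> Hom_mod k C (left_regular k)"
    note gl = Hom_mod_linear[OF g]
    have gd: "g \<in> carrier dual" using g by (simp add: dual_carrier)
    have "tensor_lift k C (\<lambda>v w. g w \<odot>\<^bsub>C\<^esub> v) (tensor_map k C C (\<lambda>x. i (\<pi> x)) id (comult C (i v))) =
      tensor_lift k C (\<lambda>v w. g w \<odot>\<^bsub>C\<^esub> i (\<pi> v)) (comult C (i v))"
      using tensor_lift_tensor_map[OF C_module C_module C_module C_module C_module P linear_map_id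
          scaled_bilinear(1)[OF C_module gl linear_map_id C_module] t] by simp
    also have "\<dots> = tensor_lift k C (\<lambda>v w. i (\<pi> (g w \<odot>\<^bsub>C\<^esub> v))) (comult C (i v))"
      by (rule tensor_lift_cong[OF C_module C_module C_module t])
        (simp_all add: linear_mapD[OF P] dual_app_closed[OF gd])
    also have "\<dots> = i (\<pi> (g \<rightharpoonup> i v))"
      unfolding lact_def
      by (rule linear_tensor_lift[symmetric, OF C_module C_module C_module C_module P t]) (simp add: dual_app_closed[OF gd])
    also have "\<dots> = tensor_lift k C (\<lambda>v w. g w \<odot>\<^bsub>C\<^esub> v) (comult C (i v))"
      unfolding stable[OF gd v] by (simp add: lact_def)
    finally show "tensor_lift k C (\<lambda>v w. g w \<odot>\<^bsub>C\<^esub> v) (tensor_map k C C (\<lambda>x. i (\<pi> x)) id (comult C (i v))) =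
      tensor_lift k C (\<lambda>v w. g w \<odot>\<^bsub>C\<^esub> v) (comult C (i v))" .
  qed
  with eq show ?thesis by simp
qed

text \<open>
  Both axioms are checked after applying \<open>i \<otimes> 1\<close> respectively \<open>i\<close>, where they become the axioms of
  \<open>C\<close>. This is legitimate because \<open>\<pi> \<otimes> 1\<close> is a left inverse of \<open>i \<otimes> 1\<close>.
\<close>

lemma retract_comodule:
  fixes M :: "('k, 'c, 'm) rcomodule"
  assumes M: "module k M" and i: "linear_map k M C i" and \<pi>: "linear_map k C M \<pi>"
    and ret: "\<And>v. v \<in> carrier M \<Longrightarrow> \<pi> (i v) = v"
    and stable: "\<And>g v. g \<in> carrier dual \<Longrightarrow> v \<in> carrier M \<Longrightarrow> i (\<pi> (g \<rightharpoonup> i v)) = g \<rightharpoonup> i v"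
    and co: "coact M = (\<lambda>v\<in>carrier M. tensor_map k M C \<pi> id (comult C (i v)))"
  shows "right_comodule k C M"
proof -
  interpret M: module k M by (rule M)
  note CC = tensor_module[OF C_module C_module] and MC = tensor_module[OF M C_module]
  note \<Delta> = Hom_mod_linear[OF comult_linear]
  let ?\<rho> = "\<lambda>v. tensor_map k M C \<pi> id (comult C (i v))"
  have \<rho>: "linear_map k M (tensor k M C) ?\<rho>"
    by (rule linear_map_comp[OF linear_map_comp[OF i \<Delta>] tensor_map_linear[OF C_module C_module M C_module \<pi> linear_map_id]])
  then have coh: "coact M \<in> Hom_mod k M (tensor k M C)" unfolding co by (rule restrict_Hom_mod[OF M])
  note col = Hom_mod_linear[OF coh]
  let ?J = "tensor_map k C C i id"
  note J = tensor_map_linear[OF M C_module C_module C_module i linear_map_id]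
  have Jco: "?J (coact M v) = comult C (i v)" if "v \<in> carrier M" for v
    using coact_recovers_comult[OF M i \<pi> stable that] that by (simp add: co)
  let ?K = "tensor_map k C (tensor k C C) i id"
  have coassoc': "tensor_assoc k M C C (tensor_map k (tensor k M C) C (coact M) id (coact M m)) =
      tensor_map k M (tensor k C C) id (comult C) (coact M m)" (is "?l = ?r") if m: "m \<in> carrier M" for m
  proof -
    note im = linear_mapD(1)[OF i m] note t = linear_mapD(1)[OF col m]
    note coid = tensor_map_linear[OF M C_module MC C_module col linear_map_id]
    note idco = tensor_map_linear[OF M C_module M CC linear_map_id \<Delta>]
    have l: "?l \<in> carrier (tensor k M (tensor k C C))"
      by (rule linear_mapD(1)[OF tensor_assoc_linear[OF M C_module C_module] linear_mapD(1)[OF coid t]])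
    have r: "?r \<in> carrier (tensor k M (tensor k C C))" by (rule linear_mapD(1)[OF idco t])
    have "?K ?l = tensor_assoc k C C C (tensor_map k (tensor k C C) C ?J id (tensor_map k (tensor k M C) C (coact M) id (coact M m)))"
      by (rule tensor_assoc_natural[OF M C_module C_module C_module i linear_mapD(1)[OF coid t]])
    also have "tensor_map k (tensor k C C) C ?J id (tensor_map k (tensor k M C) C (coact M) id (coact M m)) =
        tensor_map k (tensor k C C) C (\<lambda>v. ?J (coact M v)) (\<lambda>x. id (id x)) (coact M m)"
      by (rule tensor_map_comp[OF M C_module MC C_module CC C_module col linear_map_id J linear_map_id t])
    also have "\<dots> = tensor_map k (tensor k C C) C (\<lambda>v. comult C (i v)) (\<lambda>x. id (id x)) (coact M m)"
      by (rule tensor_map_cong[OF M C_module CC C_module linear_map_comp[OF col J] linear_map_comp[OF linear_map_id linear_map_id] _ _ t])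
        (simp_all add: Jco)
    also have "\<dots> = tensor_map k (tensor k C C) C (comult C) id (?J (coact M m))"
      by (rule tensor_map_comp[symmetric, OF M C_module C_module C_module CC C_module i linear_map_id \<Delta> linear_map_id t])
    also have "\<dots> = tensor_map k (tensor k C C) C (comult C) id (comult C (i m))" by (simp add: Jco m)
    also have "tensor_assoc k C C C \<dots> = tensor_map k C (tensor k C C) id (comult C) (?J (coact M m))"
      using coassoc[OF im] by (simp add: Jco m)
    also have "\<dots> = tensor_map k C (tensor k C C) (\<lambda>x. id (i x)) (\<lambda>x. comult C (id x)) (coact M m)"
      by (rule tensor_map_comp[OF M C_module C_module C_module C_module CC i linear_map_id linear_map_id \<Delta> t])
    also have "\<dots> = tensor_map k C (tensor k C C) (\<lambda>x. i (id x)) (\<lambda>x. id (comult C x)) (coact M m)"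
      by simp
    also have "\<dots> = ?K ?r"
      by (rule tensor_map_comp[symmetric, OF M C_module M CC C_module CC linear_map_id \<Delta> i linear_map_id t])
    finally have eq: "?K ?l = ?K ?r" .
    have inv: "tensor_map k M (tensor k C C) \<pi> id (?K s) = s" if s: "s \<in> carrier (tensor k M (tensor k C C))" for s
      using tensor_map_comp[OF M CC C_module CC M CC i linear_map_id \<pi> linear_map_id s]
        tensor_map_ident[OF M CC _ _ s, of "\<lambda>x. \<pi> (i x)" "\<lambda>x. id (id x)"] ret by simp
    have "?l = tensor_map k M (tensor k C C) \<pi> id (?K ?l)" by (rule inv[OF l, symmetric])
    also have "\<dots> = tensor_map k M (tensor k C C) \<pi> id (?K ?r)" by (rule arg_cong[OF eq])
    also have "\<dots> = ?r" by (rule inv[OF r])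
    finally show ?thesis .
  qed
  have counit': "tensor_lift k M (\<lambda>m0 m1. counit C m1 \<odot>\<^bsub>M\<^esub> m0) (coact M m) = m" (is "?l = m") if m: "m \<in> carrier M" for m
  proof -
    note im = linear_mapD(1)[OF i m] note t = linear_mapD(1)[OF col m]
    have l: "?l \<in> carrier M"
      by (rule tensor_lift_closed[OF M C_module M t]) (simp add: counit_closed)
    have "i ?l = tensor_lift k C (\<lambda>m0 m1. i (counit C m1 \<odot>\<^bsub>M\<^esub> m0)) (coact M m)"
      by (rule linear_tensor_lift[OF M C_module M C_module i t]) (simp add: counit_closed)
    also have "\<dots> = tensor_lift k C (\<lambda>m0 m1. counit C (id m1) \<odot>\<^bsub>C\<^esub> i m0) (coact M m)"
      by (rule tensor_lift_cong[OF M C_module C_module t]) (simp_all add: linear_mapD[OF i] counit_closed)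
    also have "\<dots> = tensor_lift k C (\<lambda>m0 m1. counit C m1 \<odot>\<^bsub>C\<^esub> m0) (?J (coact M m))"
      by (rule tensor_lift_tensor_map[symmetric, OF M C_module C_module C_module C_module i linear_map_id
            scaled_bilinear(1)[OF C_module counit_lin linear_map_id C_module, unfolded id_apply] t])
    also have "\<dots> = i m" using counit_right[OF im] by (simp add: Jco m)
    finally have "\<pi> (i ?l) = \<pi> (i m)" by simp
    then show ?thesis using ret l m by simp
  qed
  show ?thesis unfolding right_comodule_def using M coh coassoc' counit' by blast
qed

text \<open>
  Right translations of \<open>C\<close> are comodule maps: apply \<open>c \<otimes> 1 \<otimes> 1\<close> to the two sides of coassociativity.
\<close>

lemma comult_ract:
  assumes c: "c \<in> carrier dual" and x: "x \<in> carrier C"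
  shows "comult C (x \<leftharpoonup> c) = tensor_map k C C (\<lambda>y. y \<leftharpoonup> c) id (comult C x)"
proof -
  note CC = tensor_module[OF C_module C_module] and \<Delta> = Hom_mod_linear[OF comult_linear]
  interpret T: module k "tensor k C C" by (rule CC)
  note t = comult_closed[OF x] and cl = dual_linear[OF c]
  let ?\<psi> = "tensor_lift k (tensor k C C) (\<lambda>u t. c u \<odot>\<^bsub>tensor k C C\<^esub> t)"
  have b: "bilinear_map k C (tensor k C C) (tensor k C C) (\<lambda>u t. c u \<odot>\<^bsub>tensor k C C\<^esub> t)"
    using scaled_bilinear(2)[OF CC cl linear_map_id CC] by simp
  note \<psi> = tensor_lift_linear[OF C_module CC CC b]
  note \<Delta>id = tensor_map_linear[OF C_module C_module CC C_module \<Delta> linear_map_id]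
  have "comult C (x \<leftharpoonup> c) = tensor_lift k (tensor k C C) (\<lambda>u v. comult C (c u \<odot>\<^bsub>C\<^esub> v)) (comult C x)"
    unfolding ract_def
    by (rule linear_tensor_lift[OF C_module C_module C_module CC \<Delta> t]) (simp add: dual_app_closed[OF c])
  also have "\<dots> = tensor_lift k (tensor k C C) (\<lambda>u v. c (id u) \<odot>\<^bsub>tensor k C C\<^esub> comult C v) (comult C x)"
    by (rule tensor_lift_cong[OF C_module C_module CC t])
      (simp_all add: dual_app_closed[OF c] linear_mapD[OF \<Delta>])
  also have "\<dots> = ?\<psi> (tensor_map k C (tensor k C C) id (comult C) (comult C x))"
    by (rule tensor_lift_tensor_map[symmetric, OF C_module C_module C_module CC CC linear_map_id \<Delta> b t])
  also have "\<dots> = ?\<psi> (tensor_assoc k C C C (tensor_map k (tensor k C C) C (comult C) id (comult C x)))"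
    using coassoc[OF x] by simp
  also have "\<dots> = tensor_map k C C (\<lambda>y. y \<leftharpoonup> c) id (comult C x)"
  proof (rule tensor_ext[OF C_module C_module CC
        linear_map_comp[OF linear_map_comp[OF \<Delta>id tensor_assoc_linear[OF C_module C_module C_module]] \<psi>]
        tensor_map_linear[OF C_module C_module C_module C_module ract_linear[OF c] linear_map_id] _ t])
    fix y z assume y: "y \<in> carrier C" and z: "z \<in> carrier C"
    note ty = comult_closed[OF y] and pl = bilinear_mapD(2)[OF pure_tensor_bilinear[OF C_module C_module] z]
    have "?\<psi> (tensor_assoc k C C C (tensor_map k (tensor k C C) C (comult C) id (pure_tensor k C C y z))) =
      ?\<psi> (tensor_map k C (tensor k C C) id (\<lambda>v. pure_tensor k C C v z) (comult C y))"
      using tensor_map_pure[OF C_module C_module CC C_module \<Delta> linear_map_id y z]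
        tensor_assoc_pure[OF C_module C_module C_module ty z] by simp
    also have "\<dots> = tensor_lift k (tensor k C C) (\<lambda>u v. c (id u) \<odot>\<^bsub>tensor k C C\<^esub> pure_tensor k C C v z) (comult C y)"
      by (rule tensor_lift_tensor_map[OF C_module C_module C_module CC CC linear_map_id pl b ty])
    also have "\<dots> = tensor_lift k (tensor k C C) (\<lambda>u v. pure_tensor k C C (c u \<odot>\<^bsub>C\<^esub> v) z) (comult C y)"
      by (rule tensor_lift_cong[symmetric, OF C_module C_module CC ty])
        (simp_all add: linear_mapD[OF pl] dual_app_closed[OF c])
    also have "\<dots> = pure_tensor k C C (y \<leftharpoonup> c) z"
      unfolding ract_def
      by (rule linear_tensor_lift[symmetric, OF C_module C_module C_module CC pl ty]) (simp add: dual_app_closed[OF c])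
    also have "\<dots> = tensor_map k C C (\<lambda>y. y \<leftharpoonup> c) id (pure_tensor k C C y z)"
      using tensor_map_pure[OF C_module C_module C_module C_module ract_linear[OF c] linear_map_id y z] by simp
    finally show "?\<psi> (tensor_assoc k C C C (tensor_map k (tensor k C C) C (comult C) id (pure_tensor k C C y z))) =
      tensor_map k C C (\<lambda>y. y \<leftharpoonup> c) id (pure_tensor k C C y z)" .
  qed
  finally show ?thesis .
qed

end

section \<open>The functors\<close>

lemma functor_simps [simp]:
  "carrier (functor_G k C M) = Hom_mod (dual_algebra k C) (comodule_left k M) (coalgebra_left k C)"
  "add (functor_G k C M) = (\<lambda>f g. \<lambda>m\<in>carrier M. f m \<oplus>\<^bsub>C\<^esub> g m)"
  "smult (functor_G k C M) = (\<lambda>r f. \<lambda>m\<in>carrier M. r \<odot>\<^bsub>coalgebra_right k C\<^esub> f m)"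
  "carrier (functor_H k C M) = Hom_mod (dual_algebra k C) (comodule_left k M) (left_regular (dual_algebra k C))"
  "add (functor_H k C M) = (\<lambda>f g. \<lambda>m\<in>carrier M. f m \<oplus>\<^bsub>dual_algebra k C\<^esub> g m)"
  "smult (functor_H k C M) = (\<lambda>r f. \<lambda>m\<in>carrier M. f m \<otimes>\<^bsub>dual_algebra k C\<^esub> r)"
  by (simp_all add: functor_G_def functor_H_def Hom_right_module_def)

context coalgebra
begin

lemma comodule_act_closed:
  assumes M: "right_comodule k C M" and c: "c \<in> carrier dual" and m: "m \<in> carrier M"
  shows "c \<odot>\<^bsub>comodule_left k M\<^esub> m \<in> carrier M"
proof -
  note D = right_comoduleD[OF M]
  interpret M: module k M by (rule D(1))
  show ?thesis unfolding comodule_simps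
    by (rule tensor_lift_closed[OF D(1) C_module D(1) D(3)[OF m]]) (simp add: dual_app_closed[OF c])
qed

lemma lact_linear:
  assumes "c \<in> carrier dual" shows "linear_map k C C (\<lambda>x. c \<rightharpoonup> x)"
  unfolding lact_def
  by (rule linear_map_comp[OF Hom_mod_linear[OF comult_linear] tensor_lift_linear[OF C_module C_module C_module]])
    (use scaled_bilinear(1)[OF C_module dual_linear[OF assms] linear_map_id C_module] in simp)

text \<open>
  \<open>C\<close> is a bimodule. This is what makes \<^const>\<open>functor_G\<close> closed under the right action.
\<close>

lemma lact_ract:
  assumes b: "b \<in> carrier dual" and c: "c \<in> carrier dual" and x: "x \<in> carrier C"
  shows "b \<rightharpoonup> (x \<leftharpoonup> c) = (b \<rightharpoonup> x) \<leftharpoonup> c"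
proof -
  note t = comult_closed[OF x] and rc = ract_linear[OF c]
  have "b \<rightharpoonup> (x \<leftharpoonup> c) = tensor_lift k C (\<lambda>x1 x2. b (id x2) \<odot>\<^bsub>C\<^esub> (x1 \<leftharpoonup> c)) (comult C x)"
    unfolding lact_def comult_ract[OF c x]
    by (rule tensor_lift_tensor_map[OF C_module C_module C_module C_module C_module rc linear_map_id
          scaled_bilinear(1)[OF C_module dual_linear[OF b] linear_map_id C_module, unfolded id_apply] t])
  also have "\<dots> = tensor_lift k C (\<lambda>x1 x2. (b x2 \<odot>\<^bsub>C\<^esub> x1) \<leftharpoonup> c) (comult C x)"
    by (rule tensor_lift_cong[OF C_module C_module C_module t])
      (simp_all add: linear_mapD[OF rc] dual_app_closed[OF b])
  also have "\<dots> = (b \<rightharpoonup> x) \<leftharpoonup> c"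
    unfolding lact_def
    by (rule linear_tensor_lift[symmetric, OF C_module C_module C_module C_module rc t]) (simp add: dual_app_closed[OF b])
  finally show ?thesis .
qed

lemma comodule_hom_act:
  assumes M: "right_comodule k C M" and N: "right_comodule k C N" and h: "h \<in> Hom_rcomod k C M N"
    and c: "c \<in> carrier dual" and m: "m \<in> carrier M"
  shows "h (c \<odot>\<^bsub>comodule_left k M\<^esub> m) = c \<odot>\<^bsub>comodule_left k N\<^esub> h m"
proof -
  note D = right_comoduleD[OF M] and E = right_comoduleD[OF N]
  interpret M: module k M by (rule D(1))
  interpret N: module k N by (rule E(1))
  have hl: "linear_map k M N h" and hc: "coact N (h m) = tensor_map k N C h id (coact M m)"
    using h m by (auto simp: Hom_rcomod_def Hom_mod_linear)
  have "h (c \<odot>\<^bsub>comodule_left k M\<^esub> m) = tensor_lift k N (\<lambda>m0 m1. h (c m1 \<odot>\<^bsub>M\<^esub> m0)) (coact M m)"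
    unfolding comodule_simps
    by (rule linear_tensor_lift[OF D(1) C_module D(1) E(1) hl D(3)[OF m]]) (simp add: dual_app_closed[OF c])
  also have "\<dots> = tensor_lift k N (\<lambda>m0 m1. c (id m1) \<odot>\<^bsub>N\<^esub> h m0) (coact M m)"
    by (rule tensor_lift_cong[OF D(1) C_module E(1) D(3)[OF m]])
      (simp_all add: linear_mapD[OF hl] dual_app_closed[OF c])
  also have "\<dots> = c \<odot>\<^bsub>comodule_left k N\<^esub> h m"
    unfolding comodule_simps hc
    by (rule tensor_lift_tensor_map[symmetric, OF D(1) C_module E(1) C_module E(1) hl linear_map_id
          scaled_bilinear(1)[OF E(1) dual_linear[OF c] linear_map_id E(1), unfolded id_apply] D(3)[OF m]])
  finally show ?thesis .
qed

lemma functor_G_closed: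
  assumes M: "right_comodule k C M"
  shows "f \<in> carrier (functor_G k C M) \<Longrightarrow> g \<in> carrier (functor_G k C M) \<Longrightarrow>
      f \<oplus>\<^bsub>functor_G k C M\<^esub> g \<in> carrier (functor_G k C M)"
    and "f \<in> carrier (functor_G k C M) \<Longrightarrow> c \<in> carrier dual \<Longrightarrow>
      c \<odot>\<^bsub>functor_G k C M\<^esub> f \<in> carrier (functor_G k C M)"
    and "f \<in> carrier (functor_G k C M) \<Longrightarrow> right_comodule k C N \<Longrightarrow> h \<in> Hom_rcomod k C N M \<Longrightarrow>
      compose (carrier N) f h \<in> carrier (functor_G k C N)"
proof -
  note C_ac = M.a_ac
  note D = right_comoduleD[OF M]
  interpret M: module k M by (rule D(1))
  note act = comodule_act_closed[OF M, simplified]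
  show "f \<oplus>\<^bsub>functor_G k C M\<^esub> g \<in> carrier (functor_G k C M)"
    if f: "f \<in> carrier (functor_G k C M)" and g: "g \<in> carrier (functor_G k C M)" for f g
  proof -
    note F = linear_mapD[OF Hom_mod_linear[OF f[unfolded functor_simps]], simplified]
    note G = linear_mapD[OF Hom_mod_linear[OF g[unfolded functor_simps]], simplified]
    have "linear_map dual (comodule_left k M) (coalgebra_left k C) (f \<oplus>\<^bsub>functor_G k C M\<^esub> g)"
      by (rule linear_mapI) (simp_all add: F G act linear_mapD[OF lact_linear] C_ac)
    then show ?thesis by (simp add: Hom_mod_iff)
  qed
  show "c \<odot>\<^bsub>functor_G k C M\<^esub> f \<in> carrier (functor_G k C M)"
    if f: "f \<in> carrier (functor_G k C M)" and c: "c \<in> carrier dual" for f c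
  proof -
    note F = linear_mapD[OF Hom_mod_linear[OF f[unfolded functor_simps]], simplified]
    have "linear_map dual (comodule_left k M) (coalgebra_left k C) (c \<odot>\<^bsub>functor_G k C M\<^esub> f)"
      by (rule linear_mapI) (simp_all add: F act linear_mapD[OF ract_linear[OF c]] lact_ract c)
    then show ?thesis by (simp add: Hom_mod_iff)
  qed
  show "compose (carrier N) f h \<in> carrier (functor_G k C N)"
    if f: "f \<in> carrier (functor_G k C M)" and N: "right_comodule k C N" and h: "h \<in> Hom_rcomod k C N M" for f h and N :: "('k, 'c, 'f) rcomodule"
  proof -
    note F = linear_mapD[OF Hom_mod_linear[OF f[unfolded functor_simps]], simplified]
    note E = right_comoduleD[OF N]
    interpret N: module k N by (rule E(1))
    note H = linear_mapD[OF Hom_mod_linear, of h k N M]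
    have hl: "h \<in> Hom_mod k N M" using h by (simp add: Hom_rcomod_def)
    have "linear_map dual (comodule_left k N) (coalgebra_left k C) (compose (carrier N) f h)"
      using comodule_hom_act[OF N M h]
      by (intro linear_mapI) (simp_all add: F H[OF hl] compose_eq comodule_act_closed[OF N, simplified])
    then show ?thesis by (simp add: Hom_mod_iff compose_def)
  qed
qed

text \<open>
  Composition with \<open>\<alpha>\<close> is natural and right \<open>C*\<close>-linear, and it is injective with \<open>\<alpha>\<close>. A left
  \<open>C*\<close>-linear \<open>\<phi> : M \<rightarrow> C*\<close> takes values in the image of \<open>\<alpha>\<close>, so it factors through \<open>\<alpha>\<close>, and the
  factor is again \<open>C*\<close>-linear because \<open>\<alpha>\<close> is injective.
\<close>

lemma symmetric_imp_isomorphic: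
  assumes sym: "symmetric_coalgebra k C"
  shows "G_H_naturally_isomorphic TYPE('m) k C"
proof -
  obtain \<alpha> where l: "\<alpha> \<in> Hom_mod dual (coalgebra_left k C) (left_regular dual)"
    and r: "\<alpha> \<in> Hom_mod dual (coalgebra_right k C) (right_regular dual)"
    and inj: "inj_on \<alpha> (carrier C)"
    using sym by (auto simp: symmetric_coalgebra_def Let_def)
  note L = linear_mapD[OF Hom_mod_linear[OF l], simplified]
  note R = linear_mapD[OF Hom_mod_linear[OF r], simplified]
  note injD = inj_onD[OF inj]
  define \<eta> :: "('k, 'c, 'm) rcomodule \<Rightarrow> ('m \<Rightarrow> 'c) \<Rightarrow> ('m \<Rightarrow> 'c \<Rightarrow> 'k)"
    where "\<eta> M = (\<lambda>f\<in>carrier (functor_G k C M). \<lambda>m\<in>carrier M. \<alpha> (f m))" for M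
  have eta: "\<eta> M f = (\<lambda>m\<in>carrier M. \<alpha> (f m))" if "f \<in> carrier (functor_G k C M)" for M f
    using that by (simp add: \<eta>_def)
  have "\<eta> M \<in> Hom_mod dual (functor_G k C M) (functor_H k C M) \<and>
      bij_betw (\<eta> M) (carrier (functor_G k C M)) (carrier (functor_H k C M))"
    if M: "right_comodule k C M" for M :: "('k, 'c, 'm) rcomodule"
  proof
    note D = right_comoduleD[OF M]
    interpret M: module k M by (rule D(1))
    note act = comodule_act_closed[OF M, simplified]
    have G: "f m \<in> carrier C" if "f \<in> carrier (functor_G k C M)" "m \<in> carrier M" for f m
      using linear_mapD(1)[OF Hom_mod_linear[OF that(1)[unfolded functor_simps]]] that(2) by simp
    have etaH: "\<eta> M f \<in> carrier (functor_H k C M)" if f: "f \<in> carrier (functor_G k C M)" for f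
    proof -
      note F = linear_mapD[OF Hom_mod_linear[OF f[unfolded functor_simps]], simplified]
      have "linear_map dual (comodule_left k M) (left_regular dual) (\<eta> M f)"
        unfolding eta[OF f] by (rule linear_mapI) (simp_all add: L F act)
      then show ?thesis by (simp add: Hom_mod_iff eta[OF f])
    qed
    have "linear_map dual (functor_G k C M) (functor_H k C M) (\<eta> M)"
    proof (rule linear_mapI)
      show "\<eta> M (f \<oplus>\<^bsub>functor_G k C M\<^esub> g) = \<eta> M f \<oplus>\<^bsub>functor_H k C M\<^esub> \<eta> M g"
        if "f \<in> carrier (functor_G k C M)" "g \<in> carrier (functor_G k C M)" for f g
        unfolding eta[OF that(1)] eta[OF that(2)] eta[OF functor_G_closed(1)[OF M that]]
        using G[OF that(1)] G[OF that(2)] L(2) by (auto intro!: restrict_ext)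
      show "\<eta> M (c \<odot>\<^bsub>functor_G k C M\<^esub> f) = c \<odot>\<^bsub>functor_H k C M\<^esub> \<eta> M f"
        if "c \<in> carrier dual" "f \<in> carrier (functor_G k C M)" for f c
        unfolding eta[OF that(2)] eta[OF functor_G_closed(2)[OF M that(2,1)]]
        using G[OF that(2)] R(3)[OF that(1)] by (auto intro!: restrict_ext)
    qed (rule etaH)
    then show "\<eta> M \<in> Hom_mod dual (functor_G k C M) (functor_H k C M)"
      by (simp add: Hom_mod_iff \<eta>_def)
    show "bij_betw (\<eta> M) (carrier (functor_G k C M)) (carrier (functor_H k C M))"
    proof (rule bij_betw_imageI)
      show "inj_on (\<eta> M) (carrier (functor_G k C M))"
      proof (rule inj_onI)
        fix f g assume f: "f \<in> carrier (functor_G k C M)" and g: "g \<in> carrier (functor_G k C M)"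
          and eq: "\<eta> M f = \<eta> M g"
        show "f = g"
        proof (rule Hom_mod_eqI[OF f[unfolded functor_simps] g[unfolded functor_simps]])
          fix m assume "m \<in> carrier (comodule_left k M)"
          then have m: "m \<in> carrier M" by simp
          show "f m = g m" using fun_cong[OF eq, of m] m G[OF f m] G[OF g m] injD
            by (simp add: eta[OF f] eta[OF g])
        qed
      qed
      have "\<phi> \<in> \<eta> M ` carrier (functor_G k C M)" if \<phi>: "\<phi> \<in> carrier (functor_H k C M)" for \<phi>
      proof -
        note \<phi>' = \<phi>[unfolded functor_simps]
        note P = linear_mapD[OF Hom_mod_linear[OF \<phi>'], simplified]
        define f where "f = (\<lambda>m\<in>carrier M. inv_into (carrier C) \<alpha> (\<phi> m))"
        have im: "\<phi> m \<in> \<alpha> ` carrier C" if "m \<in> carrier M" for m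
          by (rule symmetric_map_image[OF l r inj M \<phi>' that])
        have fc: "f m \<in> carrier C" and \<alpha>f: "\<alpha> (f m) = \<phi> m" if "m \<in> carrier M" for m
          using inv_into_into[OF im[OF that]] f_inv_into_f[OF im[OF that]] that by (auto simp: f_def)
        have "linear_map dual (comodule_left k M) (coalgebra_left k C) f"
        proof (rule linear_mapI)
          show "f (m \<oplus>\<^bsub>comodule_left k M\<^esub> n) = f m \<oplus>\<^bsub>coalgebra_left k C\<^esub> f n"
            if "m \<in> carrier (comodule_left k M)" "n \<in> carrier (comodule_left k M)" for m n
            using that fc by (intro injD) (simp_all add: \<alpha>f L(2) P(2))
          show "f (c \<odot>\<^bsub>comodule_left k M\<^esub> m) = c \<odot>\<^bsub>coalgebra_left k C\<^esub> f m"
            if "c \<in> carrier dual" "m \<in> carrier (comodule_left k M)" for c m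
            using that fc act lact_closed by (intro injD) (simp_all add: \<alpha>f L(3) P(3))
        qed (simp add: fc)
        then have fG: "f \<in> carrier (functor_G k C M)" by (simp add: Hom_mod_iff f_def)
        have "\<eta> M f = \<phi>"
        proof (rule Hom_mod_eqI[OF etaH[OF fG, unfolded functor_simps] \<phi>'])
          show "\<eta> M f m = \<phi> m" if "m \<in> carrier (comodule_left k M)" for m
            using that by (simp add: eta[OF fG] \<alpha>f)
        qed
        then show ?thesis using fG by blast
      qed
      then show "\<eta> M ` carrier (functor_G k C M) = carrier (functor_H k C M)" using etaH by blast
    qed
  qed
  moreover have "\<eta> M (compose (carrier M) f h) = compose (carrier M) (\<eta> N f) h"
    if h: "h \<in> Hom_rcomod k C M N" and M: "right_comodule k C M" and N: "right_comodule k C N"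
      and f: "f \<in> carrier (functor_G k C N)" for M N :: "('k, 'c, 'm) rcomodule" and h f
  proof -
    have "h m \<in> carrier N" if "m \<in> carrier M" for m
      using h that linear_mapD(1)[OF Hom_mod_linear] by (fastforce simp: Hom_rcomod_def)
    then show ?thesis
      unfolding eta[OF f] eta[OF functor_G_closed(3)[OF N f M h]]
      by (auto simp: compose_def intro!: restrict_ext)
  qed
  ultimately show ?thesis unfolding G_H_naturally_isomorphic_def by blast
qed

section \<open>Subcomodules inside a given type\<close>

text \<open>
  \<open>M\<close> is the subspace \<open>N\<close> of \<open>C\<close>, with its elements renamed by \<open>e\<close> and with the coaction that \<open>\<Delta>\<close>
  induces. Renaming is necessary as the functors range over comodules with carrier in the type
  \<open>'m\<close> only. The coaction is characterised by its image in \<open>C \<otimes> C\<close>, and the retraction \<open>\<pi>\<close>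
  guarantees that this image determines it.
\<close>

definition copy_of :: "('c \<Rightarrow> 'm) \<Rightarrow> 'c set \<Rightarrow> ('k, 'c, 'm) rcomodule \<Rightarrow> bool"
  where "copy_of e N M \<longleftrightarrow> right_comodule k C M \<and> carrier M = e ` N \<and>
    linear_map k M C (inv_into (carrier C) e) \<and>
    (\<exists>\<pi>. linear_map k C M \<pi> \<and> (\<forall>x\<in>N. \<pi> x = e x)) \<and>
    (\<forall>v\<in>carrier M. tensor_map k C C (inv_into (carrier C) e) id (coact M v) = comult C (inv_into (carrier C) e v))"

lemma copy_exists:
  fixes e :: "'c \<Rightarrow> 'm"
  assumes e: "inj_on e (carrier C)" and N: "submodule N k C"
    and stable: "\<And>g x. g \<in> carrier dual \<Longrightarrow> x \<in> N \<Longrightarrow> g \<rightharpoonup> x \<in> N"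
  shows "\<exists>M. copy_of e N M"
proof -
  note NE = submoduleE[OF N]
  have N0: "\<zero>\<^bsub>C\<^esub> \<in> N" by (rule submodule_zero[OF C_module N])
  let ?d = "inv_into (carrier C) e"
  have de: "?d (e x) = x" if "x \<in> N" for x
    using inv_into_f_f[OF e] NE(1) that by auto
  define M0 :: "('k, 'c, 'm) rcomodule" where "M0 = \<lparr>carrier = e ` N, mult = undefined, one = undefined,
    zero = e \<zero>\<^bsub>C\<^esub>, add = (\<lambda>x y. e (?d x \<oplus>\<^bsub>C\<^esub> ?d y)), smult = (\<lambda>r x. e (r \<odot>\<^bsub>C\<^esub> ?d x)), coact = undefined\<rparr>"
  have triv: "submodule {\<zero>\<^bsub>C\<^esub>} k C" by (rule submoduleI) auto
  have "{\<zero>\<^bsub>C\<^esub>} \<inter> N = {\<zero>\<^bsub>C\<^esub>}" using N0 by auto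
  then obtain P where P: "linear_map k C C P" "\<And>x. x \<in> carrier C \<Longrightarrow> P x \<in> N"
    "\<And>a. a \<in> {\<zero>\<^bsub>C\<^esub>} \<Longrightarrow> P a = \<zero>\<^bsub>C\<^esub>" "\<And>x. x \<in> N \<Longrightarrow> P x = x"
  proof (rule projection_exists[OF C_module triv N])
    fix P assume "linear_map k C C P" "\<And>x. x \<in> carrier C \<Longrightarrow> P x \<in> N"
      "\<And>a. a \<in> {\<zero>\<^bsub>C\<^esub>} \<Longrightarrow> P a = \<zero>\<^bsub>C\<^esub>" "\<And>x. x \<in> N \<Longrightarrow> P x = x"
    then show thesis by (rule that)
  qed
  define M where "M = M0\<lparr>coact := (\<lambda>v\<in>e ` N. tensor_map k M0 C (\<lambda>x. e (P x)) id (comult C (?d v)))\<rparr>"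
  \<comment> \<open>Tensor products do not look at the field \<open>coact\<close>, so \<open>M0\<close> may be replaced by \<open>M\<close>.\<close>
  have tm: "tensor_map k M C = (tensor_map k M0 C :: ('c \<Rightarrow> 'm) \<Rightarrow> ('c \<Rightarrow> 'c) \<Rightarrow> _)"
    unfolding tensor_map_def tensor_def tensor_null_def pure_tensor_def tensor_relations_def M_def by simp
  have Ms: "carrier M = e ` N" "zero M = e \<zero>\<^bsub>C\<^esub>" "add M = (\<lambda>x y. e (?d x \<oplus>\<^bsub>C\<^esub> ?d y))"
    "smult M = (\<lambda>r x. e (r \<odot>\<^bsub>C\<^esub> ?d x))"
    by (simp_all add: M_def M0_def)
  have co: "coact M = (\<lambda>v\<in>carrier M. tensor_map k M C (\<lambda>x. e (P x)) id (comult C (?d v)))"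
    by (simp add: tm Ms) (simp add: M_def)
  have Nc: "\<And>x. x \<in> N \<Longrightarrow> x \<in> carrier C" using NE(1) by auto
  note NI = NE(4,5) N0 de Nc
  have "abelian_group M"
  proof (rule abelian_groupI)
    fix v assume "v \<in> carrier M"
    then obtain x where "x \<in> N" "v = e x" by (auto simp: Ms)
    then show "\<exists>w\<in>carrier M. w \<oplus>\<^bsub>M\<^esub> v = \<zero>\<^bsub>M\<^esub>"
      using NE(3) by (intro bexI[of _ "e (\<ominus>\<^bsub>C\<^esub> x)"]) (auto simp: Ms NI M.l_neg)
  qed (auto simp: Ms NI M.a_ac)
  then have M: "module k M"
    by (intro moduleI is_cring) (auto simp: Ms NI smult_l_distr smult_r_distr smult_assoc1)
  have d: "linear_map k M C ?d"
    by (rule linear_mapI) (auto simp: Ms NI)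
  have \<pi>: "linear_map k C M (\<lambda>x. e (P x))"
    using P(2) by (intro linear_mapI) (auto simp: Ms NI linear_mapD[OF P(1)])
  have st: "?d (e (P (g \<rightharpoonup> ?d v))) = g \<rightharpoonup> ?d v" if "g \<in> carrier dual" "v \<in> carrier M" for g v
    using that stable P(4) by (auto simp: Ms de)
  have "right_comodule k C M"
    using P(4) by (intro retract_comodule[OF M d \<pi> _ st co]) (auto simp: Ms de)
  moreover have "\<forall>v\<in>carrier M. tensor_map k C C ?d id (coact M v) = comult C (?d v)"
    using coact_recovers_comult[OF M d \<pi> st] by (simp add: co)
  moreover have "\<exists>\<pi>. linear_map k C M \<pi> \<and> (\<forall>x\<in>N. \<pi> x = e x)"
    using \<pi> P(4) by (intro exI[of _ "\<lambda>x. e (P x)"]) simp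
  ultimately have "copy_of e N M" unfolding copy_of_def using d Ms(1) by (intro conjI)
  then show ?thesis by blast
qed

text \<open>
  A linear map of \<open>C\<close> that commutes with \<open>\<Delta>\<close> on \<open>N\<close> and sends \<open>N\<close> to \<open>N'\<close> gives a comodule map between
  the copies. With \<open>d\<close> undoing the renaming, the condition on the coactions is checked after the injective
  map \<open>d \<otimes> 1\<close> into \<open>C \<otimes> C\<close>, where it is the one on \<open>\<Delta>\<close>. The lemma serves right translations of \<open>C\<close> and
  the inclusion of a subcomodule.
\<close>

lemma copy_hom:
  assumes M: "copy_of e N M" and M': "copy_of e N' M'" and e: "inj_on e (carrier C)"
    and N: "N \<subseteq> carrier C" and N': "N' \<subseteq> carrier C"
    and f: "linear_map k C C f" and fN: "\<And>x. x \<in> N \<Longrightarrow> f x \<in> N'"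
    and cf: "\<And>x. x \<in> N \<Longrightarrow> comult C (f x) = tensor_map k C C f id (comult C x)"
  shows "(\<lambda>v\<in>carrier M. e (f (inv_into (carrier C) e v))) \<in> Hom_rcomod k C M M'"
proof -
  let ?d = "inv_into (carrier C) e" and ?h = "\<lambda>v. e (f (inv_into (carrier C) e v))"
  have de: "?d (e x) = x" if "x \<in> carrier C" for x using inv_into_f_f[OF e that] .
  have MC: "right_comodule k C M" "carrier M = e ` N" and d: "linear_map k M C ?d"
    and J: "\<And>v. v \<in> carrier M \<Longrightarrow> tensor_map k C C ?d id (coact M v) = comult C (?d v)"
    using M by (auto simp: copy_of_def)
  obtain \<pi>' where MC': "right_comodule k C M'" "carrier M' = e ` N'" and d': "linear_map k M' C ?d"
    and J': "\<And>v. v \<in> carrier M' \<Longrightarrow> tensor_map k C C ?d id (coact M' v) = comult C (?d v)"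
    and \<pi>': "linear_map k C M' \<pi>'" "\<And>x. x \<in> N' \<Longrightarrow> \<pi>' x = e x"
    using M' by (auto simp: copy_of_def)
  note D = right_comoduleD[OF MC(1)] and D' = right_comoduleD[OF MC'(1)]
  interpret M: module k M by (rule D(1))
  interpret M': module k M' by (rule D'(1))
  have dM: "?d v \<in> N" if "v \<in> carrier M" for v using that N de by (auto simp: MC(2))
  have ed': "e (?d v) = v" if "v \<in> carrier M'" for v using that N' de by (auto simp: MC'(2))
  have hc: "?h v \<in> carrier M'" if "v \<in> carrier M" for v using fN[OF dM[OF that]] by (auto simp: MC'(2))
  have dh: "?d (?h v) = f (?d v)" if "v \<in> carrier M" for v
    using fN[OF dM[OF that]] N' de by auto
  have eqI: "v = w" if "v \<in> carrier M'" "w \<in> carrier M'" "?d v = ?d w" for v w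
    using ed'[OF that(1)] ed'[OF that(2)] that(3) by metis
  have h: "linear_map k M M' ?h"
  proof (rule linear_mapI)
    show "?h (v \<oplus>\<^bsub>M\<^esub> w) = ?h v \<oplus>\<^bsub>M'\<^esub> ?h w" if "v \<in> carrier M" "w \<in> carrier M" for v w
    proof (rule eqI)
      show "?d (?h (v \<oplus>\<^bsub>M\<^esub> w)) = ?d (?h v \<oplus>\<^bsub>M'\<^esub> ?h w)"
        unfolding dh[OF M.a_closed[OF that]] linear_mapD(2)[OF d' hc[OF that(1)] hc[OF that(2)]] dh[OF that(1)] dh[OF that(2)]
        using that by (simp add: linear_mapD[OF d] linear_mapD[OF f])
    qed (use that hc in auto)
    show "?h (r \<odot>\<^bsub>M\<^esub> v) = r \<odot>\<^bsub>M'\<^esub> ?h v" if "r \<in> carrier k" "v \<in> carrier M" for r v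
    proof (rule eqI)
      show "?d (?h (r \<odot>\<^bsub>M\<^esub> v)) = ?d (r \<odot>\<^bsub>M'\<^esub> ?h v)"
        unfolding dh[OF M.smult_closed[OF that]] linear_mapD(3)[OF d' that(1) hc[OF that(2)]] dh[OF that(2)]
        using that by (simp add: linear_mapD[OF d] linear_mapD[OF f])
    qed (use that hc in auto)
  qed (rule hc)
  let ?J = "tensor_map k C C ?d id"
  have "coact M' (?h v) = tensor_map k M' C (\<lambda>v\<in>carrier M. ?h v) id (coact M v)" if v: "v \<in> carrier M" for v
  proof -
    note t = D(3)[OF v] and t' = D'(3)[OF hc[OF v]]
    have "?J (coact M' (?h v)) = comult C (f (?d v))" by (simp add: J'[OF hc[OF v]] dh[OF v])
    also have "\<dots> = tensor_map k C C f id (?J (coact M v))" by (simp add: J v cf dM)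
    also have "\<dots> = tensor_map k C C (\<lambda>v. f (?d v)) (\<lambda>x. id (id x)) (coact M v)"
      by (rule tensor_map_comp[OF D(1) C_module C_module C_module C_module C_module d linear_map_id f linear_map_id t])
    also have "\<dots> = tensor_map k C C (\<lambda>v. ?d (?h v)) (\<lambda>x. id (id x)) (coact M v)"
      by (rule tensor_map_cong[OF D(1) C_module C_module C_module linear_map_comp[OF d f] linear_map_comp[OF linear_map_id linear_map_id] _ _ t])
        (simp_all add: dh)
    also have "\<dots> = ?J (tensor_map k M' C ?h id (coact M v))"
      by (rule tensor_map_comp[symmetric, OF D(1) C_module D'(1) C_module C_module C_module h linear_map_id d' linear_map_id t])
    finally have eq: "?J (coact M' (?h v)) = ?J (tensor_map k M' C ?h id (coact M v))" .
    have inv: "tensor_map k M' C \<pi>' id (?J s) = s" if s: "s \<in> carrier (tensor k M' C)" for s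
    proof -
      have "tensor_map k M' C \<pi>' id (?J s) = tensor_map k M' C (\<lambda>v. \<pi>' (?d v)) (\<lambda>x. id (id x)) s"
        by (rule tensor_map_comp[OF D'(1) C_module C_module C_module D'(1) C_module d' linear_map_id \<pi>'(1) linear_map_id s])
      also have "\<dots> = s"
        using \<pi>'(2) N' de by (intro tensor_map_ident[OF D'(1) C_module _ _ s]) (auto simp: MC'(2))
      finally show ?thesis .
    qed
    have "coact M' (?h v) = tensor_map k M' C \<pi>' id (?J (coact M' (?h v)))" by (rule inv[OF t', symmetric])
    also have "\<dots> = tensor_map k M' C \<pi>' id (?J (tensor_map k M' C ?h id (coact M v)))" by (rule arg_cong[OF eq])
    also have "\<dots> = tensor_map k M' C ?h id (coact M v)"
      by (rule inv[OF linear_mapD(1)[OF tensor_map_linear[OF D(1) C_module D'(1) C_module h linear_map_id] t]])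
    also have "\<dots> = tensor_map k M' C (\<lambda>v\<in>carrier M. ?h v) id (coact M v)"
      by (rule tensor_map_cong[OF D(1) C_module D'(1) C_module h linear_map_id _ _ t]) simp_all
    finally show ?thesis .
  qed
  then show ?thesis
    unfolding Hom_rcomod_def using restrict_Hom_mod[OF D(1) h] by simp
qed

text \<open>
  Undoing the renaming is \<open>C*\<close>-linear, so it is an element of \<open>G\<close> of the copy.
\<close>

lemma copy_decode_act:
  assumes M: "copy_of e N M" and c: "c \<in> carrier dual" and m: "m \<in> carrier M"
  shows "inv_into (carrier C) e (c \<odot>\<^bsub>comodule_left k M\<^esub> m) = c \<rightharpoonup> inv_into (carrier C) e m"
proof -
  let ?d = "inv_into (carrier C) e"
  have MC: "right_comodule k C M" and d: "linear_map k M C ?d"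
    and J: "tensor_map k C C ?d id (coact M m) = comult C (?d m)"
    using M m by (auto simp: copy_of_def)
  note D = right_comoduleD[OF MC]
  interpret M: module k M by (rule D(1))
  have "?d (c \<odot>\<^bsub>comodule_left k M\<^esub> m) = tensor_lift k C (\<lambda>m0 m1. ?d (c m1 \<odot>\<^bsub>M\<^esub> m0)) (coact M m)"
    unfolding comodule_simps
    by (rule linear_tensor_lift[OF D(1) C_module D(1) C_module d D(3)[OF m]]) (simp add: dual_app_closed[OF c])
  also have "\<dots> = tensor_lift k C (\<lambda>m0 m1. c (id m1) \<odot>\<^bsub>C\<^esub> ?d m0) (coact M m)"
    by (rule tensor_lift_cong[OF D(1) C_module C_module D(3)[OF m]])
      (simp_all add: linear_mapD[OF d] dual_app_closed[OF c])
  also have "\<dots> = c \<rightharpoonup> ?d m"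
    unfolding lact_def J[symmetric]
    by (rule tensor_lift_tensor_map[symmetric, OF D(1) C_module C_module C_module C_module d linear_map_id
          scaled_bilinear(1)[OF C_module dual_linear[OF c] linear_map_id C_module, unfolded id_apply] D(3)[OF m]])
  finally show ?thesis .
qed

section \<open>From a natural isomorphism to a symmetric coalgebra\<close>

text \<open>
  The argument of Yoneda: \<open>\<alpha>\<close> is the value of \<open>\<eta>\<close> on the identity of \<open>C\<close>, here on the map \<open>F\<close> that
  identifies the copy \<open>K\<close> of \<open>C\<close> with \<open>C\<close>. As an element of \<open>H\<close> it is left linear. Naturality along
  the translation \<open>x \<mapsto> x \<leftharpoonup> c\<close>, whose effect on the identity is the right action of \<open>c\<close>, together
  with right linearity of \<open>\<eta>\<close> gives right linearity of \<open>\<alpha>\<close>. The kernel \<open>N\<close> of \<open>\<alpha>\<close> is a subcomodule;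
  by naturality along its inclusion, \<open>\<eta>\<close> sends the inclusion \<open>N \<rightarrow> C\<close> to zero. As \<open>\<eta>\<close> is injective, the
  inclusion is zero, that is, \<open>N = 0\<close>.
\<close>

lemma isomorphic_imp_symmetric:
  fixes e :: "'c \<Rightarrow> 'm"
  assumes e: "inj_on e (carrier C)" and iso: "G_H_naturally_isomorphic TYPE('m) k C"
  shows "symmetric_coalgebra k C"
proof -
  let ?d = "inv_into (carrier C) e"
  note Cadd = M.a_closed note Cminus = M.minus_closed note Cneg = M.a_inv_closed note Csub = M.eq_if_minus_zero
  note Cdouble = M.add.r_cancel_one'
  have de: "?d (e x) = x" if "x \<in> carrier C" for x using inv_into_f_f[OF e that] .
  obtain \<eta> :: "('k, 'c, 'm) rcomodule \<Rightarrow> ('m \<Rightarrow> 'c) \<Rightarrow> ('m \<Rightarrow> 'c \<Rightarrow> 'k)" where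
    \<eta>: "\<And>M. right_comodule k C M \<Longrightarrow> \<eta> M \<in> Hom_mod dual (functor_G k C M) (functor_H k C M)"
    and bij: "\<And>M. right_comodule k C M \<Longrightarrow> bij_betw (\<eta> M) (carrier (functor_G k C M)) (carrier (functor_H k C M))"
    and nat: "\<And>M N h f. h \<in> Hom_rcomod k C M N \<Longrightarrow> right_comodule k C M \<Longrightarrow> right_comodule k C N \<Longrightarrow>
      f \<in> carrier (functor_G k C N) \<Longrightarrow> \<eta> M (compose (carrier M) f h) = compose (carrier M) (\<eta> N f) h"
    using iso unfolding G_H_naturally_isomorphic_def by blast
  obtain K where K: "copy_of e (carrier C) K"
    using copy_exists[OF e carrier_is_submodule] lact_closed by blast
  then have Kc: "right_comodule k C K" "carrier K = e ` carrier C" and dK: "linear_map k K C ?d"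
    by (auto simp: copy_of_def)
  note DK = right_comoduleD[OF Kc(1)]
  interpret K: module k K by (rule DK(1))
  have eK: "e x \<in> carrier K" if "x \<in> carrier C" for x using that by (simp add: Kc)
  have edK: "e (?d v) = v" if "v \<in> carrier K" for v using that de by (auto simp: Kc)
  note actK = comodule_act_closed[OF Kc(1)]
  define F where "F = restrict ?d (carrier K)"
  have "linear_map dual (comodule_left k K) (coalgebra_left k C) F"
    using actK copy_decode_act[OF K]
    by (intro linear_mapI) (simp_all add: F_def linear_mapD[OF dK])
  then have F: "F \<in> carrier (functor_G k C K)" by (simp add: Hom_mod_iff F_def)
  define \<Phi> where "\<Phi> = \<eta> K F"
  have \<Phi>: "\<Phi> \<in> Hom_mod dual (comodule_left k K) (left_regular dual)"
    using linear_mapD(1)[OF Hom_mod_linear[OF \<eta>[OF Kc(1)]] F] by (simp add: \<Phi>_def)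
  note P = linear_mapD[OF Hom_mod_linear[OF \<Phi>]]
  define \<alpha> where "\<alpha> = (\<lambda>x\<in>carrier C. \<Phi> (e x))"
  have e_add: "e (x \<oplus>\<^bsub>C\<^esub> y) = e x \<oplus>\<^bsub>K\<^esub> e y" if "x \<in> carrier C" "y \<in> carrier C" for x y
    using edK[of "e x \<oplus>\<^bsub>K\<^esub> e y"] that by (simp add: linear_mapD[OF dK] eK de)
  have e_act: "e (c \<rightharpoonup> x) = c \<odot>\<^bsub>comodule_left k K\<^esub> e x" if "c \<in> carrier dual" "x \<in> carrier C" for c x
    using edK[OF actK[OF that(1) eK[OF that(2)]]] copy_decode_act[OF K that(1) eK[OF that(2)]] that
    by (simp only: de)
  have "linear_map dual (coalgebra_left k C) (left_regular dual) \<alpha>"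
  proof (rule linear_mapI)
    show "\<alpha> x \<in> carrier (left_regular dual)" if "x \<in> carrier (coalgebra_left k C)" for x
      using that P(1) eK by (simp add: \<alpha>_def)
    show "\<alpha> (x \<oplus>\<^bsub>coalgebra_left k C\<^esub> y) = \<alpha> x \<oplus>\<^bsub>left_regular dual\<^esub> \<alpha> y"
      if "x \<in> carrier (coalgebra_left k C)" "y \<in> carrier (coalgebra_left k C)" for x y
      using that P(2)[of "e x" "e y"] eK by (simp add: \<alpha>_def Cadd e_add)
    show "\<alpha> (c \<odot>\<^bsub>coalgebra_left k C\<^esub> x) = c \<odot>\<^bsub>left_regular dual\<^esub> \<alpha> x"
      if "c \<in> carrier dual" "x \<in> carrier (coalgebra_left k C)" for c x
    proof -
      have x: "x \<in> carrier C" using that(2) by simp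
      have "\<alpha> (c \<rightharpoonup> x) = \<Phi> (c \<odot>\<^bsub>comodule_left k K\<^esub> e x)"
        by (simp only: \<alpha>_def restrict_apply lact_closed[OF that(1) x] e_act[OF that(1) x] if_True)
      also have "\<dots> = c \<otimes>\<^bsub>dual\<^esub> \<alpha> x" using P(3)[OF that(1), of "e x"] eK[OF x] x by (simp add: \<alpha>_def)
      finally show ?thesis by simp
    qed
  qed
  then have left: "\<alpha> \<in> Hom_mod dual (coalgebra_left k C) (left_regular dual)"
    by (simp add: Hom_mod_iff \<alpha>_def)
  note L = linear_mapD[OF Hom_mod_linear[OF left], simplified]
  have "linear_map dual (coalgebra_right k C) (right_regular dual) \<alpha>"
  proof (rule linear_mapI)
    show "\<alpha> (c \<odot>\<^bsub>coalgebra_right k C\<^esub> x) = c \<odot>\<^bsub>right_regular dual\<^esub> \<alpha> x"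
      if c: "c \<in> carrier dual" and "x \<in> carrier (coalgebra_right k C)" for c x
    proof -
      have x: "x \<in> carrier C" using that(2) by simp
      define h where "h = (\<lambda>v\<in>carrier K. e (?d v \<leftharpoonup> c))"
      have h: "h \<in> Hom_rcomod k C K K"
        unfolding h_def
        by (rule copy_hom[OF K K e subset_refl subset_refl ract_linear[OF c]])
          (simp_all add: ract_closed[OF c] comult_ract[OF c])
      have hx: "h (e x) = e (x \<leftharpoonup> c)" using eK[OF x] by (simp add: h_def de[OF x])
      have "compose (carrier K) F h = c \<odot>\<^bsub>functor_G k C K\<^esub> F"
      proof -
        have "F (h v) = F v \<leftharpoonup> c" if "v \<in> carrier K" for v
          using that eK ract_closed[OF c] linear_mapD(1)[OF dK] de by (simp add: F_def h_def)
        then show ?thesis by (auto simp: compose_def intro!: restrict_ext)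
      qed
      then have "compose (carrier K) \<Phi> h = \<eta> K (c \<odot>\<^bsub>functor_G k C K\<^esub> F)"
        using nat[OF h Kc(1) Kc(1) F] by (simp add: \<Phi>_def)
      also have "\<dots> = c \<odot>\<^bsub>functor_H k C K\<^esub> \<Phi>"
        unfolding \<Phi>_def by (rule linear_mapD(3)[OF Hom_mod_linear[OF \<eta>[OF Kc(1)]] c F])
      finally have "compose (carrier K) \<Phi> h (e x) = (c \<odot>\<^bsub>functor_H k C K\<^esub> \<Phi>) (e x)" by simp
      then show ?thesis using x eK[OF x] ract_closed[OF c x] by (simp add: compose_eq hx \<alpha>_def)
    qed
  qed (simp_all add: L)
  then have right: "\<alpha> \<in> Hom_mod dual (coalgebra_right k C) (right_regular dual)"
    by (simp add: Hom_mod_iff \<alpha>_def)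
  note pl = coalgebra_dual_map_linear[OF left]
  define N where "N = {x \<in> carrier C. \<forall>y\<in>carrier C. \<alpha> x y = \<zero>\<^bsub>k\<^esub>}"
  have Nsub: "N \<subseteq> carrier C" by (auto simp: N_def)
  have N: "submodule N k C"
  proof (rule submoduleI[OF Nsub])
    show "\<zero>\<^bsub>C\<^esub> \<in> N" using linear_map_zero[OF C_module k_module pl] C_module by (simp add: N_def)
    show "\<ominus>\<^bsub>C\<^esub> a \<in> N" if "a \<in> N" for a
    proof -
      interpret K1: module k "left_regular k" by (rule k_module)
      have "\<ominus>\<^bsub>left_regular k\<^esub> \<zero>\<^bsub>k\<^esub> = \<zero>\<^bsub>k\<^esub>" using K1.add.inv_one by (simp add: a_inv_def)
      then show ?thesis
        using that linear_map_neg[OF C_module k_module pl] Cneg by (simp add: N_def)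
    qed
    show "a \<oplus>\<^bsub>C\<^esub> b \<in> N" if "a \<in> N" "b \<in> N" for a b
      using that linear_mapD(2)[OF pl] by (simp add: N_def Cadd)
    show "r \<odot>\<^bsub>C\<^esub> a \<in> N" if "r \<in> carrier k" "a \<in> N" for r a
      using that linear_mapD(3)[OF pl] by (simp add: N_def)
  qed
  have stable: "g \<rightharpoonup> x \<in> N" if g: "g \<in> carrier dual" and x: "x \<in> N" for g x
  proof -
    have xc: "x \<in> carrier C" and z: "\<And>y. y \<in> carrier C \<Longrightarrow> \<alpha> x y = \<zero>\<^bsub>k\<^esub>" using x by (auto simp: N_def)
    have "\<alpha> (g \<rightharpoonup> x) y = \<zero>\<^bsub>k\<^esub>" if y: "y \<in> carrier C" for y
    proof -
      interpret K1: module k "left_regular k" by (rule k_module)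
      have "\<alpha> (g \<rightharpoonup> x) y = tensor_lift k (left_regular k) (\<lambda>y1 y2. g y1 \<otimes>\<^bsub>k\<^esub> \<alpha> x y2) (comult C y)"
        using L(3)[OF g xc] dual_mult[OF y] by simp
      also have "\<dots> = tensor_lift k (left_regular k) (\<lambda>y1 y2. \<zero>\<^bsub>left_regular k\<^esub>) (comult C y)"
        by (rule tensor_lift_cong[OF C_module C_module k_module comult_closed[OF y]])
          (simp_all add: z dual_app_closed[OF g])
      also have "\<dots> = \<zero>\<^bsub>left_regular k\<^esub>"
        by (rule tensor_lift_zero[OF C_module C_module k_module comult_closed[OF y]]) simp
      finally show ?thesis by simp
    qed
    then show ?thesis using lact_closed[OF g xc] by (simp add: N_def)
  qed
  obtain M where M: "copy_of e N M" using copy_exists[OF e N stable] by blast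
  then have Mc: "right_comodule k C M" "carrier M = e ` N" by (auto simp: copy_of_def)
  define h where "h = (\<lambda>v\<in>carrier M. e (id (?d v)))"
  have h: "h \<in> Hom_rcomod k C M K"
    unfolding h_def
    by (rule copy_hom[OF M K e Nsub subset_refl linear_map_id])
      (use Nsub comult_closed in \<open>auto simp: tensor_map_ident[OF C_module C_module]\<close>)
  have hv: "h v = v" if "v \<in> carrier M" for v
    using that Nsub de by (auto simp: h_def Mc(2))
  define f where "f = compose (carrier M) F h"
  have f: "f \<in> carrier (functor_G k C M)"
    unfolding f_def by (rule functor_G_closed(3)[OF Kc(1) F Mc(1) h])
  have ff: "f \<oplus>\<^bsub>functor_G k C M\<^esub> f \<in> carrier (functor_G k C M)" by (rule functor_G_closed(1)[OF Mc(1) f f])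
  have \<eta>f: "\<eta> M f v = \<zero>\<^bsub>dual\<^esub>" if v: "v \<in> carrier M" for v
  proof -
    obtain x where x: "x \<in> N" "v = e x" using v by (auto simp: Mc(2))
    then have xc: "x \<in> carrier C" using Nsub by auto
    have "\<eta> M f v = \<Phi> v"
      using fun_cong[OF nat[OF h Mc(1) Kc(1) F], of v] v hv[OF v] by (simp add: f_def \<Phi>_def compose_eq)
    also have "\<dots> = \<alpha> x" using x xc by (simp add: \<alpha>_def)
    also have "\<dots> = \<zero>\<^bsub>dual\<^esub>"
      by (rule dual_eqI[OF L(1)[OF xc] dual_zero_closed]) (use x in \<open>simp add: N_def dual_zero\<close>)
    finally show ?thesis .
  qed
  \<comment> \<open>Both \<open>f + f\<close> and \<open>f\<close> are sent to zero, so they are equal and \<open>f\<close> vanishes.\<close>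
  have "\<eta> M (f \<oplus>\<^bsub>functor_G k C M\<^esub> f) = \<eta> M f"
  proof (rule Hom_mod_eqI)
    show "\<eta> M (f \<oplus>\<^bsub>functor_G k C M\<^esub> f) \<in> Hom_mod dual (comodule_left k M) (left_regular dual)"
      "\<eta> M f \<in> Hom_mod dual (comodule_left k M) (left_regular dual)"
      using linear_mapD(1)[OF Hom_mod_linear[OF \<eta>[OF Mc(1)]]] f ff by simp_all
    fix v assume "v \<in> carrier (comodule_left k M)"
    then have v: "v \<in> carrier M" by simp
    have "\<eta> M (f \<oplus>\<^bsub>functor_G k C M\<^esub> f) v = \<zero>\<^bsub>dual\<^esub> \<oplus>\<^bsub>dual\<^esub> \<zero>\<^bsub>dual\<^esub>"
      unfolding linear_mapD(2)[OF Hom_mod_linear[OF \<eta>[OF Mc(1)]] f f] using v \<eta>f[OF v] by simp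
    also have "\<dots> = \<zero>\<^bsub>dual\<^esub>"
      by (auto simp: dual_algebra_def intro!: restrict_ext)
    finally show "\<eta> M (f \<oplus>\<^bsub>functor_G k C M\<^esub> f) v = \<eta> M f v" by (simp add: \<eta>f[OF v])
  qed
  then have fff: "f \<oplus>\<^bsub>functor_G k C M\<^esub> f = f"
    using bij_betw_imp_inj_on[OF bij[OF Mc(1)]] f ff by (auto dest: inj_onD)
  have N0: "x = \<zero>\<^bsub>C\<^esub>" if x: "x \<in> N" for x
  proof -
    have xc: "x \<in> carrier C" and v: "e x \<in> carrier M" using x Nsub by (auto simp: Mc(2))
    have "f (e x) = x" using v hv[OF v] eK[OF xc] by (simp add: f_def compose_eq F_def de[OF xc])
    then have "x \<oplus>\<^bsub>C\<^esub> x = x" using fun_cong[OF fff, of "e x"] v by simp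
    then show ?thesis using Cdouble[OF xc xc] by simp
  qed
  have "inj_on \<alpha> (carrier C)"
  proof (rule inj_onI)
    fix x y assume xy: "x \<in> carrier C" "y \<in> carrier C" and eq: "\<alpha> x = \<alpha> y"
    have "\<alpha> (x \<ominus>\<^bsub>C\<^esub> y) z = \<zero>\<^bsub>k\<^esub>" if z: "z \<in> carrier C" for z
    proof -
      interpret K1: module k "left_regular k" by (rule k_module)
      have "\<alpha> y z \<in> carrier (left_regular k)" using linear_mapD(1)[OF pl[OF z] xy(2)] .
      then have "\<alpha> y z \<ominus>\<^bsub>left_regular k\<^esub> \<alpha> y z = \<zero>\<^bsub>left_regular k\<^esub>"
        unfolding a_minus_def by (rule K1.r_neg)
      then show ?thesis using linear_map_minus[OF C_module k_module pl[OF z] xy] eq by simp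
    qed
    then have "x \<ominus>\<^bsub>C\<^esub> y \<in> N" using xy Cminus by (simp add: N_def)
    then show "x = y" using Csub[OF xy N0] by blast
  qed
  then show ?thesis using left right by (auto simp: symmetric_coalgebra_def Let_def)
qed

end

theorem theorem6p3:
  fixes k :: "('k, 'x) ring_scheme" and C :: "('k, 'c, 'y) coalgebra_scheme"
  assumes "coalgebra k C"
  shows "(symmetric_coalgebra k C \<longrightarrow> G_H_naturally_isomorphic TYPE('m) k C) \<and>
    (large_universe TYPE('m) C \<and> semiperfect TYPE('m) k C \<and>
      G_H_naturally_isomorphic TYPE('m) k C \<longrightarrow> symmetric_coalgebra k C)"
proof -
  interpret coalgebra k C by fact
  show ?thesis
    using symmetric_imp_isomorphic isomorphic_imp_symmetric by (auto simp: large_universe_def)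
qed

end
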